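(* Let $N\in\mathbb{N}$ and $p\in\{0\}\cup[1,\infty)$. Then $L_p^{\rm SIT}(\lambda^N)$, $L_p^{\rm quantile}(\lambda^N)$ and $L_p^{\rm IT}(\lambda^N)$ are convex cones, and: (1) The $\|\cdot\|_p$-closure of $L_p^{\rm quantile}(\lambda^N)$ is precisely $L_p^{\rm IT}(\lambda^N)$. In particular, the metric completion of $(\mathcal{P}_p(\mathbb{R}^N),\mathcal{KR}_p)$ is $L_p^{\rm IT}(\lambda^N)$ up to isometry. (2) $\mu\in\mathcal{P}_p(\mathbb{R}^N)$ is triangular regular if and only if $Q^\mu\in L_p^{\rm SIT}(\lambda^N)$. (3) $L_p^{\rm SIT}(\lambda^N)$ is a dense subset of $L_p^{\rm quantile}(\lambda^N)$.
   Context: $\lambda$ is Lebesgue measure on $(0,1)$ and $\lambda^N$ the product measure on $(0,1)^N$. For $p\in[1,\infty)$, $|x|_p^p:=\sum_i|x_i|^p$, $\mathcal{P}_p(\mathbb{R}^N)$ is the set of Borel probability measures on $\mathbb{R}^N$ with finite $p$-th moment, and $L_p(\lambda^N)=L_p(\lambda^N;\mathbb{R}^N)$ carries $\|f\|_p=(\int|f|_p^p\,d\lambda^N)^{1/p}$. For $p=0$, $\mathcal{P}_0(\mathbb{R}^N)$ is the set of all Borel probability measures, $L_0(\lambda^N)$ is the space of all measurable maps $(0,1)^N\to\mathbb{R}^N$ (modulo a.e. equality) with distance $\|f-g\|_0:=\int(|f-g|\wedge1)\,d\lambda^N$; "$0$-integrable" means measurable. A (measurable) map $T=(T_k)_{k=1}^N:(0,1)^N\to\mathbb{R}^N$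 is triangular if each $T_k$ depends only on the first $k$ variables. Consider, for all $k\le m\le N$ and $u_1,\dots,u_m,u_k'\in(0,1)$: (inc) $u_k\le u_k'$ implies $T_k(u_1,\dots,u_k)\le T_k(u_1,\dots,u_{k-1},u_k')$; (sinc) $u_k<u_k'$ implies $T_k(u_1,\dots,u_k)<T_k(u_1,\dots,u_{k-1},u_k')$; (con) $T_k(u_1,\dots,u_k)=T_k(u_1,\dots,u_{k-1},u_k')$ implies $T_m(u_1,\dots,u_k,\dots,u_m)=T_m(u_1,\dots,u_k',\dots,u_m)$. A triangular $T$ is increasing if it satisfies (inc), strictly increasing if it satisfies (sinc), and a quantile process if it satisfies (inc) and (con). $L_p^{\rm IT}(\lambda^N)$, $L_p^{\rm SIT}(\lambda^N)$, $L_p^{\rm quantile}(\lambda^N)$ denote the sets of (classes in $L_p(\lambda^N)$ of) $p$-integrable increasing triangular maps, strictly increasing triangular maps, and quantile processes, respectively. For every $\mu\in\mathcal{P}_0(\mathbb{R}^N)$ there is a $\lambda^N$-a.s. unique quantile process $Q^\mu$ with $Q^\mu_\#\lambda^N=\mu$. Explicitly, writing $\mu(dx)=\mu_1(dx_1)\mu_2^{x_1}(dx_2)\cdots\mu_N^{x_1,\dots,x_{N-1}}(dx_N)$ for the successive disintegration, $Q^\mu_k(u_1,\dots,u_k)$ is the value at $u_k$ of the quantile function of $\mu_k^{Q^\mu_1(u_1),\dots,Q^\mu_{k-1}(u_1,\dots,u_{k-1})}$. $\mu$ is triangular regular if for $\mu$-a.e. $x$ all the kernels $\mu_k^{x_1,\dots,x_{k-1}}$,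 $k\le N$, are atom free. $\mathcal{KR}_p(\mu,\nu):=\|Q^\mu-Q^\nu\|_p$ for $\mu,\nu\in\mathcal{P}_p(\mathbb{R}^N)$. A convex cone is a set closed under addition and under multiplication by positive scalars. *)

theory Defs
  imports "HOL-Probability.Probability"
begin

text \<open>
  Points of \<open>\<real>\<^sup>N\<close> are functions in \<open>space (RN N)\<close>, that is, \<open>nat \<Rightarrow> real\<close> restricted to the
  index set \<open>{0..<N}\<close> and \<open>undefined\<close> elsewhere.  Coordinates are counted from 0, so the first
  \<open>k\<close> variables are those with index in \<open>{0..<k}\<close>.
\<close>

abbreviation RN :: "nat \<Rightarrow> (nat \<Rightarrow> real) measure" where
  "RN N \<equiv> PiM {0..<N} (\<lambda>_. borel)"

definition cube :: "nat \<Rightarrow> (nat \<Rightarrow> real) measure" where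
  "cube N = PiM {0..<N} (\<lambda>_. restrict_space lborel {0<..<1})"

subsection \<open>The spaces $L_p$, $p \in \{0\} \cup [1,\infty)$\<close>

definition pow_sum :: "nat \<Rightarrow> real \<Rightarrow> (nat \<Rightarrow> real) \<Rightarrow> real" where
  "pow_sum N p x = (\<Sum>i\<in>{0..<N}. \<bar>x i\<bar> powr p)"

definition p_integrable :: "nat \<Rightarrow> real \<Rightarrow> ((nat \<Rightarrow> real) \<Rightarrow> (nat \<Rightarrow> real)) \<Rightarrow> bool" where
  "p_integrable N p f \<longleftrightarrow>
     f \<in> measurable (cube N) (RN N) \<and> (p \<noteq> 0 \<longrightarrow> integrable (cube N) (\<lambda>u. pow_sum N p (f u)))"

text \<open>For \<open>p = 0\<close> the vector norm in the truncated distance is the Euclidean one.\<close>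

definition fun_dist ::
  "nat \<Rightarrow> real \<Rightarrow> ((nat \<Rightarrow> real) \<Rightarrow> (nat \<Rightarrow> real)) \<Rightarrow> ((nat \<Rightarrow> real) \<Rightarrow> (nat \<Rightarrow> real)) \<Rightarrow> real" where
  "fun_dist N p f g =
     (if p = 0 then (\<integral>u. min (L2_set (\<lambda>i. f u i - g u i) {0..<N}) 1 \<partial>cube N)
      else (\<integral>u. pow_sum N p (\<lambda>i. f u i - g u i) \<partial>cube N) powr (1 / p))"

text \<open>
  The a.e.-class of \<open>f\<close> does not depend on \<open>p\<close>: a measurable map that is a.e. equal to a
  \<open>p\<close>-integrable one is itself \<open>p\<close>-integrable.
\<close>

definition ae_class ::
  "nat \<Rightarrow> ((nat \<Rightarrow> real) \<Rightarrow> (nat \<Rightarrow> real)) \<Rightarrow> ((nat \<Rightarrow> real) \<Rightarrow> (nat \<Rightarrow> real)) set" where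
  "ae_class N f = {g \<in> measurable (cube N) (RN N). AE u in cube N. g u = f u}"

definition representative ::
  "((nat \<Rightarrow> real) \<Rightarrow> (nat \<Rightarrow> real)) set \<Rightarrow> (nat \<Rightarrow> real) \<Rightarrow> (nat \<Rightarrow> real)" where
  "representative F = (SOME f. f \<in> F)"

definition Lp :: "nat \<Rightarrow> real \<Rightarrow> ((nat \<Rightarrow> real) \<Rightarrow> (nat \<Rightarrow> real)) set set" where
  "Lp N p = {ae_class N f | f. p_integrable N p f}"

definition Lp_dist ::
  "nat \<Rightarrow> real \<Rightarrow> ((nat \<Rightarrow> real) \<Rightarrow> (nat \<Rightarrow> real)) set \<Rightarrow> ((nat \<Rightarrow> real) \<Rightarrow> (nat \<Rightarrow> real)) set \<Rightarrow> real" where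
  "Lp_dist N p F G = fun_dist N p (representative F) (representative G)"

definition Lp_add ::
  "nat \<Rightarrow> ((nat \<Rightarrow> real) \<Rightarrow> (nat \<Rightarrow> real)) set \<Rightarrow> ((nat \<Rightarrow> real) \<Rightarrow> (nat \<Rightarrow> real)) set
    \<Rightarrow> ((nat \<Rightarrow> real) \<Rightarrow> (nat \<Rightarrow> real)) set" where
  "Lp_add N F G = ae_class N (\<lambda>u. \<lambda>i\<in>{0..<N}. representative F u i + representative G u i)"

definition Lp_scale ::
  "nat \<Rightarrow> real \<Rightarrow> ((nat \<Rightarrow> real) \<Rightarrow> (nat \<Rightarrow> real)) set \<Rightarrow> ((nat \<Rightarrow> real) \<Rightarrow> (nat \<Rightarrow> real)) set" where
  "Lp_scale N c F = ae_class N (\<lambda>u. \<lambda>i\<in>{0..<N}. c * representative F u i)"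

definition Lp_convex_cone :: "nat \<Rightarrow> ((nat \<Rightarrow> real) \<Rightarrow> (nat \<Rightarrow> real)) set set \<Rightarrow> bool" where
  "Lp_convex_cone N S \<longleftrightarrow>
     (\<forall>F\<in>S. \<forall>G\<in>S. Lp_add N F G \<in> S) \<and> (\<forall>c>0. \<forall>F\<in>S. Lp_scale N c F \<in> S)"

abbreviation Lp_topology :: "nat \<Rightarrow> real \<Rightarrow> ((nat \<Rightarrow> real) \<Rightarrow> (nat \<Rightarrow> real)) set topology" where
  "Lp_topology N p \<equiv> Metric_space.mtopology (Lp N p) (Lp_dist N p)"

subsection \<open>Triangular maps\<close>

definition triangular :: "nat \<Rightarrow> ((nat \<Rightarrow> real) \<Rightarrow> (nat \<Rightarrow> real)) \<Rightarrow> bool" where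
  "triangular N T \<longleftrightarrow>
     T \<in> measurable (cube N) (RN N) \<and>
     (\<forall>k<N. \<forall>u\<in>space (cube N). \<forall>u'\<in>space (cube N).
        (\<forall>j\<le>k. u j = u' j) \<longrightarrow> T u k = T u' k)"

text \<open>
  For triangular \<open>T\<close> the value \<open>T u k\<close> is \<open>T\<^sub>k(u\<^sub>1,\<dots>,u\<^sub>k)\<close>, and replacing \<open>u\<^sub>k\<close> by \<open>v\<close> is
  \<open>u(k := v)\<close>.
\<close>

definition prop_inc :: "nat \<Rightarrow> ((nat \<Rightarrow> real) \<Rightarrow> (nat \<Rightarrow> real)) \<Rightarrow> bool" where
  "prop_inc N T \<longleftrightarrow>
     (\<forall>k<N. \<forall>u\<in>space (cube N). \<forall>v\<in>{0<..<1}. u k \<le> v \<longrightarrow> T u k \<le> T (u(k := v)) k)"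

definition prop_sinc :: "nat \<Rightarrow> ((nat \<Rightarrow> real) \<Rightarrow> (nat \<Rightarrow> real)) \<Rightarrow> bool" where
  "prop_sinc N T \<longleftrightarrow>
     (\<forall>k<N. \<forall>u\<in>space (cube N). \<forall>v\<in>{0<..<1}. u k < v \<longrightarrow> T u k < T (u(k := v)) k)"

definition prop_con :: "nat \<Rightarrow> ((nat \<Rightarrow> real) \<Rightarrow> (nat \<Rightarrow> real)) \<Rightarrow> bool" where
  "prop_con N T \<longleftrightarrow>
     (\<forall>k<N. \<forall>m. k \<le> m \<and> m < N \<longrightarrow>
        (\<forall>u\<in>space (cube N). \<forall>v\<in>{0<..<1}.
           T u k = T (u(k := v)) k \<longrightarrow> T u m = T (u(k := v)) m))"

definition increasing_triangular :: "nat \<Rightarrow> ((nat \<Rightarrow> real) \<Rightarrow> (nat \<Rightarrow> real)) \<Rightarrow> bool" where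
  "increasing_triangular N T \<longleftrightarrow> triangular N T \<and> prop_inc N T"

definition strictly_increasing_triangular :: "nat \<Rightarrow> ((nat \<Rightarrow> real) \<Rightarrow> (nat \<Rightarrow> real)) \<Rightarrow> bool" where
  "strictly_increasing_triangular N T \<longleftrightarrow> triangular N T \<and> prop_sinc N T"

definition quantile_process :: "nat \<Rightarrow> ((nat \<Rightarrow> real) \<Rightarrow> (nat \<Rightarrow> real)) \<Rightarrow> bool" where
  "quantile_process N T \<longleftrightarrow> triangular N T \<and> prop_inc N T \<and> prop_con N T"

definition Lp_IT :: "nat \<Rightarrow> real \<Rightarrow> ((nat \<Rightarrow> real) \<Rightarrow> (nat \<Rightarrow> real)) set set" where
  "Lp_IT N p = {ae_class N T | T. p_integrable N p T \<and> increasing_triangular N T}"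

definition Lp_SIT :: "nat \<Rightarrow> real \<Rightarrow> ((nat \<Rightarrow> real) \<Rightarrow> (nat \<Rightarrow> real)) set set" where
  "Lp_SIT N p = {ae_class N T | T. p_integrable N p T \<and> strictly_increasing_triangular N T}"

definition Lp_quantile :: "nat \<Rightarrow> real \<Rightarrow> ((nat \<Rightarrow> real) \<Rightarrow> (nat \<Rightarrow> real)) set set" where
  "Lp_quantile N p = {ae_class N T | T. p_integrable N p T \<and> quantile_process N T}"

subsection \<open>Probability measures on $\mathbb{R}^N$\<close>

definition Pp :: "nat \<Rightarrow> real \<Rightarrow> (nat \<Rightarrow> real) measure set" where
  "Pp N p = {\<mu> \<in> space (prob_algebra (RN N)). p \<noteq> 0 \<longrightarrow> integrable \<mu> (pow_sum N p)}"

text \<open>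
  \<open>Q N \<mu>\<close> is the a.e.-class of the quantile process with law \<open>\<mu>\<close>, which is unique only up to
  null sets.
\<close>

definition Q :: "nat \<Rightarrow> (nat \<Rightarrow> real) measure \<Rightarrow> ((nat \<Rightarrow> real) \<Rightarrow> (nat \<Rightarrow> real)) set" where
  "Q N \<mu> =
     (THE F. \<exists>T. quantile_process N T \<and> distr (cube N) (RN N) T = \<mu> \<and> F = ae_class N T)"

definition KR :: "nat \<Rightarrow> real \<Rightarrow> (nat \<Rightarrow> real) measure \<Rightarrow> (nat \<Rightarrow> real) measure \<Rightarrow> real" where
  "KR N p \<mu> \<nu> = Lp_dist N p (Q N \<mu>) (Q N \<nu>)"

text \<open>
  \<open>K k x\<close> is the conditional law of coordinate \<open>k\<close> given the coordinates \<open>x\<close> in \<open>{0..<k}\<close>, and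
  \<open>Ionescu_Tulcea.C K (\<lambda>_. borel) 0 N (\<lambda>_. undefined)\<close> is the iterated composition
  \<open>K 0 (dx\<^sub>0) K 1 x\<^sub>0 (dx\<^sub>1) \<dots> K (N - 1) (x\<^sub>0,\<dots>) (dx\<^sub>N\<^sub>-\<^sub>1)\<close>, started at the only point of
  \<open>\<real>\<^sup>0\<close>.  The locale asks for probability kernels at all indices; those with index at least
  \<open>N\<close> are arbitrary and play no role.
\<close>

definition disintegration ::
  "nat \<Rightarrow> (nat \<Rightarrow> real) measure \<Rightarrow> (nat \<Rightarrow> (nat \<Rightarrow> real) \<Rightarrow> real measure) \<Rightarrow> bool" where
  "disintegration N \<mu> K \<longleftrightarrow>
     Ionescu_Tulcea K (\<lambda>_. borel) \<and>
     \<mu> = Ionescu_Tulcea.C K (\<lambda>_. borel) 0 N (\<lambda>_. undefined)"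

text \<open>
  The kernels of a disintegration are unique up to null sets, so the following property does
  not depend on the choice of \<open>K\<close>.
\<close>

definition triangular_regular :: "nat \<Rightarrow> (nat \<Rightarrow> real) measure \<Rightarrow> bool" where
  "triangular_regular N \<mu> \<longleftrightarrow>
     (\<exists>K. disintegration N \<mu> K \<and>
        (AE x in \<mu>. \<forall>k<N. \<forall>a. emeasure (K k (restrict x {0..<k})) {a} = 0))"

subsection \<open>Metric completion\<close>

text \<open>
  \<open>(M', d')\<close> is, up to isometry, the metric completion of \<open>(M, d)\<close>.
\<close>

definition metric_completion_of ::
  "'a set \<Rightarrow> ('a \<Rightarrow> 'a \<Rightarrow> real) \<Rightarrow> 'b set \<Rightarrow> ('b \<Rightarrow> 'b \<Rightarrow> real) \<Rightarrow> bool" where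
  "metric_completion_of M d M' d' \<longleftrightarrow>
     Metric_space M d \<and> Metric_space M' d' \<and> Metric_space.mcomplete M' d' \<and>
     (\<exists>\<iota>. \<iota> \<in> M \<rightarrow> M' \<and>
          (\<forall>x\<in>M. \<forall>y\<in>M. d' (\<iota> x) (\<iota> y) = d x y) \<and>
          Metric_space.mtopology M' d' closure_of (\<iota> ` M) = M')"

end

theory Submission
  imports Defs
begin

text \<open>
  Call \<open>g\<close> a step over \<open>M\<close> if \<open>g x v\<close> is measurable in \<open>(x, v)\<close> and increasing in \<open>v \<in> (0, 1)\<close>. A sequence of
  steps \<open>G\<^sub>k\<close> over \<open>\<real>\<^sup>k\<close> yields a quantile process by the recursion \<open>T\<^sub>k(u) = G\<^sub>k(T\<^sub>0(u), \<dots>, T\<^sub>k\<^sub>-\<^sub>1(u))(u\<^sub>k)\<close>, whose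
  law has the laws of \<open>G\<^sub>k(x)\<close> as successive kernels. Every quantile process is of this form: by (con),
  \<open>T\<^sub>k\<close> depends on the earlier inputs only through the earlier outputs, and a measurable right inverse of
  the earlier outputs is obtained from the midpoints of the fibres, which are intervals.
  Existence and uniqueness of \<open>Q\<close> thus reduce to one step: existence by inverting conditional
  distribution functions given by Radon-Nikodym derivatives, uniqueness since increasing functions with
  equal laws agree almost everywhere. Atoms of the kernels are the plateaus of the steps, whence (2).

  Adding \<open>\<epsilon> u\<close> makes an increasing triangular map strictly increasing, so the smallest of the three cones
  is dense in the largest. The latter is complete, since a fast Cauchy subsequence converges almost
  everywhere and the pointwise limit superior preserves monotonicity.
\<close>


subsection \<open>The unit cube\<close>

text \<open>Laws determine maps only up to null sets, whereas (inc), (sinc) and (con) are demanded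
  at every point of the cube. Each construction therefore carries a harmless value for the
  exceptional set (the identity step, 1/2 or 0), chosen so that measurability and monotonicity hold
  without exception. The second constraint is measurability in parameters: infima, suprema,
  strictness and finiteness along a fibre are tested at rational points, and monotonicity extends
  the result to the whole fibre. Midpoints are preferred to end points because an end point of a
  fibre may lie outside it, or even outside (0, 1).

  The closure in (1) is larger than the set of quantile processes because (con) is lost in limits:
  for \<open>N = 2\<close> the maps \<open>(u1 / n, u1)\<close> are quantile processes, but their
  limit \<open>(0, u1)\<close> is not even almost everywhere equal to one, the quantile process with
  the same law being \<open>(0, u2)\<close>. Property (inc) survives, and the perturbation restores
  (con) by making every fibre a single point.\<close>

abbreviation unit_measure :: "real measure" where
  "unit_measure \<equiv> restrict_space lborel {0<..<1}"

lemma prob_space_unit_measure: "prob_space unit_measure"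
  by (rule prob_spaceI) (simp add: space_restrict_space emeasure_restrict_space)

interpretation unit: prob_space unit_measure
  by (rule prob_space_unit_measure)

interpretation cubes: product_sigma_finite "\<lambda>_::nat. unit_measure"
  by unfold_locales

lemma space_unit_measure [simp]: "space unit_measure = {0<..<1}"
  by (simp add: space_restrict_space)

lemma sets_unit_measure [measurable_cong]: "sets unit_measure = sets (restrict_space borel {0<..<1})"
  by (simp add: sets_restrict_space)

lemma prob_space_cube: "prob_space (cube N)"
  unfolding cube_def by (rule prob_space_PiM) (rule prob_space_unit_measure)

interpretation cube: prob_space "cube N" for N
  by (rule prob_space_cube)

lemma space_cube: "space (cube N) = {0..<N} \<rightarrow>\<^sub>E {0<..<1}"
  by (simp add: cube_def space_PiM)

lemma space_RN: "space (RN N) = extensional {0..<N}"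
  by (simp add: space_PiM PiE_def)

lemma measurable_unit_measure_iff:
  "f \<in> measurable M unit_measure \<longleftrightarrow> f \<in> borel_measurable M \<and> f \<in> space M \<rightarrow> {0<..<1}"
  by (subst measurable_cong_sets[OF refl sets_unit_measure], subst measurable_restrict_space2_iff) auto

lemma cube_upd_in: "u \<in> space (cube N) \<Longrightarrow> v \<in> {0<..<1} \<Longrightarrow> k < N \<Longrightarrow> u(k := v) \<in> space (cube N)"
  by (auto simp: space_cube PiE_iff extensional_def)

lemma measurable_cube_component: "k < N \<Longrightarrow> (\<lambda>u. u k) \<in> measurable (cube N) unit_measure"
  unfolding cube_def by simp

lemma measurable_cube_component_borel: "k < N \<Longrightarrow> (\<lambda>u. u k) \<in> borel_measurable (cube N)"
  using measurable_cube_component measurable_unit_measure_iff by blast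

lemma measurable_cube_upd:
  assumes "k < N" "f \<in> measurable M (cube N)" "g \<in> measurable M unit_measure"
  shows "(\<lambda>x. (f x)(k := g x)) \<in> measurable M (cube N)"
  unfolding cube_def
  by (rule measurable_fun_upd[where J="{0..<N}"]) (use assms in \<open>auto simp: cube_def\<close>)

text \<open>On a box the old coordinate \<open>k\<close> is unconstrained and contributes the factor
  1, while the fresh variable contributes the side \<open>A k\<close>. Resampling one coordinate
  thus preserves the product measure.\<close>

lemma distr_cube_upd:
  assumes k: "k < N"
  shows "distr (cube N \<Otimes>\<^sub>M unit_measure) (cube N) (\<lambda>(u, v). u(k := v)) = cube N"
proof -
  have m: "(\<lambda>(u, v). u(k := v)) \<in> measurable (cube N \<Otimes>\<^sub>M unit_measure) (cube N)"
    unfolding split_beta by (rule measurable_cube_upd[OF k]) auto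
  show ?thesis
  proof (rule cubes.PiM_eqI[of "{0..<N}", folded cube_def])
    fix A :: "nat \<Rightarrow> real set"
    assume A: "\<And>i. i \<in> {0..<N} \<Longrightarrow> A i \<in> sets unit_measure"
    let ?B = "Pi\<^sub>E {0..<N} (A(k := {0<..<1}))"
    have sets_unit: "{0<..<1} \<in> sets unit_measure"
      using sets.top[of unit_measure] by simp
    have pre: "(\<lambda>(u, v). u(k := v)) -` Pi\<^sub>E {0..<N} A \<inter> space (cube N \<Otimes>\<^sub>M unit_measure) = ?B \<times> A k"
      using k sets.sets_into_space[OF A] 
      by (auto simp: space_pair_measure space_cube PiE_iff extensional_def split: if_splits)
         (metis atLeastLessThan_iff greaterThanLessThan_iff space_unit_measure subsetD zero_le)+
    have B: "?B \<in> sets (cube N)"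
      unfolding cube_def using A sets_unit by (intro sets_PiM_I_finite) auto
    have PA: "Pi\<^sub>E {0..<N} A \<in> sets (cube N)"
      unfolding cube_def using A by (intro sets_PiM_I_finite) auto
    have "emeasure (distr (cube N \<Otimes>\<^sub>M unit_measure) (cube N) (\<lambda>(u, v). u(k := v))) (Pi\<^sub>E {0..<N} A)
        = emeasure (cube N) ?B * emeasure unit_measure (A k)"
      using k A by (simp add: emeasure_distr[OF m PA] pre unit.emeasure_pair_measure_Times[OF B])
    also have "emeasure (cube N) ?B = (\<Prod>i\<in>{0..<N}. emeasure unit_measure ((A(k := {0<..<1})) i))"
      unfolding cube_def using A sets_unit by (intro cubes.emeasure_PiM) auto
    also have "\<dots> = (\<Prod>i\<in>{0..<N} - {k}. emeasure unit_measure (A i))"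
      using k unit.emeasure_space_1 by (subst prod.remove[of _ k]) (auto intro!: prod.cong)
    also have "\<dots> * emeasure unit_measure (A k) = (\<Prod>i\<in>{0..<N}. emeasure unit_measure (A i))"
      using k by (subst (2) prod.remove[of _ k]) (auto simp: mult.commute)
    finally show "emeasure (distr (cube N \<Otimes>\<^sub>M unit_measure) (cube N) (\<lambda>(u, v). u(k := v))) (Pi\<^sub>E {0..<N} A)
        = (\<Prod>i\<in>{0..<N}. emeasure unit_measure (A i))" .
  qed (simp_all add: cube_def)
qed

text \<open>Fubini along the lines in direction \<open>k\<close>: a null set of the cube meets
  almost every such line in a null set. This serves where a property of a whole line is to be
  derived from almost sure convergence.\<close>

lemma AE_cube_upd:
  assumes k: "k < N" and P: "AE u in cube N. P u"
  shows "AE u in cube N. AE v in unit_measure. P (u(k := v))"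
proof -
  have m: "(\<lambda>(u, v). u(k := v)) \<in> measurable (cube N \<Otimes>\<^sub>M unit_measure) (cube N)"
    unfolding split_beta by (rule measurable_cube_upd[OF k]) auto
  interpret pair_sigma_finite "cube N" unit_measure ..
  have "AE x in cube N \<Otimes>\<^sub>M unit_measure. P ((\<lambda>(u, v). u(k := v)) x)"
    using P by (intro AE_distrD[OF m]) (subst distr_cube_upd[OF k])
  then show ?thesis
    by (auto dest: AE_pair)
qed

text \<open>\<open>distr_pair_PiM_eq_PiM\<close> puts the new coordinate into the first factor, so
  the factors are swapped; in the recursion the last input comes second.\<close>

lemma distr_cube_Suc:
  "distr (cube N \<Otimes>\<^sub>M unit_measure) (cube (Suc N)) (\<lambda>(u, v). u(N := v)) = cube (Suc N)"
proof -
  have ins: "{0..<Suc N} = insert N {0..<N}" by auto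
  have *: "distr (unit_measure \<Otimes>\<^sub>M cube N) (cube (Suc N)) (\<lambda>(v, u). u(N := v)) = cube (Suc N)"
    unfolding cube_def ins by (rule distr_pair_PiM_eq_PiM) (auto simp: prob_space_unit_measure)
  interpret pair_sigma_finite "cube N" unit_measure ..
  have "distr (cube N \<Otimes>\<^sub>M unit_measure) (cube (Suc N)) (\<lambda>(u, v). u(N := v)) =
    distr (distr (unit_measure \<Otimes>\<^sub>M cube N) (cube N \<Otimes>\<^sub>M unit_measure) (\<lambda>(x, y). (y, x)))
      (cube (Suc N)) (\<lambda>(u, v). u(N := v))"
    by (subst distr_pair_swap) (rule refl)
  also have "\<dots> = distr (unit_measure \<Otimes>\<^sub>M cube N) (cube (Suc N)) (\<lambda>(v, u). u(N := v))"
  proof (subst distr_distr)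
    show "(\<lambda>(u, v). u(N := v)) \<in> measurable (cube N \<Otimes>\<^sub>M unit_measure) (cube (Suc N))"
      unfolding split_beta cube_def
      by (rule measurable_fun_upd[where J="{0..<N}"]) (auto simp: ins)
  qed (auto intro!: distr_cong)
  finally show ?thesis
    unfolding * .
qed

subsection \<open>Increasing functions of a uniform variable\<close>

text \<open>With \<open>V\<close> uniform, \<open>g x V\<close> realises a probability kernel on the
  line by an increasing function. Monotonicity is demanded at every \<open>x\<close>, since the
  conditions on triangular maps hold at every point.\<close>

definition step :: "'a measure \<Rightarrow> ('a \<Rightarrow> real \<Rightarrow> real) \<Rightarrow> bool" where
  "step M g \<longleftrightarrow> case_prod g \<in> borel_measurable (M \<Otimes>\<^sub>M unit_measure) \<and>
     (\<forall>x\<in>space M. mono_on {0<..<1} (g x))"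

lemma step_mono: "step M g \<Longrightarrow> x \<in> space M \<Longrightarrow> mono_on {0<..<1} (g x)"
  by (simp add: step_def)

lemma step_measurable: "step M g \<Longrightarrow> case_prod g \<in> borel_measurable (M \<Otimes>\<^sub>M unit_measure)"
  by (simp add: step_def)

lemma step_measurable2:
  assumes "step M g" "f \<in> measurable L M" "h \<in> measurable L unit_measure"
  shows "(\<lambda>x. g (f x) (h x)) \<in> borel_measurable L"
  using measurable_compose[OF measurable_Pair[OF assms(2,3)] step_measurable[OF assms(1)]] by simp

text \<open>The joint law of \<open>x\<close> and \<open>g x V\<close> for \<open>V\<close> uniform
  and independent of \<open>x\<close>; its conditional law given \<open>x\<close> is that of
  \<open>g x V\<close>.\<close>

definition step_law :: "'a measure \<Rightarrow> ('a \<Rightarrow> real \<Rightarrow> real) \<Rightarrow> ('a \<times> real) measure" where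
  "step_law M g = distr (M \<Otimes>\<^sub>M unit_measure) (M \<Otimes>\<^sub>M borel) (\<lambda>(x, v). (x, g x v))"

lemma measurable_step_pair:
  assumes "step M g"
  shows "(\<lambda>(x, v). (x, g x v)) \<in> measurable (M \<Otimes>\<^sub>M unit_measure) (M \<Otimes>\<^sub>M borel)"
  unfolding split_beta by (intro measurable_Pair step_measurable2[OF assms]) auto

lemma step_sections:
  assumes g: "step M g" and x: "x \<in> space M" and t: "t \<in> sets borel"
  shows "{v \<in> {0<..<1}. g x v \<in> t} \<in> sets unit_measure"
proof -
  have "(\<lambda>v. g x v) \<in> borel_measurable unit_measure"
    by (rule step_measurable2[OF g]) (use x in auto)
  then show ?thesis
    using measurable_sets[of "g x" unit_measure borel t] t by (simp add: vimage_def Int_def conj_commute)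
qed

text \<open>Tonelli: the preimage of a rectangle has the section \<open>{v. g x v \<in> B}\<close>
  over \<open>x \<in> A\<close> and an empty one elsewhere. For fixed \<open>B\<close> the kernel
  mass is thus a density in \<open>x\<close>, which is how equal laws come to give equal
  kernels.\<close>

lemma emeasure_step_law:
  assumes M: "prob_space M" and g: "step M g" and A: "A \<in> sets M" and B: "B \<in> sets borel"
  shows "emeasure (step_law M g) (A \<times> B) = (\<integral>\<^sup>+x. emeasure unit_measure {v \<in> {0<..<1}. g x v \<in> B} * indicator A x \<partial>M)"
proof -
  interpret prob_space M by fact
  note m = measurable_step_pair[OF g]
  let ?S = "(\<lambda>(x, v). (x, g x v)) -` (A \<times> B) \<inter> space (M \<Otimes>\<^sub>M unit_measure)"
  have S: "?S \<in> sets (M \<Otimes>\<^sub>M unit_measure)"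
    using A B by (intro measurable_sets[OF m]) auto
  have "emeasure (step_law M g) (A \<times> B) = emeasure (M \<Otimes>\<^sub>M unit_measure) ?S"
    unfolding step_law_def using A B by (intro emeasure_distr[OF m]) auto
  also have "\<dots> = (\<integral>\<^sup>+x. emeasure unit_measure (Pair x -` ?S) \<partial>M)"
    by (rule unit.emeasure_pair_measure_alt[OF S])
  also have "\<dots> = (\<integral>\<^sup>+x. emeasure unit_measure {v \<in> {0<..<1}. g x v \<in> B} * indicator A x \<partial>M)"
  proof (rule nn_integral_cong)
    fix x assume x: "x \<in> space M"
    show "emeasure unit_measure (Pair x -` ?S) = emeasure unit_measure {v \<in> {0<..<1}. g x v \<in> B} * indicator A x"
    proof (cases "x \<in> A")
      case True
      then have "Pair x -` ?S = {v \<in> {0<..<1}. g x v \<in> B}"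
        using x by (auto simp: space_pair_measure)
      then show ?thesis using True by simp
    next
      case False
      then have "Pair x -` ?S = {}" by auto
      then show ?thesis using False by (simp del: vimage_Int)
    qed
  qed
  finally show ?thesis .
qed

lemma emeasure_step_measurable:
  assumes g: "step M g" and B: "B \<in> sets borel"
  shows "(\<lambda>x. emeasure unit_measure {v \<in> {0<..<1}. g x v \<in> B}) \<in> borel_measurable M"
proof -
  have S: "case_prod g -` B \<inter> space (M \<Otimes>\<^sub>M unit_measure) \<in> sets (M \<Otimes>\<^sub>M unit_measure)"
    using measurable_sets[OF step_measurable[OF g] B] .
  have "(\<lambda>x. emeasure unit_measure (Pair x -` (case_prod g -` B \<inter> space (M \<Otimes>\<^sub>M unit_measure)))) \<in> borel_measurable M"
    by (rule unit.measurable_emeasure_Pair[OF S])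
  also have "?this \<longleftrightarrow> ?thesis"
    by (intro measurable_cong arg_cong[where f="emeasure _"]) (auto simp: space_pair_measure)
  finally show ?thesis .
qed

text \<open>If \<open>v\<close> lay only in the first set and \<open>w\<close> only in the second,
  the smaller of the two would by monotonicity belong to both.\<close>

lemma mono_preimage_nested:
  fixes f g :: "real \<Rightarrow> real"
  assumes "mono_on {0<..<1} f" "mono_on {0<..<1} g"
  shows "{v \<in> {0<..<1}. f v \<le> t} \<subseteq> {v \<in> {0<..<1}. g v \<le> t} \<or> {v \<in> {0<..<1}. g v \<le> t} \<subseteq> {v \<in> {0<..<1}. f v \<le> t}"
proof (rule ccontr)
  assume "\<not> ?thesis"
  then obtain v w where v: "v \<in> {0<..<1}" "f v \<le> t" "\<not> g v \<le> t" and w: "w \<in> {0<..<1}" "g w \<le> t" "\<not> f w \<le> t"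
    by blast
  then show False
    using mono_onD[OF assms(1), of w v] mono_onD[OF assms(2), of v w] by (cases "v \<le> w") auto
qed

lemma real_eqI_rat_le:
  fixes a b :: real
  assumes "\<And>q. q \<in> \<rat> \<Longrightarrow> a \<le> q \<longleftrightarrow> b \<le> q"
  shows "a = b"
proof (rule ccontr)
  assume "a \<noteq> b"
  then consider "a < b" | "b < a" by linarith
  then show False
  proof cases
    case 1 with Rats_dense_in_real[OF 1] assms show False by force
  next
    case 2 with Rats_dense_in_real[OF 2] assms show False by force
  qed
qed

text \<open>The sublevel sets of \<open>g x\<close> and \<open>h x\<close> are initial segments of \<open>(0, 1)\<close>, hence nested, so they
  agree up to a null set as soon as their measures do.\<close>

lemma step_law_unique:
  assumes M: "prob_space M" and g: "step M g" and h: "step M h" and eq: "step_law M g = step_law M h"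
  shows "AE x in M. AE v in unit_measure. g x v = h x v"
proof -
  interpret prob_space M by fact
  have "AE x in M. emeasure unit_measure {v \<in> {0<..<1}. g x v \<in> {..q}} = emeasure unit_measure {v \<in> {0<..<1}. h x v \<in> {..q}}"
    for q :: real
  proof -
    let ?a = "\<lambda>g x. emeasure unit_measure {v \<in> {0<..<1}. g x v \<in> {..q}}"
    have m: "?a g \<in> borel_measurable M" "?a h \<in> borel_measurable M"
      by (intro emeasure_step_measurable[OF g] emeasure_step_measurable[OF h]; simp)+
    \<comment> \<open>The two masses have equal integrals over every \<open>A\<close>, so these
      densities agree almost everywhere for one threshold at a time; restricting to rational
      thresholds allows the null sets to be united.\<close>
    have "density M (?a g) = density M (?a h)"
    proof (rule measure_eqI)
      fix A assume "A \<in> sets (density M (?a g))"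
      then have A: "A \<in> sets M" by simp
      show "emeasure (density M (?a g)) A = emeasure (density M (?a h)) A"
        using emeasure_step_law[OF M g A, of "{..q}"] emeasure_step_law[OF M h A, of "{..q}"] eq A m
        by (simp add: emeasure_density)
    qed simp
    then show ?thesis
      using density_unique_iff[OF m] by simp
  qed
  then have "AE x in M. \<forall>q\<in>\<rat>. emeasure unit_measure {v \<in> {0<..<1}. g x v \<in> {..q}} = emeasure unit_measure {v \<in> {0<..<1}. h x v \<in> {..q}}"
    by (intro AE_ball_countable') (auto simp: countable_rat)
  then show ?thesis using AE_space
  proof eventually_elim
    case (elim x)
    note x = elim(2)
    have *: "AE v in unit_measure. g x v \<le> q \<longleftrightarrow> h x v \<le> q" if q: "q \<in> \<rat>" for q
    proof -
      let ?A = "{v \<in> {0<..<1}. g x v \<in> {..q}}" and ?B = "{v \<in> {0<..<1}. h x v \<in> {..q}}"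
      have s: "?A \<in> sets unit_measure" "?B \<in> sets unit_measure"
        using step_sections[OF g x atMost_borel] step_sections[OF h x atMost_borel] by blast+
      have e: "emeasure unit_measure ?A = emeasure unit_measure ?B"
        using elim q by auto
      have "?A \<subseteq> ?B \<or> ?B \<subseteq> ?A"
        using mono_preimage_nested[OF step_mono[OF g x] step_mono[OF h x]] by simp
      then have "emeasure unit_measure (?A - ?B) = 0 \<and> emeasure unit_measure (?B - ?A) = 0"
      proof
        assume "?A \<subseteq> ?B"
        then show ?thesis
          using e s emeasure_Diff[OF _ s(2) s(1)] by (simp add: Diff_eq_empty_iff[THEN iffD2])
      next
        assume "?B \<subseteq> ?A"
        then show ?thesis
          using e s emeasure_Diff[OF _ s(1) s(2)] by (simp add: Diff_eq_empty_iff[THEN iffD2])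
      qed
      then have "?A - ?B \<in> null_sets unit_measure" "?B - ?A \<in> null_sets unit_measure"
        using s by auto
      from AE_not_in[OF this(1)] AE_not_in[OF this(2)] AE_space show ?thesis
        by eventually_elim auto
    qed
    then have "AE v in unit_measure. \<forall>q\<in>\<rat>. g x v \<le> q \<longleftrightarrow> h x v \<le> q"
      by (intro AE_ball_countable') (auto simp: countable_rat)
    then show ?case
      by eventually_elim (use real_eqI_rat_le in blast)
  qed
qed

section \<open>Inverting distribution functions given at rational points\<close>

text \<open>Placing \<open>r n\<close> strictly between \<open>t - 1 / (n + 1)\<close> and
  \<open>t - 1 / (n + 2)\<close> makes the sequence increase by itself and tend to \<open>t\<close>
  from below. It writes \<open>{..<t}\<close> as an increasing union of rational half lines, on
  which distribution functions are known.\<close>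

lemma rat_seq_below:
  fixes t :: real
  obtains r :: "nat \<Rightarrow> rat"
  where "incseq r" "\<And>n. of_rat (r n) < t" "\<And>s. s < t \<Longrightarrow> \<exists>n. s < of_rat (r n)"
proof -
  have "\<exists>q::rat. t - 1 / Suc n < of_rat q \<and> of_rat q < t - 1 / Suc (Suc n)" for n
  proof -
    have "t - 1 / Suc n < t - 1 / Suc (Suc n)" by (simp add: frac_less2)
    from of_rat_dense[OF this] show ?thesis by blast
  qed
  then obtain r :: "nat \<Rightarrow> rat" where r: "\<And>n. t - 1 / Suc n < of_rat (r n)" "\<And>n. of_rat (r n) < t - 1 / Suc (Suc n)"
    by metis
  show thesis
  proof (rule that[of r])
    show "incseq r"
    proof (rule incseq_SucI)
      fix n
      have "(of_rat (r n) :: real) < of_rat (r (Suc n))"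
        using r(1)[of "Suc n"] r(2)[of n] by linarith
      then show "r n \<le> r (Suc n)" by (simp add: of_rat_less)
    qed
    show "of_rat (r n) < t" for n
      using r(2)[of n] by (smt (verit) divide_pos_pos of_nat_0_less_iff zero_less_Suc)
    fix s assume "s < t"
    then obtain n where "1 / Suc n < t - s"
      by (metis diff_gt_0_iff_gt nat_approx_posE)
    then show "\<exists>n. s < of_rat (r n)"
      using r(1)[of n] by (intro exI[of _ n]) linarith
  qed
qed

lemma lessThan_eq_UN_atMost:
  fixes s :: "nat \<Rightarrow> 'a::linorder"
  assumes "\<And>n. s n < t" "\<And>x. x < t \<Longrightarrow> \<exists>n. x < s n"
  shows "{..<t} = (\<Union>n. {..s n})"
proof (intro set_eqI iffI)
  fix x assume "x \<in> {..<t}"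
  then obtain n where "x < s n" using assms(2) by auto
  then show "x \<in> (\<Union>n. {..s n})" by (auto intro: less_imp_le)
qed (use assms(1) le_less_trans in auto)

text \<open>The trace on the rationals of a distribution function; by monotonicity the two existence
  clauses say that the limits at the ends are 0 and 1. Right continuity is left out on purpose: laws
  are compared on the sets \<open>{..<t}\<close>, which involve only suprema over rationals below
  \<open>t\<close>.\<close>

definition good_cdf :: "(rat \<Rightarrow> real) \<Rightarrow> bool" where
  "good_cdf F \<longleftrightarrow> (\<forall>q q'. q \<le> q' \<longrightarrow> F q \<le> F q') \<and> (\<forall>q. 0 \<le> F q \<and> F q \<le> 1) \<and>
     (\<forall>n::nat. \<exists>q. F q < 1 / Suc n) \<and> (\<forall>n::nat. \<exists>q. 1 - 1 / Suc n < F q)"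

definition quantiles_above :: "(rat \<Rightarrow> real) \<Rightarrow> real \<Rightarrow> real set" where
  "quantiles_above F v = of_rat ` {q. v < F q}"

text \<open>The right-continuous quantile function. The strict inequality \<open>v < F q\<close>
  turns \<open>cdf_inverse F v < t\<close> into a countable union of such inequalities, which yields
  both measurability and law. The fallback \<open>v\<close> keeps the function increasing for every
  \<open>F\<close>.\<close>

definition cdf_inverse :: "(rat \<Rightarrow> real) \<Rightarrow> real \<Rightarrow> real" where
  "cdf_inverse F v = (if good_cdf F then Inf (quantiles_above F v) else v)"

lemma quantiles_above:
  assumes F: "good_cdf F" and v: "v \<in> {0<..<1}"
  shows "quantiles_above F v \<noteq> {}" and "bdd_below (quantiles_above F v)"
proof -
  obtain n where "1 / Suc n < 1 - v" using v by (metis diff_gt_0_iff_gt greaterThanLessThan_iff nat_approx_posE)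
  moreover obtain q where "1 - 1 / Suc n < F q" using F unfolding good_cdf_def by blast
  ultimately have "v < F q" by linarith
  then show "quantiles_above F v \<noteq> {}" by (auto simp: quantiles_above_def)
  obtain n where "1 / Suc n < v" using v by (metis greaterThanLessThan_iff nat_approx_posE)
  moreover obtain q where "F q < 1 / Suc n" using F unfolding good_cdf_def by blast
  ultimately have q: "F q < v" by linarith
  have "q \<le> q'" if "v < F q'" for q'
  proof (rule ccontr)
    assume "\<not> q \<le> q'"
    then have "F q' \<le> F q" using F unfolding good_cdf_def by simp
    then show False using q that by linarith
  qed
  then show "bdd_below (quantiles_above F v)"
    unfolding bdd_below_def quantiles_above_def by (intro exI[of _ "of_rat q"]) (auto simp: of_rat_less_eq)
qed

lemma cdf_inverse_less_iff:
  assumes "good_cdf F" "v \<in> {0<..<1}"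
  shows "cdf_inverse F v < t \<longleftrightarrow> (\<exists>q. of_rat q < t \<and> v < F q)"
  using assms(1) cInf_less_iff[OF quantiles_above[OF assms]]
  by (auto simp: cdf_inverse_def quantiles_above_def)

lemma mono_cdf_inverse: "mono_on {0<..<1} (cdf_inverse F)"
proof (cases "good_cdf F")
  case True
  show ?thesis
  proof (rule mono_onI)
    fix v w :: real assume vw: "v \<in> {0<..<1}" "w \<in> {0<..<1}" "v \<le> w"
    have "Inf (quantiles_above F v) \<le> Inf (quantiles_above F w)"
      by (rule cInf_superset_mono[OF quantiles_above(1)[OF True vw(2)] quantiles_above(2)[OF True vw(1)]])
         (use vw in \<open>auto simp: quantiles_above_def\<close>)
    then show "cdf_inverse F v \<le> cdf_inverse F w" using True by (simp add: cdf_inverse_def)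
  qed
qed (simp add: cdf_inverse_def mono_on_def)

lemma step_cdf_inverse:
  assumes D: "\<And>q. D q \<in> borel_measurable M"
  shows "step M (\<lambda>x. cdf_inverse (\<lambda>q. D q x))" (is "step M ?g")
  unfolding step_def
proof (intro conjI ballI)
  show "case_prod ?g \<in> borel_measurable (M \<Otimes>\<^sub>M unit_measure)"
  proof (rule borel_measurableI_less)
    fix t
    have Dfst: "(\<lambda>z. D q (fst z)) \<in> borel_measurable (M \<Otimes>\<^sub>M unit_measure)" for q
      by (rule measurable_compose[OF measurable_fst D])
    have good: "{z \<in> space (M \<Otimes>\<^sub>M unit_measure). good_cdf (\<lambda>q. D q (fst z))} \<in> sets (M \<Otimes>\<^sub>M unit_measure)"
    proof -
      have "Measurable.pred (M \<Otimes>\<^sub>M unit_measure) (\<lambda>z. D q (fst z) \<le> D q' (fst z))"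
        "Measurable.pred (M \<Otimes>\<^sub>M unit_measure) (\<lambda>z. 0 \<le> D q (fst z))"
        "Measurable.pred (M \<Otimes>\<^sub>M unit_measure) (\<lambda>z. D q (fst z) \<le> 1)" for q q'
        unfolding pred_def by (intro borel_measurable_le Dfst borel_measurable_const)+
      moreover have "Measurable.pred (M \<Otimes>\<^sub>M unit_measure) (\<lambda>z. D q (fst z) < c)"
        "Measurable.pred (M \<Otimes>\<^sub>M unit_measure) (\<lambda>z. c < D q (fst z))" for q c
        unfolding pred_def by (intro borel_measurable_less Dfst borel_measurable_const)+
      ultimately show ?thesis
        unfolding good_cdf_def pred_def[symmetric]
        by (intro pred_intros_logic(3) pred_intros_countable pred_intros_imp'; blast)
    qed
    have snd: "snd \<in> borel_measurable (M \<Otimes>\<^sub>M unit_measure)"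
      using measurable_snd[of M unit_measure] by (simp add: measurable_unit_measure_iff)
    have "{z \<in> space (M \<Otimes>\<^sub>M unit_measure). case_prod ?g z < t} =
      {z \<in> space (M \<Otimes>\<^sub>M unit_measure). good_cdf (\<lambda>q. D q (fst z)) \<and> (\<exists>q. of_rat q < t \<and> snd z < D q (fst z)) \<or> \<not> good_cdf (\<lambda>q. D q (fst z)) \<and> snd z < t}"
    proof (intro Collect_cong conj_cong refl)
      fix z assume z: "z \<in> space (M \<Otimes>\<^sub>M unit_measure)"
      show "(case_prod ?g z < t) = (good_cdf (\<lambda>q. D q (fst z)) \<and> (\<exists>q. of_rat q < t \<and> snd z < D q (fst z)) \<or> \<not> good_cdf (\<lambda>q. D q (fst z)) \<and> snd z < t)"
      proof (cases "good_cdf (\<lambda>q. D q (fst z))")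
        case True
        then show ?thesis
          using cdf_inverse_less_iff[OF True, of "snd z" t] z by (simp add: space_pair_measure split_beta mem_Times_iff)
      next
        case False
        then show ?thesis by (simp add: cdf_inverse_def split_beta)
      qed
    qed
    also have "\<dots> \<in> sets (M \<Otimes>\<^sub>M unit_measure)"
    proof -
      have "Measurable.pred (M \<Otimes>\<^sub>M unit_measure) (\<lambda>z. \<exists>q. of_rat q < t \<and> snd z < D q (fst z))"
        by (intro pred_intros_countable(2) pred_intros_conj1' borel_measurable_pred_less snd Dfst)
      moreover have "Measurable.pred (M \<Otimes>\<^sub>M unit_measure) (\<lambda>z. snd z < t)"
        by (intro borel_measurable_pred_less snd borel_measurable_const)
      ultimately show ?thesis
        using good unfolding pred_def[symmetric] by (intro pred_intros_logic(2,3,5))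
    qed
    finally show "{z \<in> space (M \<Otimes>\<^sub>M unit_measure). case_prod ?g z < t} \<in> sets (M \<Otimes>\<^sub>M unit_measure)" .
  qed
qed (rule mono_cdf_inverse)

text \<open>Every rational below \<open>t\<close> is exceeded by some \<open>r n\<close>, so the
  event is the increasing union of the intervals from 0 to \<open>F (r n)\<close>, and their lengths
  are the terms of the supremum.\<close>

lemma emeasure_cdf_inverse:
  assumes F: "good_cdf F" and r: "incseq r" "\<And>n. of_rat (r n) < t" "\<And>s. s < t \<Longrightarrow> \<exists>n. s < of_rat (r n)"
  shows "emeasure unit_measure {v \<in> {0<..<1}. cdf_inverse F v \<in> {..<t}} = (SUP n::nat. ennreal (F (r n)))"
proof -
  have mono: "\<And>q q'. q \<le> q' \<Longrightarrow> F q \<le> F q'" and bd: "\<And>q. 0 \<le> F q" "\<And>q. F q \<le> 1"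
    using F unfolding good_cdf_def by blast+
  \<comment> \<open>The minimum with 1 keeps the intervals visibly inside (0, 1), hence measurable
    for \<open>unit_measure\<close>; as \<open>F\<close> is at most 1, the lengths are still
    \<open>F (r n)\<close>.\<close>
  let ?A = "\<lambda>n. {0<..<min 1 (F (r n))}"
  have "cdf_inverse F v < t \<longleftrightarrow> (\<exists>n. v < F (r n))" if v: "v \<in> {0<..<1}" for v
    unfolding cdf_inverse_less_iff[OF F v]
  proof (intro iffI; elim exE conjE)
    fix q assume q: "of_rat q < t" "v < F q"
    then obtain n where "(of_rat q :: real) < of_rat (r n)" using r(3) by blast
    then have "F q \<le> F (r n)" by (intro mono) (simp add: of_rat_less)
    then show "\<exists>n. v < F (r n)" using q(2) by (intro exI[of _ n]) linarith
  qed (use r(2) in blast)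
  then have "{v \<in> {0<..<1}. cdf_inverse F v \<in> {..<t}} = (\<Union>n. ?A n)" by auto
  also have "emeasure unit_measure \<dots> = (SUP n. emeasure unit_measure (?A n))"
  proof (rule SUP_emeasure_incseq[symmetric])
    show "range ?A \<subseteq> sets unit_measure"
      by (auto simp: sets_restrict_space)
    show "incseq ?A"
    proof (rule incseq_SucI)
      fix n
      have "F (r n) \<le> F (r (Suc n))" using mono r(1) by (simp add: incseq_SucD)
      then show "?A n \<subseteq> ?A (Suc n)" by auto
    qed
  qed
  also have "(\<lambda>n. emeasure unit_measure (?A n)) = (\<lambda>n. ennreal (F (r n)))"
  proof
    fix n
    have "?A n \<inter> {0<..<1} = {0<..<F (r n)}" using bd(2)[of "r n"] by auto
    then show "emeasure unit_measure (?A n) = ennreal (F (r n))"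
      using bd[of "r n"] by (subst emeasure_restrict_space) (auto simp: min_def)
  qed
  finally show ?thesis .
qed

lemma finite_measure_eqI_lessThan:
  fixes M L :: "real measure"
  assumes M: "finite_measure M" and sets: "sets M = sets borel" "sets L = sets borel"
    and eq: "\<And>t. emeasure M {..<t} = emeasure L {..<t}"
  shows "M = L"
proof (rule measure_eqI_generator_eq[where \<Omega>=UNIV and E="range lessThan" and A="\<lambda>n::nat. {..<real n}"])
  show "Int_stable (range lessThan :: real set set)"
  proof (rule Int_stableI)
    fix A B :: "real set" assume "A \<in> range lessThan" "B \<in> range lessThan"
    then obtain a b where "A = {..<a}" "B = {..<b}" by auto
    then have "A \<inter> B = {..<min a b}" by auto
    then show "A \<inter> B \<in> range lessThan" by simp
  qed
  show "sets M = sigma_sets UNIV (range lessThan)" "sets L = sigma_sets UNIV (range lessThan)"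
    unfolding sets borel_Iio by simp_all
  show "(\<Union>n. {..<real n}) = UNIV" by (auto simp: reals_Archimedean2)
  show "emeasure M {..<real n} \<noteq> \<infinity>" for n
    using finite_measure.emeasure_finite[OF M] by simp
qed (auto simp: eq)

text \<open>Uniqueness is applied twice: for fixed \<open>A\<close> the measures
  \<open>A \<times> B\<close> receives, as \<open>B\<close> varies, agree on half lines and hence on
  all Borel sets; then rectangles determine the measure. The measure in \<open>B\<close> is obtained
  as the image under \<open>snd\<close> of the restriction to \<open>A \<times> UNIV\<close>,
  written as a density.\<close>

lemma pair_measure_eqI_lessThan:
  fixes P R :: "('a \<times> real) measure"
  assumes P: "prob_space P" and sets: "sets P = sets (M \<Otimes>\<^sub>M borel)" "sets R = sets (M \<Otimes>\<^sub>M borel)"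
    and eq: "\<And>A t. A \<in> sets M \<Longrightarrow> emeasure P (A \<times> {..<t}) = emeasure R (A \<times> {..<t})"
  shows "P = R"
proof -
  interpret prob_space P by fact
  have emeas: "emeasure (distr (density L (indicator (A \<times> UNIV))) borel snd) B = emeasure L (A \<times> B)"
    if "sets L = sets (M \<Otimes>\<^sub>M borel)" "A \<in> sets M" "B \<in> sets borel" for L :: "('a \<times> real) measure" and A B
  proof -
    have sp: "space L = space M \<times> UNIV"
      using sets_eq_imp_space_eq[OF that(1)] by (simp add: space_pair_measure)
    have "snd \<in> borel_measurable L"
      using measurable_snd[of M borel] measurable_cong_sets[OF that(1) refl] by blast
    moreover have "snd -` B \<inter> space L \<in> sets L" "A \<times> UNIV \<in> sets L" "A \<times> B \<in> sets L"
      using that by (auto simp: sp vimage_snd Times_Int_Times intro!: sets.Int)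
    moreover have "(A \<times> UNIV) \<inter> (snd -` B \<inter> space L) = A \<times> B"
      using sets.sets_into_space[OF that(2)] by (auto simp: sp)
    ultimately show ?thesis
      using that(3) 
      by (subst emeasure_distr) (auto simp: emeasure_density indicator_inter_arith[symmetric] measurable_density_eq1)
  qed
  have "emeasure P (A \<times> B) = emeasure R (A \<times> B)" if A: "A \<in> sets M" and B: "B \<in> sets borel" for A B
  proof -
    have fin: "finite_measure (distr (density P (indicator (A \<times> UNIV))) borel snd)"
    proof (rule finite_measureI)
      show "emeasure (distr (density P (indicator (A \<times> UNIV))) borel snd)
         (space (distr (density P (indicator (A \<times> UNIV))) borel snd)) \<noteq> \<infinity>"
        using emeas[OF sets(1) A, of UNIV] by simp
    qed
    have "distr (density P (indicator (A \<times> UNIV))) borel snd = distr (density R (indicator (A \<times> UNIV))) borel snd"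
      by (rule finite_measure_eqI_lessThan[OF fin]) (auto simp: emeas sets A eq)
    then show ?thesis using emeas[OF sets(1) A B] emeas[OF sets(2) A B] by simp
  qed
  note rect = this
  let ?E = "{a \<times> b | a b. a \<in> sets M \<and> b \<in> sets (borel :: real measure)}"
  show ?thesis
  proof (rule measure_eqI_generator_eq[where \<Omega>="space M \<times> UNIV" and E="?E" and A="\<lambda>_::nat. space M \<times> UNIV"])
    show "Int_stable ?E" by (rule Int_stable_pair_measure_generator)
    show "?E \<subseteq> Pow (space M \<times> UNIV)" by (auto dest: sets.sets_into_space)
    show "range (\<lambda>_::nat. space M \<times> UNIV) \<subseteq> ?E" by (intro image_subsetI CollectI exI[of _ "space M"] exI[of _ UNIV]) simp
  qed (auto simp: sets sets_pair_measure rect[symmetric])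
qed

text \<open>The kernel is given at every point, so its distribution function can be inverted at
  every point and the laws agree without a null set. This allows the kernels of a prescribed
  disintegration to be realised exactly.\<close>

lemma kernel_step:
  assumes K: "K \<in> measurable M (subprob_algebra borel)" and P: "\<And>x. x \<in> space M \<Longrightarrow> prob_space (K x)"
  obtains g where "step M g" "\<And>x. x \<in> space M \<Longrightarrow> distr unit_measure borel (g x) = K x"
proof -
  define D where "D q x = measure (K x) {..of_rat q}" for q :: rat and x
  have setsK: "sets (K x) = sets borel" if "x \<in> space M" for x
    using subprob_measurableD(2)[OF K that] .
  have D: "D q \<in> borel_measurable M" for q
    unfolding D_def by (rule measurable_compose[OF K]) (auto intro!: measurable_measure_subprob_algebra)
  have good: "good_cdf (\<lambda>q. D q x)" if x: "x \<in> space M" for x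
  proof -
    interpret real_distribution "K x"
      using P[OF x] setsK[OF x] sets_eq_imp_space_eq[OF setsK[OF x]] by (simp add: real_distribution_def real_distribution_axioms_def)
    have D: "D q x = cdf (K x) (of_rat q)" for q by (simp add: D_def cdf_def)
    show ?thesis
      unfolding good_cdf_def D
    proof (intro conjI allI impI)
      fix n :: nat
      have "eventually (\<lambda>y. cdf (K x) y < 1 / Suc n) at_bot"
        using cdf_lim_at_bot by (rule order_tendstoD) simp
      then obtain b where b: "\<And>y. y \<le> b \<Longrightarrow> cdf (K x) y < 1 / Suc n"
        by (auto simp: eventually_at_bot_linorder)
      obtain q where "of_rat q < b" using of_rat_dense[of "b - 1" b] by auto
      then show "\<exists>q. cdf (K x) (of_rat q) < 1 / Suc n" using b[of "of_rat q"] by auto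
      have "eventually (\<lambda>y. 1 - 1 / Suc n < cdf (K x) y) at_top"
        using cdf_lim_at_top_prob by (rule order_tendstoD) simp
      then obtain b where b: "\<And>y. y \<ge> b \<Longrightarrow> 1 - 1 / Suc n < cdf (K x) y"
        by (auto simp: eventually_at_top_linorder)
      obtain q where "b < of_rat q" using of_rat_dense[of b "b + 1"] by auto
      then show "\<exists>q. 1 - 1 / Suc n < cdf (K x) (of_rat q)" using b[of "of_rat q"] by auto
    qed (auto intro!: cdf_nondecreasing cdf_nonneg cdf_bounded_prob simp: of_rat_less_eq)
  qed
  define g where "g x = cdf_inverse (\<lambda>q. D q x)" for x
  have g: "step M g"
    unfolding g_def using D by (rule step_cdf_inverse)
  have "distr unit_measure borel (g x) = K x" if x: "x \<in> space M" for x
  proof (rule sym, rule finite_measure_eqI_lessThan)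
    interpret prob_space "K x" by (rule P[OF x])
    show "finite_measure (K x)" by (rule finite_measure_axioms)
    show "sets (K x) = sets borel" by (rule setsK[OF x])
    fix t :: real
    obtain r where r: "incseq r" "\<And>n. of_rat (r n) < t" "\<And>s. s < t \<Longrightarrow> \<exists>n. s < of_rat (r n)"
      using rat_seq_below[of t] by metis
    have gm: "g x \<in> borel_measurable unit_measure"
      by (rule step_measurable2[OF g]) (use x in auto)
    have "{..<t} = (\<Union>n. {..of_rat (r n)})"
      by (rule lessThan_eq_UN_atMost) (use r in auto)
    then have "emeasure (K x) {..<t} = emeasure (K x) (\<Union>n. {..of_rat (r n)})" by simp
    also have "\<dots> = (SUP n. emeasure (K x) {..of_rat (r n)})"
      using r(1) by (intro SUP_emeasure_incseq[symmetric]) (auto simp: setsK[OF x] incseq_def of_rat_less_eq intro: order_trans)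
    also have "\<dots> = (SUP n. ennreal (D (r n) x))"
      by (simp add: D_def emeasure_eq_measure)
    also have "\<dots> = emeasure (distr unit_measure borel (g x)) {..<t}"
      using emeasure_cdf_inverse[OF good[OF x] r] gm by (simp add: emeasure_distr vimage_def Int_def conj_commute g_def)
    finally show "emeasure (K x) {..<t} = emeasure (distr unit_measure borel (g x)) {..<t}" .
  qed simp
  with g show thesis by (rule that)
qed

section \<open>Disintegration by Radon-Nikodym densities\<close>

text \<open>Tested with the set where \<open>g < f\<close>, the hypothesis makes the integral of
  \<open>f - g\<close> over this set vanish. Finiteness of the integral of \<open>g\<close> is what
  makes the subtraction legitimate.\<close>

lemma AE_le_of_nn_integral_le:
  fixes f g :: "'a \<Rightarrow> ennreal"
  assumes f [measurable]: "f \<in> borel_measurable M" and g [measurable]: "g \<in> borel_measurable M"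
    and fin: "(\<integral>\<^sup>+x. g x \<partial>M) \<noteq> \<infinity>"
    and le: "\<And>A. A \<in> sets M \<Longrightarrow> (\<integral>\<^sup>+x. f x * indicator A x \<partial>M) \<le> (\<integral>\<^sup>+x. g x * indicator A x \<partial>M)"
  shows "AE x in M. f x \<le> g x"
proof -
  define E where "E = {x \<in> space M. g x < f x}"
  have E [measurable]: "E \<in> sets M" unfolding E_def by measurable
  have finE: "(\<integral>\<^sup>+x. g x * indicator E x \<partial>M) \<noteq> \<infinity>"
  proof -
    have "(\<integral>\<^sup>+x. g x * indicator E x \<partial>M) \<le> (\<integral>\<^sup>+x. g x \<partial>M)"
      by (intro nn_integral_mono) (auto split: split_indicator)
    then show ?thesis using fin by (auto simp: top_unique)
  qed
  have "(\<integral>\<^sup>+x. f x * indicator E x - g x * indicator E x \<partial>M) =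
    (\<integral>\<^sup>+x. f x * indicator E x \<partial>M) - (\<integral>\<^sup>+x. g x * indicator E x \<partial>M)"
    by (rule nn_integral_diff) (use finE in \<open>auto simp: E_def split: split_indicator intro: less_imp_le\<close>)
  also have "\<dots> = 0" using le[OF E] finE by (intro diff_eq_0_ennreal) (auto simp: less_top[symmetric] top_unique)
  finally have "AE x in M. f x * indicator E x - g x * indicator E x = 0"
    by (subst (asm) nn_integral_0_iff_AE) auto
  then show ?thesis using AE_space
  proof eventually_elim
    case (elim x)
    show ?case
    proof (rule ccontr)
      assume "\<not> f x \<le> g x"
      then have "x \<in> E" using elim by (auto simp: E_def)
      then have "f x - g x = 0" using elim by simp
      then show False using \<open>\<not> f x \<le> g x\<close> by (metis diff_eq_0_iff_ennreal)
    qed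
  qed
qed

lemma step_cong_sets:
  assumes "sets M = sets L"
  shows "step M g \<longleftrightarrow> step L g"
proof -
  have *: "sets (M \<Otimes>\<^sub>M unit_measure) = sets (L \<Otimes>\<^sub>M unit_measure)"
    by (rule sets_pair_measure_cong) (use assms in auto)
  have "(case_prod g \<in> borel_measurable (M \<Otimes>\<^sub>M unit_measure)) = (case_prod g \<in> borel_measurable (L \<Otimes>\<^sub>M unit_measure))"
    unfolding measurable_cong_sets[OF * refl] by (rule refl)
  then show ?thesis
    unfolding step_def sets_eq_imp_space_eq[OF assms] by blast
qed

lemma step_law_exists:
  fixes P :: "('a \<times> real) measure"
  assumes P: "prob_space P" and sets: "sets P = sets (M \<Otimes>\<^sub>M borel)"
  obtains g where "step M g" "P = step_law (distr P M fst) g"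
proof -
  interpret P: prob_space P by fact
  have sp: "space P = space M \<times> UNIV"
    using sets_eq_imp_space_eq[OF sets] by (simp add: space_pair_measure)
  have fst_m: "fst \<in> measurable P M"
    using measurable_fst[of M borel] measurable_cong_sets[OF sets refl] by blast
  define L where "L = distr P M fst"
  have L: "prob_space L" unfolding L_def by (rule P.prob_space_distr[OF fst_m])
  interpret L: prob_space L by (rule L)
  have sL: "sets L = sets M" and spL: "space L = space M" by (simp_all add: L_def)
  define C where "C q = {..of_rat q :: real}" for q :: rat
  have rect: "A \<times> B \<in> sets P" if "A \<in> sets M" "B \<in> sets borel" for A B
    using that by (simp add: sets)
  have PL: "emeasure L A = emeasure P (A \<times> UNIV)" if A: "A \<in> sets M" for A
    unfolding L_def using A fst_m sets.sets_into_space[OF A]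
    by (subst emeasure_distr) (auto intro!: arg_cong[where f="emeasure P"] simp: sp)
  \<comment> \<open>For each rational \<open>q\<close>, the mass of the part of
    \<open>A \<times> UNIV\<close> with second component at most \<open>q\<close>, as a measure in
    \<open>A\<close>. It is dominated by the marginal \<open>L\<close>, and its density is the
    conditional distribution function at \<open>q\<close>.\<close>
  define nu where "nu q = distr (density P (indicator (space M \<times> C q))) M fst" for q
  have nu: "emeasure (nu q) A = emeasure P (A \<times> C q)" if A: "A \<in> sets M" for A q
  proof -
    have *: "fst -` A \<inter> space P = A \<times> UNIV" using sets.sets_into_space[OF A] by (auto simp: sp)
    have "(\<integral>\<^sup>+x. indicator (space M \<times> C q) x * indicator (A \<times> UNIV) x \<partial>P) = (\<integral>\<^sup>+x. indicator (A \<times> C q) x \<partial>P)"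
      using sets.sets_into_space[OF A] by (intro nn_integral_cong) (auto split: split_indicator)
    then show ?thesis
      using A fst_m rect[OF A] rect[OF sets.top] unfolding nu_def
      by (subst emeasure_distr) (auto simp: * emeasure_density C_def)
  qed
  have ac: "absolutely_continuous L (nu q)" for q
    unfolding absolutely_continuous_def
  proof
    fix A assume A: "A \<in> null_sets L"
    then have AM: "A \<in> sets M" by (simp add: null_sets_def sL)
    have "emeasure (nu q) A \<le> emeasure L A"
      unfolding nu[OF AM] PL[OF AM] using rect[OF AM, of UNIV] by (intro emeasure_mono) auto
    then show "A \<in> null_sets (nu q)" using A AM by (auto simp: null_sets_def nu_def)
  qed
  define R where "R q = RN_deriv L (nu q)" for q
  have Rm [measurable]: "R q \<in> borel_measurable L" for q unfolding R_def by simp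
  have R: "(\<integral>\<^sup>+x. R q x * indicator A x \<partial>L) = emeasure P (A \<times> C q)" if A: "A \<in> sets M" for A q
  proof -
    have "density L (R q) = nu q"
      unfolding R_def by (rule L.density_RN_deriv[OF ac]) (simp add: nu_def sL)
    then have "emeasure (density L (R q)) A = emeasure P (A \<times> C q)" using nu[OF A] by simp
    then show ?thesis using A sL by (simp add: emeasure_density)
  qed
  have fin: "(\<integral>\<^sup>+x. R q x \<partial>L) \<noteq> \<infinity>" for q
  proof -
    have "(\<integral>\<^sup>+x. R q x \<partial>L) = (\<integral>\<^sup>+x. R q x * indicator (space M) x \<partial>L)"
      by (intro nn_integral_cong) (simp add: spL)
    then show ?thesis using R[OF sets.top] by simp
  qed
  have mono: "AE x in L. \<forall>q q'. q \<le> q' \<longrightarrow> R q x \<le> R q' x"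
  proof -
    have "AE x in L. q \<le> q' \<longrightarrow> R q x \<le> R q' x" for q q'
    proof (cases "q \<le> q'")
      case True
      have "AE x in L. R q x \<le> R q' x"
      proof (rule AE_le_of_nn_integral_le[OF Rm Rm fin])
        fix A assume "A \<in> sets L"
        then have A: "A \<in> sets M" by (simp add: sL)
        show "(\<integral>\<^sup>+x. R q x * indicator A x \<partial>L) \<le> (\<integral>\<^sup>+x. R q' x * indicator A x \<partial>L)"
          unfolding R[OF A] using True rect[OF A]
          by (intro emeasure_mono) (auto simp: C_def of_rat_less_eq intro: order_trans)
      qed
      then show ?thesis by auto
    qed auto
    then show ?thesis by (simp add: AE_all_countable)
  qed
  have le1: "AE x in L. \<forall>q. R q x \<le> 1"
  proof -
    have "AE x in L. R q x \<le> 1" for q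
    proof (rule AE_le_of_nn_integral_le[OF Rm])
      fix A assume "A \<in> sets L"
      then have A: "A \<in> sets M" by (simp add: sL)
      have "(\<integral>\<^sup>+x. R q x * indicator A x \<partial>L) \<le> emeasure P (A \<times> UNIV)"
        unfolding R[OF A] using rect[OF A, of UNIV] by (intro emeasure_mono) auto
      then show "(\<integral>\<^sup>+x. R q x * indicator A x \<partial>L) \<le> (\<integral>\<^sup>+x. 1 * indicator A x \<partial>L)"
        using A by (simp add: PL sL)
    qed (auto simp: L.emeasure_space_1)
    then show ?thesis by (simp add: AE_all_countable)
  qed
  \<comment> \<open>The rectangles \<open>A \<times> C (of_nat m)\<close> exhaust
    \<open>A \<times> UNIV\<close>, so over each \<open>A\<close> the supremum integrates to at
    least the mass of \<open>A\<close>. Together with \<open>le1\<close> this gives the limit 1 at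
    the upper end.\<close>
  have top: "AE x in L. 1 \<le> (SUP m::nat. R (of_nat m) x)"
  proof (rule AE_le_of_nn_integral_le)
    have "AE x in L. (SUP m::nat. R (of_nat m) x) \<le> 1"
      using le1 by eventually_elim (auto intro: SUP_least)
    then have "(\<integral>\<^sup>+x. (SUP m::nat. R (of_nat m) x) \<partial>L) \<le> (\<integral>\<^sup>+x. 1 \<partial>L)"
      by (rule nn_integral_mono_AE)
    then show "(\<integral>\<^sup>+x. (SUP m::nat. R (of_nat m) x) \<partial>L) \<noteq> \<infinity>"
      by (auto simp: L.emeasure_space_1 top_unique)
    fix A assume "A \<in> sets L"
    then have A: "A \<in> sets M" by (simp add: sL)
    have "A \<times> UNIV = (\<Union>m::nat. A \<times> C (of_nat m))" 
      using real_arch_simple by (auto simp: C_def)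
    then have "(\<integral>\<^sup>+x. 1 * indicator A x \<partial>L) = emeasure P (\<Union>m::nat. A \<times> C (of_nat m))"
      using A by (simp add: PL[OF A] sL)
    also have "\<dots> = (SUP m::nat. emeasure P (A \<times> C (of_nat m)))"
      by (rule SUP_emeasure_incseq[symmetric]) (use rect[OF A] in \<open>auto simp: C_def incseq_def\<close>)
    also have "\<dots> \<le> (\<integral>\<^sup>+x. (SUP m::nat. R (of_nat m) x) * indicator A x \<partial>L)"
      unfolding R[OF A, symmetric] by (intro SUP_least nn_integral_mono mult_right_mono SUP_upper) auto
    finally show "(\<integral>\<^sup>+x. 1 * indicator A x \<partial>L) \<le> (\<integral>\<^sup>+x. (SUP m::nat. R (of_nat m) x) * indicator A x \<partial>L)" .
  qed measurable
  \<comment> \<open>Dual to the upper end: the rectangles over the half lines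
    \<open>C (- of_nat m)\<close> decrease to the empty set, so the infimum has integral 0 over each
    \<open>A\<close>.\<close>
  have bot: "AE x in L. (INF m::nat. R (- of_nat m) x) \<le> 0"
  proof (rule AE_le_of_nn_integral_le)
    fix A assume "A \<in> sets L"
    then have A: "A \<in> sets M" by (simp add: sL)
    have e: "(\<Inter>m::nat. A \<times> C (- of_nat m)) = {}"
    proof -
      have "\<exists>m::nat. \<not> y \<le> - real m" for y :: real
        using reals_Archimedean2[of "-y"] by (metis minus_less_iff not_le)
      then show ?thesis by (auto simp: C_def of_rat_minus)
    qed
    have "(\<integral>\<^sup>+x. (INF m::nat. R (- of_nat m) x) * indicator A x \<partial>L) \<le> (INF m::nat. emeasure P (A \<times> C (- of_nat m)))"
      unfolding R[OF A, symmetric] by (intro INF_greatest nn_integral_mono mult_right_mono INF_lower) auto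
    also have "\<dots> = emeasure P (\<Inter>m::nat. A \<times> C (- of_nat m))"
      by (rule INF_emeasure_decseq) (use rect[OF A] in \<open>auto simp: C_def decseq_def of_rat_minus\<close>)
    finally show "(\<integral>\<^sup>+x. (INF m::nat. R (- of_nat m) x) * indicator A x \<partial>L) \<le> (\<integral>\<^sup>+x. 0 * indicator A x \<partial>L)"
      by (simp add: e)
  qed auto
  define D where "D q x = enn2real (R q x)" for q x
  have Dm: "D q \<in> borel_measurable L" for q unfolding D_def by measurable
  \<comment> \<open>One null set serves all rationals. Where \<open>good_cdf\<close> fails,
    \<open>cdf_inverse\<close> falls back to the identity, so the conditions on a step still hold
    for every \<open>x\<close>.\<close>
  have good: "AE x in L. good_cdf (\<lambda>q. D q x) \<and> (\<forall>q. ennreal (D q x) = R q x) \<and> (\<forall>q q'. q \<le> q' \<longrightarrow> R q x \<le> R q' x)"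
    using mono le1 top bot
  proof eventually_elim
    case (elim x)
    have lt: "R q x < \<top>" for q using elim(2) by (metis ennreal_one_less_top le_less_trans)
    have D: "ennreal (D q x) = R q x" for q using lt[of q] by (simp add: D_def)
    have "D q x \<le> D q' x" if "q \<le> q'" for q q'
      using elim(1) that lt unfolding D_def by (simp add: enn2real_mono)
    moreover have "D q x \<le> 1" for q
      using elim(2) unfolding D_def by (metis enn2real_1 enn2real_mono ennreal_one_less_top)
    moreover have "\<exists>q. D q x < 1 / Suc n" for n :: nat
    proof -
      have "(INF m::nat. R (- of_nat m) x) < ennreal (1 / Suc n)" 
        by (rule le_less_trans[OF elim(4)]) simp
      then obtain m :: nat where "R (- of_nat m) x < ennreal (1 / Suc n)" unfolding INF_less_iff by blast
      then have "ennreal (D (- of_nat m) x) < ennreal (1 / Suc n)" by (simp only: D)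
      then show ?thesis by (intro exI[of _ "- of_nat m"]) (simp add: ennreal_less_iff D_def)
    qed
    moreover have "\<exists>q. 1 - 1 / Suc n < D q x" for n :: nat
    proof -
      have "ennreal (1 - 1 / Suc n) < 1" 
        by (subst ennreal_1[symmetric], subst ennreal_less_iff) auto
      then have "ennreal (1 - 1 / Suc n) < (SUP m::nat. R (of_nat m) x)"
        using elim(3) by (rule less_le_trans)
      then obtain m :: nat where "ennreal (1 - 1 / Suc n) < R (of_nat m) x" unfolding less_SUP_iff by blast
      then have "ennreal (1 - 1 / Suc n) < ennreal (D (of_nat m) x)" by (simp only: D)
      then show ?thesis by (intro exI[of _ "of_nat m"]) (simp add: ennreal_less_iff)
    qed
    ultimately show ?case using D elim(1) by (auto simp: good_cdf_def D_def)
  qed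
  define g where "g x = cdf_inverse (\<lambda>q. D q x)" for x
  have g: "step L g" unfolding g_def using Dm by (rule step_cdf_inverse)
  have "P = step_law L g"
  proof (rule pair_measure_eqI_lessThan[OF P sets])
    show "sets (step_law L g) = sets (M \<Otimes>\<^sub>M borel)"
      unfolding step_law_def using sL by (simp cong: sets_pair_measure_cong)
    fix A and t :: real assume A: "A \<in> sets M"
    obtain r :: "nat \<Rightarrow> rat" where r: "incseq r" "\<And>n. of_rat (r n) < t" "\<And>s. s < t \<Longrightarrow> \<exists>n. s < of_rat (r n)"
      using rat_seq_below[of t] by metis
    have "{..<t} = (\<Union>n. C (r n))"
      unfolding C_def by (rule lessThan_eq_UN_atMost) (use r in auto)
    then have "A \<times> {..<t} = (\<Union>n. A \<times> C (r n))" by auto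
    then have "emeasure P (A \<times> {..<t}) = emeasure P (\<Union>n. A \<times> C (r n))" by (rule arg_cong)
    also have "\<dots> = (SUP n. emeasure P (A \<times> C (r n)))"
      using r(1) rect[OF A] by (intro SUP_emeasure_incseq[symmetric]) (auto simp: C_def incseq_def of_rat_less_eq intro: order_trans)
    also have "\<dots> = (SUP n. \<integral>\<^sup>+x. R (r n) x * indicator A x \<partial>L)"
      by (simp add: R[OF A])
    \<comment> \<open>The densities increase with \<open>q\<close> only almost everywhere, hence the
      almost everywhere form of monotone convergence.\<close>
    also have "\<dots> = (\<integral>\<^sup>+x. (SUP n. R (r n) x * indicator A x) \<partial>L)"
    proof (rule nn_integral_monotone_convergence_SUP_AE[symmetric])
      show "AE x in L. R (r n) x * indicator A x \<le> R (r (Suc n)) x * indicator A x" for n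
        using mono by eventually_elim (use r(1) in \<open>auto simp: incseq_SucD intro!: mult_right_mono\<close>)
    qed (use A sL in measurable)
    also have "\<dots> = (\<integral>\<^sup>+x. emeasure unit_measure {v \<in> {0<..<1}. g x v \<in> {..<t}} * indicator A x \<partial>L)"
    proof (rule nn_integral_cong_AE)
      show "AE x in L. (SUP n. R (r n) x * indicator A x) = emeasure unit_measure {v \<in> {0<..<1}. g x v \<in> {..<t}} * indicator A x"
        using good
      proof eventually_elim
        case (elim x)
        then have "emeasure unit_measure {v \<in> {0<..<1}. g x v \<in> {..<t}} = (SUP n. R (r n) x)"
          using emeasure_cdf_inverse[OF _ r, of "\<lambda>q. D q x"] unfolding g_def by simp
        then show ?case by (auto split: split_indicator)
      qed
    qed
    also have "\<dots> = emeasure (step_law L g) (A \<times> {..<t})"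
      using A sL by (intro emeasure_step_law[OF L g, symmetric]) auto
    finally show "emeasure P (A \<times> {..<t}) = emeasure (step_law L g) (A \<times> {..<t})" .
  qed
  then have "P = step_law (distr P M fst) g" unfolding L_def .
  moreover have "step M g" using g step_cong_sets[OF sL, of g] by blast
  ultimately show thesis by (intro that[of g])
qed

subsection \<open>Recursively built quantile processes\<close>

lemma atLeastLessThan_Suc_Un: "{0..<Suc k} = {0..<k} \<union> {k}"
  by auto

lemma measurable_RN_upd:
  assumes "f \<in> measurable M (RN k)" "h \<in> borel_measurable M"
  shows "(\<lambda>x. (f x)(k := h x)) \<in> measurable M (RN (Suc k))"
  by (rule measurable_fun_upd[where J="{0..<k}"]) (use assms atLeastLessThan_Suc_Un in auto)

lemma measurable_RN_restrict: "k \<le> n \<Longrightarrow> (\<lambda>x. restrict x {0..<k}) \<in> measurable (RN n) (RN k)"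
  by (rule measurable_restrict_subset) auto

lemma RN_restrict_id: "x \<in> space (RN n) \<Longrightarrow> restrict x {0..<n} = x"
  by (simp add: space_RN extensional_restrict)

lemma RN_upd_restrict: "x \<in> space (RN k) \<Longrightarrow> restrict (x(k := a)) {0..<k} = x"
  by (auto simp: space_RN restrict_def extensional_def)

lemma restrict_Suc_upd: "(restrict x {0..<k})(k := x k) = restrict x {0..<Suc k}"
  by (auto simp: restrict_def)

text \<open>The first \<open>n\<close> outputs are kept as a point of \<open>RN n\<close>, with
  value \<open>undefined\<close> from \<open>n\<close> on, so that they can be fed to
  \<open>G n\<close> as they stand. Only the inputs below \<open>n\<close> are read.\<close>

primrec build :: "(nat \<Rightarrow> (nat \<Rightarrow> real) \<Rightarrow> real \<Rightarrow> real) \<Rightarrow> nat \<Rightarrow> (nat \<Rightarrow> real) \<Rightarrow> nat \<Rightarrow> real" where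
  "build G 0 u = (\<lambda>_. undefined)"
| "build G (Suc n) u = (build G n u)(n := G n (build G n u) (u n))"

lemma build_space: "build G n u \<in> space (RN n)"
  by (induction n) (auto simp: space_RN extensional_def)

lemma build_undefined: "n \<le> k \<Longrightarrow> build G n u k = undefined"
  using build_space[of G n u] by (auto simp: space_RN extensional_def)

lemma build_apply: "k < n \<Longrightarrow> build G n u k = G k (build G k u) (u k)"
  by (induction n) (auto simp: less_Suc_eq)

lemma restrict_build: "k \<le> n \<Longrightarrow> restrict (build G n u) {0..<k} = build G k u"
  by (rule ext) (auto simp: restrict_def build_apply build_undefined)

lemma build_cong: "(\<And>j. j < n \<Longrightarrow> u j = w j) \<Longrightarrow> build G n u = build G n w"
  by (induction n) auto

lemma measurable_build:
  assumes G: "\<And>k. k < n \<Longrightarrow> step (RN k) (G k)" and "n \<le> N"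
  shows "build G n \<in> measurable (cube N) (RN n)"
  using assms
proof (induction n)
  case 0
  show ?case by (rule measurable_PiM_single') (auto simp: space_PiM)
next
  case (Suc n)
  then have IH: "build G n \<in> measurable (cube N) (RN n)" by simp
  show ?case
    unfolding build.simps
    by (intro measurable_RN_upd IH step_measurable2[OF Suc.prems(1)] measurable_cube_component) (use Suc.prems in auto)
qed

lemma quantile_process_build:
  assumes G: "\<And>k. k < N \<Longrightarrow> step (RN k) (G k)"
  shows "quantile_process N (build G N)"
  unfolding quantile_process_def triangular_def prop_inc_def prop_con_def
proof (intro conjI allI ballI impI)
  show "build G N \<in> measurable (cube N) (RN N)"
    by (rule measurable_build[OF G]) auto
next
  fix k and u w :: "nat \<Rightarrow> real" assume "k < N" "\<forall>j\<le>k. u j = w j"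
  then show "build G N u k = build G N w k"
    using build_cong[of k u w G] by (simp add: build_apply)
next
  fix k v and u :: "nat \<Rightarrow> real" assume k: "k < N" and u: "u \<in> space (cube N)" and v: "v \<in> {0<..<1}" "u k \<le> v"
  have "u k \<in> {0<..<1}" using u k by (auto simp: space_cube)
  moreover have "build G k (u(k := v)) = build G k u" by (rule build_cong) auto
  ultimately show "build G N u k \<le> build G N (u(k := v)) k"
    using k v mono_onD[OF step_mono[OF G[OF k] build_space[of G k u]]] by (simp add: build_apply)
next
  fix k m v and u :: "nat \<Rightarrow> real"
  assume k: "k < N" and m: "k \<le> m \<and> m < N" and eq: "build G N u k = build G N (u(k := v)) k"
  have b: "build G k (u(k := v)) = build G k u" by (rule build_cong) auto
  \<comment> \<open>The heart of (con): once the outputs at \<open>k\<close> agree, the prefixes of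
    length \<open>k + 1\<close> agree, and from there on the recursion reads only prefixes and
    unchanged inputs.\<close>
  have "build G n (u(k := v)) = build G n u" if "k < n" for n
    using that
  proof (induction n)
    case (Suc n)
    show ?case
    proof (cases "n = k")
      case True
      show ?thesis using eq[unfolded build_apply[OF k] b] by (simp only: True build.simps b)
    next
      case False
      then show ?thesis using Suc by auto
    qed
  qed simp
  then show "build G N u m = build G N (u(k := v)) m"
    using m eq by (cases "m = k") (auto simp: build_apply)
qed

section \<open>Splitting off the last coordinate of a law\<close>

text \<open>Together with the map \<open>x \<mapsto> (restrict x {0..<k}, x k)\<close> this
  identifies laws on \<open>RN (Suc k)\<close> with laws on
  \<open>RN k \<Otimes>\<^sub>M borel\<close>; the two passages turn out to be inverse to each
  other.\<close>

definition append_law :: "nat \<Rightarrow> ((nat \<Rightarrow> real) \<times> real) measure \<Rightarrow> (nat \<Rightarrow> real) measure" where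
  "append_law k P = distr P (RN (Suc k)) (\<lambda>(x, y). x(k := y))"

lemma measurable_append: "(\<lambda>(x, y). x(k := y)) \<in> measurable (RN k \<Otimes>\<^sub>M borel) (RN (Suc k))"
  unfolding split_beta by (rule measurable_RN_upd) auto

lemma measurable_split_last: "(\<lambda>x. (restrict x {0..<k}, x k)) \<in> measurable (RN (Suc k)) (RN k \<Otimes>\<^sub>M borel)"
  by (intro measurable_Pair measurable_RN_restrict measurable_component_singleton) auto

lemma split_append_law:
  assumes "sets P = sets (RN k \<Otimes>\<^sub>M borel)"
  shows "distr (append_law k P) (RN k \<Otimes>\<^sub>M borel) (\<lambda>x. (restrict x {0..<k}, x k)) = P"
proof -
  have m: "(\<lambda>(x, y). x(k := y)) \<in> measurable P (RN (Suc k))"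
    using measurable_append measurable_cong_sets[OF assms refl] by blast
  have sp: "space P = space (RN k) \<times> UNIV"
    using sets_eq_imp_space_eq[OF assms] by (simp add: space_pair_measure)
  have "distr (append_law k P) (RN k \<Otimes>\<^sub>M borel) (\<lambda>x. (restrict x {0..<k}, x k)) = distr P (RN k \<Otimes>\<^sub>M borel) (\<lambda>x. x)"
    unfolding append_law_def
    by (subst distr_distr[OF measurable_split_last m], rule distr_cong)
       (auto simp: sp RN_upd_restrict RN_restrict_id)
  also have "\<dots> = P" by (rule distr_id2[OF assms[symmetric]])
  finally show ?thesis .
qed

lemma append_split_law:
  assumes "sets \<mu> = sets (RN (Suc k))"
  shows "append_law k (distr \<mu> (RN k \<Otimes>\<^sub>M borel) (\<lambda>x. (restrict x {0..<k}, x k))) = \<mu>"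
proof -
  have m: "(\<lambda>x. (restrict x {0..<k}, x k)) \<in> measurable \<mu> (RN k \<Otimes>\<^sub>M borel)"
    using measurable_split_last measurable_cong_sets[OF assms refl] by blast
  have sp: "space \<mu> = space (RN (Suc k))"
    by (rule sets_eq_imp_space_eq[OF assms])
  have "append_law k (distr \<mu> (RN k \<Otimes>\<^sub>M borel) (\<lambda>x. (restrict x {0..<k}, x k))) = distr \<mu> (RN (Suc k)) (\<lambda>x. x)"
    unfolding append_law_def
    by (subst distr_distr[OF measurable_append m], rule distr_cong)
       (auto simp: sp restrict_Suc_upd RN_restrict_id)
  also have "\<dots> = \<mu>" by (rule distr_id2[OF assms[symmetric]])
  finally show ?thesis .
qed

lemma sets_step_law: "sets (step_law M g) = sets (M \<Otimes>\<^sub>M borel)"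
  by (simp add: step_law_def)

abbreviation law :: "nat \<Rightarrow> ((nat \<Rightarrow> real) \<Rightarrow> nat \<Rightarrow> real) \<Rightarrow> (nat \<Rightarrow> real) measure" where
  "law N T \<equiv> distr (cube N) (RN N) T"

lemma prob_space_law: "T \<in> measurable (cube N) (RN N) \<Longrightarrow> prob_space (law N T)"
  by (rule cube.prob_space_distr)

text \<open>The last input is independent of the earlier ones, so given the prefix the new output is
  \<open>G n\<close> of this prefix at a fresh uniform variable, which is what
  \<open>step_law\<close> describes.\<close>

lemma law_build_Suc:
  assumes G: "\<And>k. k < Suc n \<Longrightarrow> step (RN k) (G k)"
  shows "law (Suc n) (build G (Suc n)) = append_law n (step_law (law n (build G n)) (G n))"
proof -
  interpret pair_sigma_finite "cube n" unit_measure ..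
  have b: "build G n \<in> measurable (cube n) (RN n)"
    by (rule measurable_build) (use G in auto)
  have bS: "build G (Suc n) \<in> measurable (cube (Suc n)) (RN (Suc n))"
    by (rule measurable_build) (use G in auto)
  have st: "step (law n (build G n)) (G n)"
    using G[of n] step_cong_sets[of "law n (build G n)" "RN n"] by simp
  have upd: "(\<lambda>(u, v). u(n := v)) \<in> measurable (cube n \<Otimes>\<^sub>M unit_measure) (cube (Suc n))"
    unfolding split_beta cube_def
    by (rule measurable_fun_upd[where J="{0..<n}"]) auto
  have prod: "law n (build G n) \<Otimes>\<^sub>M unit_measure =
      distr (cube n \<Otimes>\<^sub>M unit_measure) (RN n \<Otimes>\<^sub>M unit_measure) (\<lambda>(u, v). (build G n u, v))"
    using pair_measure_distr[OF b measurable_ident[of unit_measure]] unit.sigma_finite_measure_axioms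
    by (simp add: distr_id id_def)
  have bm: "(\<lambda>(u, v). (build G n u, v)) \<in> measurable (cube n \<Otimes>\<^sub>M unit_measure) (RN n \<Otimes>\<^sub>M unit_measure)"
    using b by measurable
  have stm: "(\<lambda>(x, v). (x, G n x v)) \<in> measurable (RN n \<Otimes>\<^sub>M unit_measure) (RN n \<Otimes>\<^sub>M borel)"
    by (rule measurable_step_pair) (use G in auto)
  have "law (Suc n) (build G (Suc n)) = distr (distr (cube n \<Otimes>\<^sub>M unit_measure) (cube (Suc n)) (\<lambda>(u, v). u(n := v))) (RN (Suc n)) (build G (Suc n))"
    by (simp add: distr_cube_Suc)
  also have "\<dots> = distr (cube n \<Otimes>\<^sub>M unit_measure) (RN (Suc n)) (\<lambda>(u, v). (build G n u)(n := G n (build G n u) v))"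
    by (subst distr_distr[OF bS upd], rule distr_cong) (auto simp: build_cong[of n "_(n := _)"])
  also have "\<dots> = append_law n (step_law (law n (build G n)) (G n))"
    unfolding append_law_def step_law_def prod
    apply (subst distr_distr[OF _ bm])
    subgoal using stm by (simp cong: measurable_cong_sets sets_pair_measure_cong)
    apply (subst distr_distr)
    subgoal using measurable_append by (simp cong: measurable_cong_sets sets_pair_measure_cong)
    subgoal using measurable_comp[OF bm stm] by (simp cong: measurable_cong_sets sets_pair_measure_cong)
    apply (rule distr_cong)
    apply (auto simp: split_beta comp_def)
    done
  finally show ?thesis .
qed

lemma build_cong_steps: "(\<And>k. k < n \<Longrightarrow> G k = H k) \<Longrightarrow> build G n u = build H n u"
  by (induction n) auto

lemma distr_step_law_fst:
  assumes "prob_space M" "step M g"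
  shows "distr (step_law M g) M fst = M"
proof -
  interpret prob_space M by fact
  have "distr (step_law M g) M fst = distr (M \<Otimes>\<^sub>M unit_measure) M fst"
    unfolding step_law_def
    by (subst distr_distr[OF measurable_fst measurable_step_pair[OF assms(2)]], rule distr_cong) auto
  also have "\<dots> = M"
  proof (rule measure_eqI)
    fix A assume "A \<in> sets (distr (M \<Otimes>\<^sub>M unit_measure) M fst)"
    then have A: "A \<in> sets M" by simp
    have "fst -` A \<inter> space (M \<Otimes>\<^sub>M unit_measure) = A \<times> space unit_measure"
      using sets.sets_into_space[OF A] by (auto simp: space_pair_measure)
    then have "emeasure (distr (M \<Otimes>\<^sub>M unit_measure) M fst) A = emeasure (M \<Otimes>\<^sub>M unit_measure) (A \<times> space unit_measure)"
      using A by (simp add: emeasure_distr)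
    also have "\<dots> = emeasure M A"
      unfolding unit.emeasure_pair_measure_Times[OF A sets.top] unit.emeasure_space_1 by simp
    finally show "emeasure (distr (M \<Otimes>\<^sub>M unit_measure) M fst) A = emeasure M A" .
  qed simp
  finally show ?thesis .
qed

text \<open>The default wherever no step is prescribed: measurable and strictly increasing over any
  base space.\<close>

lemma step_identity: "step M (\<lambda>x v. v)"
proof -
  have "snd \<in> borel_measurable (M \<Otimes>\<^sub>M unit_measure)"
    using measurable_snd[of M unit_measure] by (simp add: measurable_unit_measure_iff)
  then show ?thesis by (simp add: step_def mono_on_def split_beta')
qed

text \<open>Peeling from the top: the last coordinate is disintegrated over the law of the first
  \<open>n\<close>, and that law is realised by the induction hypothesis, which is therefore kept
  general in \<open>\<mu>\<close>.\<close>

lemma build_exists: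
  assumes "prob_space \<mu>" "sets \<mu> = sets (RN N)"
  shows "\<exists>G. (\<forall>k. step (RN k) (G k)) \<and> law N (build G N) = \<mu>"
  using assms
proof (induction N arbitrary: \<mu>)
  case 0
  interpret prob_space \<mu> by fact
  \<comment> \<open>\<open>RN 0\<close> has a single point and so carries only one probability
    measure.\<close>
  have *: "law 0 (build G 0) = \<mu>" for G
  proof (rule measure_eqI)
    interpret L: prob_space "law 0 (build G 0)"
      by (intro prob_space_law measurable_build) auto
    show "sets (law 0 (build G 0)) = sets \<mu>" using 0 by simp
    have sp: "space \<mu> = {\<lambda>_. undefined}" 
      using sets_eq_imp_space_eq[OF 0(2)] by (simp add: space_PiM)
    fix A assume "A \<in> sets (law 0 (build G 0))"
    then have "A \<subseteq> {\<lambda>_. undefined}" using sets.sets_into_space sp 0 by (metis sets_distr)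
    then consider "A = {}" | "A = space \<mu>" unfolding sp by (metis subset_singletonD)
    then show "emeasure (law 0 (build G 0)) A = emeasure \<mu> A"
    proof cases
      case 2
      have "space \<mu> = space (law 0 (build G 0))"
        using sets_eq_imp_space_eq[OF 0(2)] by simp
      then show ?thesis using 2 emeasure_space_1 L.emeasure_space_1 by simp
    qed simp
  qed
  show ?case
    by (intro exI[of _ "\<lambda>k x v. v"] conjI allI step_identity *)
next
  case (Suc n)
  interpret prob_space \<mu> by fact
  define P where "P = distr \<mu> (RN n \<Otimes>\<^sub>M borel) (\<lambda>x. (restrict x {0..<n}, x n))"
  have m: "(\<lambda>x. (restrict x {0..<n}, x n)) \<in> measurable \<mu> (RN n \<Otimes>\<^sub>M borel)"
    using measurable_split_last measurable_cong_sets[OF Suc.prems(2) refl] by blast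
  have P: "prob_space P" unfolding P_def by (rule prob_space_distr[OF m])
  have sP: "sets P = sets (RN n \<Otimes>\<^sub>M borel)" by (simp add: P_def)
  obtain g where g: "step (RN n) g" "P = step_law (distr P (RN n) fst) g"
    by (rule step_law_exists[OF P sP])
  have "fst \<in> measurable P (RN n)"
    using measurable_fst measurable_cong_sets[OF sP refl] by blast
  then have "prob_space (distr P (RN n) fst)" by (rule prob_space.prob_space_distr[OF P])
  from Suc.IH[OF this] obtain G where G: "\<forall>k. step (RN k) (G k)" "law n (build G n) = distr P (RN n) fst"
    by auto
  define H where "H = G(n := g)"
  have H: "step (RN k) (H k)" for k using G g by (simp add: H_def)
  have bH: "build H n = build G n"
    by (rule ext, rule build_cong_steps) (simp add: H_def)
  have Hn: "H n = g" by (simp add: H_def)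
  have "law (Suc n) (build H (Suc n)) = append_law n P"
    unfolding law_build_Suc[OF H] bH Hn G(2) g(2)[symmetric] by (rule refl)
  also have "\<dots> = \<mu>" unfolding P_def by (rule append_split_law[OF Suc.prems(2)])
  finally show ?case using H by (intro exI[of _ H] conjI allI)
qed

text \<open>Points of \<open>RN n\<close> are extensional, so equality is a condition on finitely
  many real coordinates. The measurability is required for passing from almost every line back to
  almost every point of a product.\<close>

lemma sets_RN_eq:
  assumes "f \<in> measurable M (RN n)" "g \<in> measurable M (RN n)"
  shows "{x \<in> space M. f x = g x} \<in> sets M"
proof -
  have c: "(\<lambda>x. h x k) \<in> borel_measurable M" if "h \<in> measurable M (RN n)" "k < n" for h k
    using measurable_compose[OF that(1) measurable_component_singleton[of k]] that(2) by simp
  have "f x = g x \<longleftrightarrow> (\<forall>k\<in>{0..<n}. f x k = g x k)" if "x \<in> space M" for x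
    using measurable_space[OF assms(1) that] measurable_space[OF assms(2) that]
    by (auto simp: space_RN intro: extensionalityI)
  then have "{x \<in> space M. f x = g x} = {x \<in> space M. \<forall>k\<in>{0..<n}. f x k = g x k}" by auto
  also have "\<dots> \<in> sets M"
    by (intro sets.sets_Collect_finite_All borel_measurable_eq c assms) auto
  finally show ?thesis .
qed

text \<open>After splitting, the law of \<open>n + 1\<close> outputs gives the law of the first
  \<open>n\<close> as its marginal, to which the induction hypothesis applies, and the joint law
  with the last output, to which \<open>step_law_unique\<close> applies.\<close>

lemma build_law_unique:
  assumes "\<And>k. step (RN k) (G k)" "\<And>k. step (RN k) (H k)"
    and "law n (build G n) = law n (build H n)"
  shows "AE u in cube n. build G n u = build H n u"
  using assms(3)
proof (induction n)
  case 0
  show ?case by simp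
next
  case (Suc n)
  interpret pair_sigma_finite "cube n" unit_measure ..
  note G = assms(1) and H = assms(2)
  let ?g = "law n (build G n)" and ?h = "law n (build H n)"
  have mG: "build G k \<in> measurable (cube k) (RN k)" and mH: "build H k \<in> measurable (cube k) (RN k)" for k
    using G H by (auto intro: measurable_build)
  have st: "step ?g (G n)" "step ?h (H n)"
    using G[of n] H[of n] step_cong_sets[OF sets_distr, of "cube n" "RN n"] by blast+
  have s: "sets (step_law ?g (G n)) = sets (RN n \<Otimes>\<^sub>M borel)" "sets (step_law ?h (H n)) = sets (RN n \<Otimes>\<^sub>M borel)"
    unfolding sets_step_law by (auto intro!: sets_pair_measure_cong)
  have eq: "step_law ?g (G n) = step_law ?h (H n)"
    using arg_cong[OF Suc.prems[unfolded law_build_Suc[OF G] law_build_Suc[OF H]],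
        of "\<lambda>P. distr P (RN n \<Otimes>\<^sub>M borel) (\<lambda>x. (restrict x {0..<n}, x n))"]
    unfolding split_append_law[OF s(1)] split_append_law[OF s(2)] .
  \<comment> \<open>\<open>RN n\<close> and a law on it have the same measurable sets, so they are
    interchangeable as targets of \<open>distr\<close>.\<close>
  have "distr (step_law ?g (G n)) (RN n) fst = distr (step_law ?g (G n)) ?g fst"
    "distr (step_law ?h (H n)) (RN n) fst = distr (step_law ?h (H n)) ?h fst"
    by (rule distr_cong; simp)+
  then have d: "distr (step_law ?g (G n)) (RN n) fst = ?g" "distr (step_law ?h (H n)) (RN n) fst = ?h"
    unfolding distr_step_law_fst[OF prob_space_law[OF mG] st(1)] distr_step_law_fst[OF prob_space_law[OF mH] st(2)] .
  have law_eq: "?g = ?h"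
  proof -
    have "?g = distr (step_law ?g (G n)) (RN n) fst" by (rule d(1)[symmetric])
    also have "\<dots> = distr (step_law ?h (H n)) (RN n) fst" by (simp only: eq)
    finally show ?thesis unfolding d(2) .
  qed
  have "AE x in ?g. AE v in unit_measure. G n x v = H n x v"
    by (rule step_law_unique[OF prob_space_law[OF mG] st(1) st(2)[folded law_eq] eq[folded law_eq]])
  then have "AE u in cube n. AE v in unit_measure. G n (build G n u) v = H n (build G n u) v"
    by (rule AE_distrD[OF mG])
  then have ae: "AE u in cube n. AE v in unit_measure. build G (Suc n) (u(n := v)) = build H (Suc n) (u(n := v))"
    using Suc.IH[OF law_eq]
  proof eventually_elim
    case (elim u)
    from elim(1) show ?case
      by eventually_elim (use elim(2) in \<open>simp add: build_cong[of n "u(n := _)" u]\<close>)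
  qed
  have upd: "(\<lambda>(u, v). u(n := v)) \<in> measurable (cube n \<Otimes>\<^sub>M unit_measure) (cube (Suc n))"
    unfolding split_beta cube_def by (rule measurable_fun_upd[where J="{0..<n}"]) auto
  note S = sets_RN_eq[OF mG mH, of "Suc n"]
  have "AE z in cube n \<Otimes>\<^sub>M unit_measure. build G (Suc n) ((\<lambda>(u, v). u(n := v)) z) = build H (Suc n) ((\<lambda>(u, v). u(n := v)) z)"
  proof (rule AE_pair_measure)
    show "{z \<in> space (cube n \<Otimes>\<^sub>M unit_measure). build G (Suc n) ((\<lambda>(u, v). u(n := v)) z) = build H (Suc n) ((\<lambda>(u, v). u(n := v)) z)}
      \<in> sets (cube n \<Otimes>\<^sub>M unit_measure)"
      by (rule sets_RN_eq[OF measurable_compose[OF upd mG] measurable_compose[OF upd mH]])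
  qed (use ae in simp)
  then have "AE u in distr (cube n \<Otimes>\<^sub>M unit_measure) (cube (Suc n)) (\<lambda>(u, v). u(n := v)). build G (Suc n) u = build H (Suc n) u"
    unfolding AE_distr_iff[OF upd S] .
  then show ?case unfolding distr_cube_Suc .
qed

subsection \<open>Every quantile process is built recursively\<close>

text \<open>The fibre of \<open>f\<close> through \<open>v\<close> is an interval with end points
  \<open>a\<close> and \<open>b\<close>. If they coincide, the midpoint is \<open>v\<close> itself;
  otherwise it lies strictly inside the fibre. Infimum and supremum over the rationals, with the
  neutral values 1 and 0 for points that do not qualify, make \<open>a\<close> and \<open>b\<close>
  measurable in parameters of \<open>f\<close>.\<close>

lemma mono_fibre_midpoint:
  fixes f :: "real \<Rightarrow> real"
  assumes f: "mono_on {0<..<1} f" and v: "v \<in> {0<..<1}"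
  defines "a \<equiv> INF q\<in>\<rat> \<inter> {0<..<1}. if f v \<le> f q then q else 1"
    and "b \<equiv> SUP q\<in>\<rat> \<inter> {0<..<1}. if f q \<le> f v then q else 0"
  shows "(a + b) / 2 \<in> {0<..<1}" and "f ((a + b) / 2) = f v"
proof -
  let ?I = "\<rat> \<inter> {0<..<1::real}"
  let ?F = "\<lambda>q. if f v \<le> f q then q else 1" and ?H = "\<lambda>q. if f q \<le> f v then q else 0"
  have v01: "0 < v" "v < 1" using v by auto
  have ne: "?I \<noteq> {}" using Rats_dense_in_real[of 0 1] by auto
  have bF: "bdd_below (?F ` ?I)" by (rule bdd_belowI[of _ 0]) auto
  have bH: "bdd_above (?H ` ?I)" by (rule bdd_aboveI[of _ 1]) auto
  have mono: "\<And>s t. 0 < s \<Longrightarrow> s \<le> t \<Longrightarrow> t < 1 \<Longrightarrow> f s \<le> f t"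
    using f by (auto simp: mono_on_def)
  have av: "a \<le> v"
  proof (rule ccontr)
    assume "\<not> a \<le> v"
    then have "v < min a 1" using v01 by auto
    from Rats_dense_in_real[OF this] obtain q where q: "q \<in> \<rat>" "v < q" "q < a" "q < 1" by auto
    then have qI: "q \<in> ?I" using v01 by auto
    have "f v \<le> f q" using mono[of v q] q v01 by auto
    then have "a \<le> q" unfolding a_def using cINF_lower[OF bF qI] by simp
    then show False using q by simp
  qed
  have vb: "v \<le> b"
  proof (rule ccontr)
    assume "\<not> v \<le> b"
    then have "max b 0 < v" using v01 by auto
    from Rats_dense_in_real[OF this] obtain q where q: "q \<in> \<rat>" "q < v" "b < q" "0 < q" by auto
    then have qI: "q \<in> ?I" using v01 by auto
    have "f q \<le> f v" using mono[of q v] q v01 by auto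
    then have "q \<le> b" unfolding b_def using cSUP_upper[OF qI bH] by simp
    then show False using q by simp
  qed
  have a0: "0 \<le> a" unfolding a_def by (rule cINF_greatest[OF ne]) auto
  have b1: "b \<le> 1" unfolding b_def by (rule cSUP_least[OF ne]) auto
  show m: "(a + b) / 2 \<in> {0<..<1}" using a0 b1 av vb v01 by auto
  show "f ((a + b) / 2) = f v"
  proof (cases "a = b")
    case True
    then show ?thesis using av vb by simp
  next
    case False
    then have ab: "a < (a + b) / 2" "(a + b) / 2 < b" using av vb by auto
    obtain q where q: "q \<in> ?I" "?F q < (a + b) / 2"
      using ab(1) unfolding a_def[symmetric] by (metis (no_types, lifting) a_def bF cINF_less_iff ne)
    have "f v \<le> f ((a + b) / 2)"
    proof -
      have "f v \<le> f q" "q < (a + b) / 2" using q m by (auto split: if_splits)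
      moreover have "f q \<le> f ((a + b) / 2)" using q m calculation by (intro mono) auto
      ultimately show ?thesis by simp
    qed
    moreover
    obtain r where r: "r \<in> ?I" "(a + b) / 2 < ?H r"
      using ab(2) by (metis (no_types, lifting) b_def bH less_cSUP_iff ne)
    have "f ((a + b) / 2) \<le> f v"
    proof -
      have "f r \<le> f v" "(a + b) / 2 < r" using r m by (auto split: if_splits)
      moreover have "f ((a + b) / 2) \<le> f r" using r m calculation by (intro mono) auto
      ultimately show ?thesis by simp
    qed
    ultimately show ?thesis by simp
  qed
qed

lemma triangular_cong:
  "triangular N T \<Longrightarrow> k < N \<Longrightarrow> u \<in> space (cube N) \<Longrightarrow> w \<in> space (cube N) \<Longrightarrow>
    (\<And>j. j \<le> k \<Longrightarrow> u j = w j) \<Longrightarrow> T u k = T w k"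
  unfolding triangular_def by blast

lemma triangular_measurable: "triangular N T \<Longrightarrow> T \<in> measurable (cube N) (RN N)"
  unfolding triangular_def by blast

lemma prop_inc_mono_on:
  assumes "prop_inc N T" "k < N" "u \<in> space (cube N)"
  shows "mono_on {0<..<1} (\<lambda>v. T (u(k := v)) k)"
proof (rule mono_onI)
  fix v w :: real assume vw: "v \<in> {0<..<1}" "w \<in> {0<..<1}" "v \<le> w"
  have "u(k := v) \<in> space (cube N)" by (rule cube_upd_in) (use assms vw in auto)
  from assms(1)[unfolded prop_inc_def, rule_format, OF assms(2) this vw(2)] vw(3)
  have "T (u(k := v)) k \<le> T ((u(k := v))(k := w)) k" by simp
  then show "T (u(k := v)) k \<le> T (u(k := w)) k" by simp
qed

text \<open>Condition (con) iterated: by changing the first \<open>i\<close> inputs one at a time, the later outputs of a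
  quantile process depend on these inputs only through the first \<open>i\<close> outputs.\<close>

lemma quantile_process_propagate:
  assumes T: "quantile_process N T" and u: "u \<in> space (cube N)" and w: "w \<in> space (cube N)"
    and eq: "\<And>j. j < i \<Longrightarrow> T w j = T u j" and i: "i \<le> N" and m: "i \<le> m" "m < N"
  shows "T (\<lambda>j. if j < i then w j else u j) m = T u m"
  using eq i m
proof (induction i arbitrary: m)
  case 0
  then show ?case by simp
next
  case (Suc i)
  define h where "h i = (\<lambda>j. if j < i then w j else u j)" for i
  have tri: "triangular N T" and con: "prop_con N T" using T by (auto simp: quantile_process_def)
  have h: "h j \<in> space (cube N)" for j
    using u w by (auto simp: h_def space_cube PiE_iff extensional_def)
  have upd: "h (Suc i) = (h i)(i := w i)" by (auto simp: h_def)
  have wi: "w i \<in> {0<..<1}" using w Suc.prems by (auto simp: space_cube)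
  have IH: "T (h i) k = T u k" if "i \<le> k" "k < N" for k
    unfolding h_def by (rule Suc.IH) (use Suc.prems that in auto)
  have "T (h (Suc i)) i = T w i"
    by (rule triangular_cong[OF tri _ h w]) (use Suc.prems in \<open>auto simp: h_def\<close>)
  also have "\<dots> = T (h i) i" using Suc.prems IH[of i] by simp
  finally have "T (h i) i = T ((h i)(i := w i)) i" by (simp add: upd)
  then have "T (h i) m = T ((h i)(i := w i)) m"
    using con[unfolded prop_con_def, rule_format, of i m "h i" "w i"] h[of i] wi Suc.prems(3,4) by linarith
  then show ?case using IH[of m] Suc.prems unfolding upd[symmetric] by (simp add: h_def)
qed

text \<open>By propagation the first \<open>k\<close> inputs can be exchanged, and by triangularity
  the inputs after \<open>k\<close> do not affect output \<open>k\<close>. Output \<open>k\<close>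
  is thus a function of the earlier outputs and of its own input, as a step has to be.\<close>

lemma quantile_process_determined:
  assumes T: "quantile_process N T" and u: "u \<in> space (cube N)" and w: "w \<in> space (cube N)"
    and eq: "\<And>j. j < k \<Longrightarrow> T w j = T u j" and k: "k < N" and v: "v \<in> {0<..<1}"
  shows "T (w(k := v)) k = T (u(k := v)) k"
proof -
  have tri: "triangular N T" using T by (simp add: quantile_process_def)
  have u': "u(k := v) \<in> space (cube N)" and w': "w(k := v) \<in> space (cube N)"
    using cube_upd_in u w k v by auto
  have "T w j = T (u(k := v)) j" if "j < k" for j
    using eq[OF that] triangular_cong[OF tri _ u u', of j] that k by simp
  then have "T (\<lambda>j. if j < k then w j else (u(k := v)) j) k = T (u(k := v)) k"
    by (intro quantile_process_propagate[OF T u' w]) (use k in auto)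
  moreover have "T (w(k := v)) k = T (\<lambda>j. if j < k then w j else (u(k := v)) j) k"
    by (rule triangular_cong[OF tri k w'])
       (use u' w in \<open>auto simp: space_cube PiE_iff extensional_def\<close>)
  ultimately show ?thesis by simp
qed

text \<open>One coordinate is treated at a time: an input realising the first \<open>k\<close>
  outputs is kept, and its coordinate \<open>k\<close> is replaced by the midpoint of the fibre over
  the prescribed value. The input found need not be \<open>u\<close>, but it yields the same first
  outputs.\<close>

lemma quantile_process_right_inverse:
  assumes T: "quantile_process N T" and k: "k \<le> N"
  obtains r where "r \<in> measurable (RN k) (cube N)"
    "\<And>u j. u \<in> space (cube N) \<Longrightarrow> j < k \<Longrightarrow> T (r (restrict (T u) {0..<k})) j = T u j"
  using k
proof (induction k arbitrary: thesis)
  case 0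
  obtain u where u: "u \<in> space (cube N)" using cube.not_empty[of N] by blast
  show ?case by (rule "0.prems"(1)[of "\<lambda>_. u"]) (use u in auto)
next
  case (Suc k)
  have tri: "triangular N T" and inc: "prop_inc N T" using T by (auto simp: quantile_process_def)
  note Tm = triangular_measurable[OF tri]
  have k: "k < N" using Suc.prems by simp
  obtain r where rm: "r \<in> measurable (RN k) (cube N)"
    and r: "\<And>u j. u \<in> space (cube N) \<Longrightarrow> j < k \<Longrightarrow> T (r (restrict (T u) {0..<k})) j = T u j"
    by (rule Suc.IH) (use k in auto)
  define \<rho> where "\<rho> y = r (restrict y {0..<k})" for y
  have \<rho>m: "\<rho> \<in> measurable (RN (Suc k)) (cube N)"
    unfolding \<rho>_def by (rule measurable_compose[OF measurable_RN_restrict rm]) simp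
  define a where "a y = (INF q\<in>\<rat> \<inter> {0<..<1}. if y k \<le> T ((\<rho> y)(k := q)) k then q else 1)" for y
  define b where "b y = (SUP q\<in>\<rat> \<inter> {0<..<1}. if T ((\<rho> y)(k := q)) k \<le> y k then q else 0)" for y
  \<comment> \<open>For a \<open>y\<close> that is not attained the midpoint may fall outside (0,
    1); the value 1/2 is used there, so that \<open>c\<close> is admissible as an input for all
    \<open>y\<close>.\<close>
  define c where "c y = (if (a y + b y) / 2 \<in> {0<..<1} then (a y + b y) / 2 else 1 / 2)" for y
  have yk: "(\<lambda>y. y k) \<in> borel_measurable (RN (Suc k))" by (rule measurable_component_singleton) simp
  have Tk: "(\<lambda>x. x k) \<in> borel_measurable (RN N)" by (rule measurable_component_singleton) (use k in simp)
  have Tq: "(\<lambda>y. T ((\<rho> y)(k := q)) k) \<in> borel_measurable (RN (Suc k))" if "q \<in> {0<..<1}" for q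
  proof -
    have "(\<lambda>y. (\<rho> y)(k := q)) \<in> measurable (RN (Suc k)) (cube N)"
      by (rule measurable_cube_upd[OF k \<rho>m]) (use that in \<open>auto intro: measurable_const\<close>)
    from measurable_compose[OF measurable_compose[OF this Tm] Tk] show ?thesis .
  qed
  have cnt: "countable (\<rat> \<inter> {0<..<1::real})" by (intro countable_Int1 countable_rat)
  have am: "a \<in> borel_measurable (RN (Suc k))"
    unfolding a_def
    by (intro borel_measurable_cINF_real cnt measurable_If borel_measurable_const borel_measurable_le yk Tq) auto
  have bm: "b \<in> borel_measurable (RN (Suc k))"
    unfolding b_def
    by (intro borel_measurable_cSUP cnt measurable_If borel_measurable_const borel_measurable_le yk Tq)
       (auto intro!: bdd_aboveI[of _ 1])
  have cm: "c \<in> measurable (RN (Suc k)) unit_measure"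
    unfolding measurable_unit_measure_iff
  proof
    show "c \<in> borel_measurable (RN (Suc k))"
      unfolding c_def greaterThanLessThan_iff using am bm by measurable
  qed (auto simp: c_def)
  show ?case
  proof (rule Suc.prems(1)[of "\<lambda>y. (\<rho> y)(k := c y)"])
    show "(\<lambda>y. (\<rho> y)(k := c y)) \<in> measurable (RN (Suc k)) (cube N)"
      by (rule measurable_cube_upd[OF k \<rho>m cm])
    fix u j assume u: "u \<in> space (cube N)" and j: "j < Suc k"
    define y where "y = restrict (T u) {0..<Suc k}"
    have y: "restrict y {0..<k} = restrict (T u) {0..<k}" "y k = T u k"
      by (auto simp: y_def restrict_def)
    have ysp: "y \<in> space (RN (Suc k))" by (simp add: y_def space_RN)
    define w where "w = \<rho> y"
    have w: "w \<in> space (cube N)" unfolding w_def by (rule measurable_space[OF \<rho>m ysp])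
    have w_eq: "T w i = T u i" if "i < k" for i
      using r[OF u that] by (simp add: w_def \<rho>_def y(1))
    have uk: "u k \<in> {0<..<1}" using u k by (auto simp: space_cube)
    \<comment> \<open>The fibre runs through \<open>w\<close>, not through \<open>u\<close>. By
      \<open>quantile_process_determined\<close> the value \<open>y k\<close> is attained on it at
      \<open>u k\<close>, so the midpoint lemma applies.\<close>
    have Tv: "T (w(k := u k)) k = y k"
      using quantile_process_determined[OF T u w w_eq k uk] unfolding fun_upd_triv y(2) .
    note mid = mono_fibre_midpoint[OF prop_inc_mono_on[OF inc k w] uk, unfolded Tv, folded w_def]
    have ab: "a y = (INF q\<in>\<rat> \<inter> {0<..<1}. if y k \<le> T (w(k := q)) k then q else 1)"
      "b y = (SUP q\<in>\<rat> \<inter> {0<..<1}. if T (w(k := q)) k \<le> y k then q else 0)"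
      by (simp_all add: a_def b_def w_def)
    have c: "c y = (a y + b y) / 2" using mid(1) unfolding ab[symmetric] c_def by simp
    have Tc: "T (w(k := c y)) k = T u k" using mid(2) unfolding ab[symmetric] c[symmetric] unfolding y(2) .
    have c01: "c y \<in> {0<..<1}" using mid(1) unfolding ab[symmetric] c[symmetric] .
    show "T ((\<rho> (restrict (T u) {0..<Suc k}))(k := c (restrict (T u) {0..<Suc k}))) j = T u j"
      unfolding y_def[symmetric] w_def[symmetric]
    proof (cases "j = k")
      case True
      then show "T (w(k := c y)) j = T u j" using Tc by simp
    next
      case False
      then have "j < k" using j by simp
      then have "T (w(k := c y)) j = T w j"
        using k cube_upd_in[OF w c01 k] by (intro triangular_cong[OF tri _ _ w]) auto
      then show "T (w(k := c y)) j = T u j" using w_eq[OF \<open>j < k\<close>] by simp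
    qed
  qed
qed

text \<open>A step is read off by evaluating \<open>T\<close> at the right inverse of the prefix
  with input \<open>k\<close> left free. As the right inverse takes values in the cube for every
  \<open>x\<close>, monotonicity and strictness pass to the step at every \<open>x\<close>, not only
  at attained prefixes.\<close>

lemma quantile_process_eq_build:
  assumes T: "quantile_process N T"
  obtains G where "\<And>k. step (RN k) (G k)" "\<And>u. u \<in> space (cube N) \<Longrightarrow> build G N u = T u"
    "prop_sinc N T \<Longrightarrow> \<forall>k. \<forall>x\<in>space (RN k). strict_mono_on {0<..<1} (G k x)"
proof -
  have tri: "triangular N T" and inc: "prop_inc N T" using T by (auto simp: quantile_process_def)
  note Tm = triangular_measurable[OF tri]
  have "\<exists>r. r \<in> measurable (RN k) (cube N) \<and>
    (\<forall>u\<in>space (cube N). \<forall>j<k. T (r (restrict (T u) {0..<k})) j = T u j)" if "k < N" for k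
    using quantile_process_right_inverse[OF T, of k] that by (metis less_imp_le)
  then obtain r where rm: "\<And>k. k < N \<Longrightarrow> r k \<in> measurable (RN k) (cube N)"
    and r: "\<And>k u j. k < N \<Longrightarrow> u \<in> space (cube N) \<Longrightarrow> j < k \<Longrightarrow> T (r k (restrict (T u) {0..<k})) j = T u j"
    by metis
  define G where "G k x v = (if k < N then T ((r k x)(k := v)) k else v)" for k x v
  have rsp: "r k x \<in> space (cube N)" if "k < N" "x \<in> space (RN k)" for k x
    using measurable_space[OF rm that(2)] that(1) by blast
  have G: "step (RN k) (G k)" for k
  proof (cases "k < N")
    case True
    have Tk: "(\<lambda>x. x k) \<in> borel_measurable (RN N)" by (rule measurable_component_singleton) (use True in simp)
    have "(\<lambda>z. (r k (fst z))(k := snd z)) \<in> measurable (RN k \<Otimes>\<^sub>M unit_measure) (cube N)"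
      by (intro measurable_cube_upd True measurable_compose[OF measurable_fst rm] measurable_snd)
    from measurable_compose[OF measurable_compose[OF this Tm] Tk]
    have "case_prod (G k) \<in> borel_measurable (RN k \<Otimes>\<^sub>M unit_measure)"
      using True by (simp add: G_def split_beta')
    moreover have "mono_on {0<..<1} (G k x)" if "x \<in> space (RN k)" for x
    proof -
      have "G k x = (\<lambda>v. T ((r k x)(k := v)) k)" using True by (simp add: G_def fun_eq_iff)
      then show ?thesis using prop_inc_mono_on[OF inc True rsp[OF True that]] by simp
    qed
    ultimately show ?thesis by (simp add: step_def)
  next
    case False
    then have "G k = (\<lambda>x v. v)" by (simp add: G_def fun_eq_iff)
    then show ?thesis by (simp only: step_identity)
  qed
  have b: "build G k u = restrict (T u) {0..<k}" if u: "u \<in> space (cube N)" and "k \<le> N" for u k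
    using that(2)
  proof (induction k)
    case 0
    then show ?case by (simp add: restrict_def)
  next
    case (Suc k)
    have uk: "u k \<in> {0<..<1}" using u Suc.prems by (auto simp: space_cube)
    have sp: "restrict (T u) {0..<k} \<in> space (RN k)" by (simp add: space_RN)
    have "T ((r k (restrict (T u) {0..<k}))(k := u k)) k = T (u(k := u k)) k"
      by (rule quantile_process_determined[OF T u rsp[OF _ sp]]) (use r[OF _ u] Suc.prems uk in auto)
    moreover have bk: "build G k u = restrict (T u) {0..<k}" by (rule Suc.IH) (use Suc.prems in simp)
    moreover have "G k x v = T ((r k x)(k := v)) k" for x v using Suc.prems by (simp add: G_def)
    ultimately have "G k (build G k u) (u k) = T u k" by (simp only: fun_upd_triv)
    then have "build G (Suc k) u = (build G k u)(k := T u k)" by (simp only: build.simps)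
    also note bk
    finally show ?case unfolding restrict_Suc_upd .
  qed
  show thesis
  proof (rule that[of G])
    show "build G N u = T u" if u: "u \<in> space (cube N)" for u
      unfolding b[OF u order_refl] by (rule RN_restrict_id) (rule measurable_space[OF Tm u])
    assume sinc: "prop_sinc N T"
    show "\<forall>k. \<forall>x\<in>space (RN k). strict_mono_on {0<..<1} (G k x)"
    proof (intro allI ballI strict_mono_onI)
      fix k x and v w :: real assume x: "x \<in> space (RN k)" and vw: "v \<in> {0<..<1}" "w \<in> {0<..<1}" "v < w"
      show "G k x v < G k x w"
      proof (cases "k < N")
        case True
        have "(r k x)(k := v) \<in> space (cube N)" by (rule cube_upd_in[OF rsp[OF True x] vw(1) True])
        from sinc[unfolded prop_sinc_def, rule_format, OF True this vw(2)] vw(3)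
        have "T ((r k x)(k := v)) k < T (((r k x)(k := v))(k := w)) k" by simp
        then show ?thesis using True by (simp add: G_def)
      qed (use vw in \<open>simp add: G_def\<close>)
    qed
  qed (rule G)
qed

lemma quantile_law_unique:
  assumes S: "quantile_process N S" and T: "quantile_process N T" and eq: "law N S = law N T"
  shows "AE u in cube N. S u = T u"
proof -
  obtain G where G: "\<And>k. step (RN k) (G k)" "\<And>u. u \<in> space (cube N) \<Longrightarrow> build G N u = S u"
    using quantile_process_eq_build[OF S] by metis
  obtain H where H: "\<And>k. step (RN k) (H k)" "\<And>u. u \<in> space (cube N) \<Longrightarrow> build H N u = T u"
    using quantile_process_eq_build[OF T] by metis
  have "law N (build G N) = law N S" "law N (build H N) = law N T"
    using G(2) H(2) by (auto intro!: distr_cong)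
  then have "AE u in cube N. build G N u = build H N u"
    by (intro build_law_unique G(1) H(1)) (simp add: eq)
  with AE_space show ?thesis
    by eventually_elim (use G(2) H(2) in simp)
qed

subsection \<open>Triangular regularity\<close>

lemma Ionescu_Tulcea_of_steps:
  assumes G: "\<And>k. step (RN k) (G k)"
  shows "Ionescu_Tulcea (\<lambda>k x. distr unit_measure borel (G k x)) (\<lambda>_. borel)"
proof (rule Ionescu_Tulcea.intro)
  fix k
  have U: "unit_measure \<in> space (subprob_algebra unit_measure)"
    using unit.subprob_space_axioms by (simp add: space_subprob_algebra)
  show "(\<lambda>x. distr unit_measure borel (G k x)) \<in> measurable (RN k) (subprob_algebra borel)"
    by (rule measurable_distr2[OF step_measurable[OF G] measurable_const[OF U]])
next
  fix k x assume "x \<in> space (RN k)"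
  then show "prob_space (distr unit_measure borel (G k x))"
    by (intro unit.prob_space_distr step_measurable2[OF G]) auto
qed

text \<open>One turn of the recursion is one turn of the Ionescu-Tulcea composition: both give
  \<open>A\<close> the integral over \<open>x\<close> of the kernel mass of the section of
  \<open>A\<close> at \<open>x\<close>.\<close>

lemma append_step_law_eq_bind:
  assumes IT: "Ionescu_Tulcea K (\<lambda>_. borel)" and M: "prob_space M" "sets M = sets (RN n)"
    and g: "step (RN n) g" and K: "\<And>x. x \<in> space (RN n) \<Longrightarrow> distr unit_measure borel (g x) = K n x"
  shows "append_law n (step_law M g) = M \<bind> Ionescu_Tulcea.eP K (\<lambda>_. borel) n"
proof (rule measure_eqI)
  interpret Ionescu_Tulcea K "\<lambda>_. borel" by (rule IT)
  interpret M: prob_space M by (rule M)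
  have spM: "space M = space (RN n)" by (rule sets_eq_imp_space_eq[OF M(2)])
  have eP: "eP n \<in> measurable M (subprob_algebra (RN (Suc n)))"
    unfolding measurable_cong_sets[OF M(2) refl] by (rule measurable_eP)
  show "sets (append_law n (step_law M g)) = sets (M \<bind> eP n)"
    using sets_bind[of M "eP n" "RN (Suc n)"] M.not_empty sets_eP by (simp add: append_law_def spM)
  fix A assume "A \<in> sets (append_law n (step_law M g))"
  then have A: "A \<in> sets (RN (Suc n))" by (simp add: append_law_def)
  have st: "step M g" using g step_cong_sets[OF M(2)] by blast
  have m1: "(\<lambda>(x, v). (x, g x v)) \<in> measurable (M \<Otimes>\<^sub>M unit_measure) (M \<Otimes>\<^sub>M borel)"
    by (rule measurable_step_pair[OF st])
  have "sets (M \<Otimes>\<^sub>M borel) = sets (RN n \<Otimes>\<^sub>M borel)" using M(2) by (intro sets_pair_measure_cong) auto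
  then have m2: "(\<lambda>(x, y). x(n := y)) \<in> measurable (M \<Otimes>\<^sub>M borel) (RN (Suc n))"
    using measurable_append measurable_cong_sets[OF _ refl] by blast
  have m3: "(\<lambda>(x, v). x(n := g x v)) \<in> measurable (M \<Otimes>\<^sub>M unit_measure) (RN (Suc n))"
    using measurable_compose[OF m1 m2] by (simp add: split_beta')
  have "append_law n (step_law M g) = distr (M \<Otimes>\<^sub>M unit_measure) (RN (Suc n)) (\<lambda>(x, v). x(n := g x v))"
    unfolding append_law_def step_law_def by (subst distr_distr[OF m2 m1]) (simp add: comp_def split_beta')
  then have "emeasure (append_law n (step_law M g)) A =
      emeasure (M \<Otimes>\<^sub>M unit_measure) ((\<lambda>(x, v). x(n := g x v)) -` A \<inter> space (M \<Otimes>\<^sub>M unit_measure))"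
    by (simp only: emeasure_distr[OF m3 A])
  also have "\<dots> = (\<integral>\<^sup>+x. emeasure unit_measure (Pair x -` ((\<lambda>(x, v). x(n := g x v)) -` A \<inter> space (M \<Otimes>\<^sub>M unit_measure))) \<partial>M)"
    by (rule unit.emeasure_pair_measure_alt[OF measurable_sets[OF m3 A]])
  also have "\<dots> = (\<integral>\<^sup>+x. emeasure (eP n x) A \<partial>M)"
  proof (rule nn_integral_cong)
    fix x assume x: "x \<in> space M"
    then have xR: "x \<in> space (RN n)" by (simp add: spM)
    have gx: "g x \<in> borel_measurable unit_measure"
      by (rule step_measurable2[OF g]) (use xR in auto)
    have S: "(\<lambda>y. x(n := y)) -` A \<inter> space borel \<in> sets borel"
      by (rule measurable_sets[OF measurable_RN_upd A]) (use xR in auto)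
    have "emeasure (eP n x) A = emeasure (distr unit_measure borel (g x)) ((\<lambda>y. x(n := y)) -` A \<inter> space borel)"
      unfolding K[OF xR] by (rule emeasure_eP[OF xR A])
    also have "\<dots> = emeasure unit_measure (g x -` ((\<lambda>y. x(n := y)) -` A \<inter> space borel) \<inter> space unit_measure)"
      by (rule emeasure_distr[OF gx S])
    also have "g x -` ((\<lambda>y. x(n := y)) -` A \<inter> space borel) \<inter> space unit_measure =
        Pair x -` ((\<lambda>(x, v). x(n := g x v)) -` A \<inter> space (M \<Otimes>\<^sub>M unit_measure))"
      using x by (auto simp: space_pair_measure)
    finally show "emeasure unit_measure (Pair x -` ((\<lambda>(x, v). x(n := g x v)) -` A \<inter> space (M \<Otimes>\<^sub>M unit_measure))) = emeasure (eP n x) A"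
      by (rule sym)
  qed
  also have "\<dots> = emeasure (M \<bind> eP n) A"
    by (rule emeasure_bind[OF M.not_empty eP A, symmetric])
  finally show "emeasure (append_law n (step_law M g)) A = emeasure (M \<bind> eP n) A" .
qed

text \<open>Both sides start as the point mass on \<open>RN 0\<close> and are extended by the same
  kernels.\<close>

lemma law_build_eq_C:
  assumes IT: "Ionescu_Tulcea K (\<lambda>_. borel)" and G: "\<And>k. step (RN k) (G k)"
    and K: "\<And>k x. x \<in> space (RN k) \<Longrightarrow> distr unit_measure borel (G k x) = K k x"
  shows "law N (build G N) = Ionescu_Tulcea.C K (\<lambda>_. borel) 0 N (\<lambda>_. undefined)"
proof (induction N)
  case 0
  interpret Ionescu_Tulcea K "\<lambda>_. borel" by (rule IT)
  have "build G 0 = (\<lambda>u. \<lambda>_. undefined)" by (rule ext) simp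
  then have "law 0 (build G 0) = distr (cube 0) (RN 0) (\<lambda>u. \<lambda>_. undefined)" by (rule arg_cong)
  also have "\<dots> = return (RN 0) (\<lambda>_. undefined)"
    by (rule cube.distr_const) (simp add: space_PiM)
  finally show ?case by simp
next
  case (Suc n)
  interpret Ionescu_Tulcea K "\<lambda>_. borel" by (rule IT)
  have "law (Suc n) (build G (Suc n)) = append_law n (step_law (law n (build G n)) (G n))"
    by (rule law_build_Suc[OF G])
  also have "\<dots> = law n (build G n) \<bind> eP n"
    by (rule append_step_law_eq_bind[OF IT _ _ G K])
       (auto intro!: prob_space_law measurable_build G)
  finally show ?case by (simp only: Suc.IH C.simps add_0)
qed

lemma disintegration_law_build:
  assumes G: "\<And>k. step (RN k) (G k)"
  shows "disintegration N (law N (build G N)) (\<lambda>k x. distr unit_measure borel (G k x))"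
  unfolding disintegration_def
  using Ionescu_Tulcea_of_steps[OF G] law_build_eq_C[OF Ionescu_Tulcea_of_steps[OF G] G refl] by blast

text \<open>Equal values at \<open>v < w\<close> make an increasing function constant on
  \<open>{v..w}\<close> and give that value mass at least \<open>w - v\<close>. Conversely, a
  strictly increasing function takes each value at most once, and points are null.\<close>

lemma step_atom:
  assumes g: "step M g" and x: "x \<in> space M"
  shows "strict_mono_on {0<..<1} (g x) \<longleftrightarrow> (\<forall>a. emeasure (distr unit_measure borel (g x)) {a} = 0)"
proof
  have gx: "g x \<in> borel_measurable unit_measure"
    by (rule step_measurable2[OF g]) (use x in auto)
  have em: "emeasure (distr unit_measure borel (g x)) {a} = emeasure unit_measure {v \<in> {0<..<1}. g x v = a}" for a
    using gx by (subst emeasure_distr) (auto intro!: arg_cong[where f="emeasure _"])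
  {
    assume sm: "strict_mono_on {0<..<1} (g x)"
    show "\<forall>a. emeasure (distr unit_measure borel (g x)) {a} = 0"
    proof
      fix a
      have "emeasure unit_measure {v \<in> {0<..<1}. g x v = a} = 0"
      proof (cases "\<exists>v\<in>{0<..<1}. g x v = a")
        case True
        then obtain v where v: "v \<in> {0<..<1}" "g x v = a" by blast
        then have "{v \<in> {0<..<1}. g x v = a} = {v}"
          using strict_mono_on_imp_inj_on[OF sm] by (auto simp: inj_on_def)
        then show ?thesis using v by (simp add: emeasure_restrict_space)
      next
        case False
        then have "{v \<in> {0<..<1}. g x v = a} = {}" by blast
        then show ?thesis by (simp only: emeasure_empty)
      qed
      then show "emeasure (distr unit_measure borel (g x)) {a} = 0" by (simp only: em)
    qed
  }
  assume na: "\<forall>a. emeasure (distr unit_measure borel (g x)) {a} = 0"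
  have mono: "mono_on {0<..<1} (g x)" by (rule step_mono[OF g x])
  show "strict_mono_on {0<..<1} (g x)"
  proof (rule strict_mono_onI, rule ccontr)
    fix v w :: real assume vw: "v \<in> {0<..<1}" "w \<in> {0<..<1}" "v < w" and "\<not> g x v < g x w"
    then have eq: "g x v = g x w" using mono_onD[OF mono, of v w] by auto
    have sub: "{v..w} \<subseteq> {s \<in> {0<..<1}. g x s = g x v}"
    proof
      fix s assume s: "s \<in> {v..w}"
      then have "g x v \<le> g x s" "g x s \<le> g x w" using vw by (auto intro!: mono_onD[OF mono])
      then show "s \<in> {s \<in> {0<..<1}. g x s = g x v}" using eq s vw by auto
    qed
    have "{s \<in> {0<..<1}. g x s = g x v} = g x -` {g x v} \<inter> space unit_measure" by auto
    also have "\<dots> \<in> sets unit_measure" by (rule measurable_sets[OF gx]) simp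
    finally have "emeasure unit_measure {v..w} \<le> emeasure unit_measure {s \<in> {0<..<1}. g x s = g x v}"
      by (rule emeasure_mono[OF sub])
    moreover have "emeasure unit_measure {v..w} = ennreal (w - v)"
      using vw by (subst emeasure_restrict_space) auto
    ultimately show False using na[rule_format, of "g x v", unfolded em] vw by (simp add: ennreal_eq_0_iff)
  qed
qed

text \<open>Two rationals inserted between \<open>v\<close> and \<open>w\<close> reduce strictness
  to countably many comparisons. For a step, strictness of the section at \<open>x\<close> thus
  becomes a measurable condition on \<open>x\<close>.\<close>

lemma strict_mono_on_iff_rat:
  fixes f :: "real \<Rightarrow> real"
  assumes "mono_on {0<..<1} f"
  shows "strict_mono_on {0<..<1} f \<longleftrightarrow> (\<forall>q r :: rat. 0 < q \<longrightarrow> q < r \<longrightarrow> r < 1 \<longrightarrow> f (of_rat q) < f (of_rat r))"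
proof
  assume R: "\<forall>q r :: rat. 0 < q \<longrightarrow> q < r \<longrightarrow> r < 1 \<longrightarrow> f (of_rat q) < f (of_rat r)"
  show "strict_mono_on {0<..<1} f"
  proof (rule strict_mono_onI)
    fix v w :: real assume vw: "v \<in> {0<..<1}" "w \<in> {0<..<1}" "v < w"
    obtain q :: rat where q: "v < of_rat q" "of_rat q < w" using of_rat_dense[OF vw(3)] by blast
    obtain r :: rat where r: "of_rat q < (of_rat r :: real)" "of_rat r < w" using of_rat_dense[OF q(2)] by blast
    have q01: "0 < (of_rat q :: real)" "(of_rat r :: real) < 1"
      using vw q(1) r(2) unfolding greaterThanLessThan_iff by linarith+
    have qr: "0 < q" "q < r" "r < 1"
      using q01 r(1) unfolding zero_less_of_rat_iff of_rat_less_1_iff of_rat_less by simp_all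
    then have "q < 1" "0 < r" by simp_all
    note qr01 = this qr
    have "f v \<le> f (of_rat q)" by (rule mono_onD[OF assms]) (use vw q r qr01 in simp_all)
    moreover have "f (of_rat r) \<le> f w" by (rule mono_onD[OF assms]) (use vw q r qr01 in simp_all)
    moreover have "f (of_rat q) < f (of_rat r)" using R qr by blast
    ultimately show "f v < f w" by simp
  qed
qed (auto simp: strict_mono_on_def of_rat_less)

lemma prop_sinc_build:
  assumes "\<And>k x. x \<in> space (RN k) \<Longrightarrow> strict_mono_on {0<..<1} (G k x)"
  shows "prop_sinc N (build G N)"
  unfolding prop_sinc_def
proof (intro allI ballI impI)
  fix k v and u :: "nat \<Rightarrow> real" assume k: "k < N" and u: "u \<in> space (cube N)" and v: "v \<in> {0<..<1}" "u k < v"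
  have "u k \<in> {0<..<1}" using u k by (auto simp: space_cube)
  moreover have "build G k (u(k := v)) = build G k u" by (rule build_cong) auto
  ultimately show "build G N u k < build G N (u(k := v)) k"
    using k v strict_mono_onD[OF assms[OF build_space[of G k u]]] by (simp add: build_apply)
qed

text \<open>The kernels are atom free only almost surely, whereas (sinc) is required everywhere. The
  steps are therefore replaced by the identity wherever they are not strictly increasing;
  \<open>R\<close> is the countable form of strictness, so that the replacement is
  measurable.\<close>

lemma triangular_regular_imp_SIT:
  assumes "triangular_regular N \<mu>"
  obtains T where "quantile_process N T" "prop_sinc N T" "law N T = \<mu>"
proof -
  obtain K where IT: "Ionescu_Tulcea K (\<lambda>_. borel)"
    and \<mu>: "\<mu> = Ionescu_Tulcea.C K (\<lambda>_. borel) 0 N (\<lambda>_. undefined)"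
    and ae: "AE x in \<mu>. \<forall>k<N. \<forall>a. emeasure (K k (restrict x {0..<k})) {a} = 0"
    using assms unfolding triangular_regular_def disintegration_def by blast
  have "\<exists>g. step (RN k) g \<and> (\<forall>x\<in>space (RN k). distr unit_measure borel (g x) = K k x)" for k
    using kernel_step[OF Ionescu_Tulcea.P[OF IT] Ionescu_Tulcea.prob_space_P[OF IT], of k] by metis
  then obtain G where G: "\<And>k. step (RN k) (G k)"
    and GK: "\<And>k x. x \<in> space (RN k) \<Longrightarrow> distr unit_measure borel (G k x) = K k x"
    by metis
  have law_G: "law N (build G N) = \<mu>" unfolding \<mu> by (rule law_build_eq_C[OF IT G GK])
  define R where "R f \<longleftrightarrow> (\<forall>q r :: rat. 0 < q \<longrightarrow> q < r \<longrightarrow> r < 1 \<longrightarrow> f (of_rat q) < f (of_rat r))" for f :: "real \<Rightarrow> real"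
  define H where "H k x v = (if R (G k x) then G k x v else v)" for k x v
  have H_eq: "H k x = (if strict_mono_on {0<..<1} (G k x) then G k x else (\<lambda>v. v))" if "x \<in> space (RN k)" for k x
    unfolding strict_mono_on_iff_rat[OF step_mono[OF G that]] R_def[symmetric] by (auto simp: H_def)
  have H_strict: "strict_mono_on {0<..<1} (H k x)" if "x \<in> space (RN k)" for k x
    unfolding H_eq[OF that] by (auto simp: strict_mono_on_def)
  have H: "step (RN k) (H k)" for k
    unfolding step_def
  proof (intro conjI ballI)
    have Gq: "(\<lambda>z. G k (fst z) q) \<in> borel_measurable (RN k \<Otimes>\<^sub>M unit_measure)" if "q \<in> {0<..<1}" for q
      by (rule step_measurable2[OF G]) (use that in \<open>auto intro: measurable_const\<close>)
    have P: "{z \<in> space (RN k \<Otimes>\<^sub>M unit_measure). R (G k (fst z))}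
        \<in> sets (RN k \<Otimes>\<^sub>M unit_measure)"
    proof -
      have "Measurable.pred (RN k \<Otimes>\<^sub>M unit_measure) (\<lambda>z. G k (fst z) (of_rat q) < G k (fst z) (of_rat r))"
        if "0 < q" "q < r" "r < 1" for q r :: rat
      proof -
        have "of_rat q \<in> {0<..<1::real}" "of_rat r \<in> {0<..<1::real}"
          using that less_trans[of 0 q r] less_trans[of q r 1] by auto
        then show ?thesis by (intro borel_measurable_pred_less Gq)
      qed
      then show ?thesis
        unfolding R_def pred_def[symmetric] by (intro pred_intros_countable(1) pred_intros_imp')
    qed
    have "(\<lambda>z. if R (G k (fst z)) then G k (fst z) (snd z) else snd z)
        \<in> borel_measurable (RN k \<Otimes>\<^sub>M unit_measure)"
      using step_measurable[OF step_identity[of "RN k"]] step_measurable[OF G[of k]]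
      by (intro measurable_If P) (simp_all add: split_beta')
    then show "case_prod (H k) \<in> borel_measurable (RN k \<Otimes>\<^sub>M unit_measure)"
      by (simp add: H_def[abs_def] split_beta')
  qed (rule strict_mono_on_imp_mono_on[OF H_strict])
  have mG: "build G N \<in> measurable (cube N) (RN N)" and mH: "build H N \<in> measurable (cube N) (RN N)"
    by (auto intro: measurable_build G H)
  have "AE u in cube N. \<forall>k<N. \<forall>a. emeasure (K k (restrict (build G N u) {0..<k})) {a} = 0"
    using ae unfolding law_G[symmetric] by (rule AE_distrD[OF mG])
  then have "AE u in cube N. build H N u = build G N u"
  proof eventually_elim
    case (elim u)
    \<comment> \<open>For almost every \<open>u\<close>, each prefix built by \<open>G\<close> meets
      an atom free kernel, hence a strictly increasing step, so \<open>H\<close> never departs from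
      \<open>G\<close> along it.\<close>
    have "build H k u = build G k u" if "k \<le> N" for k
      using that
    proof (induction k)
      case (Suc k)
      have sp: "build G k u \<in> space (RN k)" by (rule build_space)
      have "\<forall>a. emeasure (K k (build G k u)) {a} = 0"
        using elim[rule_format, of k] restrict_build[of k N G u] Suc.prems by (simp only: simp_thms)
      then have "strict_mono_on {0<..<1} (G k (build G k u))"
        using step_atom[OF G sp] by (simp add: GK[OF sp])
      then show ?case using Suc H_eq[OF sp] by simp
    qed simp
    then show ?case by simp
  qed
  then have "law N (build H N) = law N (build G N)"
    by (intro distr_cong_AE mG mH) auto
  then show thesis
    by (intro that[of "build H N"] quantile_process_build H prop_sinc_build H_strict) (auto simp: law_G)
qed

text \<open>The steps of a strictly increasing map are strictly increasing at every point, so their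
  laws form a disintegration that is atom free everywhere and not merely almost everywhere.\<close>

lemma SIT_imp_triangular_regular:
  assumes T: "quantile_process N T" and sinc: "prop_sinc N T"
  shows "triangular_regular N (law N T)"
proof -
  obtain G where G: "\<And>k. step (RN k) (G k)" and b: "\<And>u. u \<in> space (cube N) \<Longrightarrow> build G N u = T u"
    and sm: "\<forall>k. \<forall>x\<in>space (RN k). strict_mono_on {0<..<1} (G k x)"
    using quantile_process_eq_build[OF T] sinc by metis
  have "law N (build G N) = law N T" using b by (intro distr_cong) auto
  then have "disintegration N (law N T) (\<lambda>k x. distr unit_measure borel (G k x))"
    using disintegration_law_build[of G N, OF G] by simp
  moreover have "emeasure (distr unit_measure borel (G k (restrict x {0..<k}))) {a} = 0" for k x a
  proof -
    have sp: "restrict x {0..<k} \<in> space (RN k)" by (simp add: space_RN)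
    show ?thesis using sm sp step_atom[OF G sp] by blast
  qed
  ultimately show ?thesis unfolding triangular_regular_def by (intro exI conjI) auto
qed

subsection \<open>The spaces $L_p$\<close>

text \<open>Together with \<open>expo\<close> this treats \<open>p = 0\<close> and
  \<open>p \<ge> 1\<close> alike: in both cases \<open>fun_dist\<close> is the integral of the cost
  of the difference, raised to the power \<open>1 / expo p\<close>.\<close>

definition cost :: "nat \<Rightarrow> real \<Rightarrow> (nat \<Rightarrow> real) \<Rightarrow> real" where
  "cost N p x = (if p = 0 then min (L2_set x {0..<N}) 1 else pow_sum N p x)"

definition expo :: "real \<Rightarrow> real" where
  "expo p = (if p = 0 then 1 else p)"

abbreviation diff_cost ::
  "nat \<Rightarrow> real \<Rightarrow> ((nat \<Rightarrow> real) \<Rightarrow> nat \<Rightarrow> real) \<Rightarrow> ((nat \<Rightarrow> real) \<Rightarrow> nat \<Rightarrow> real) \<Rightarrow> (nat \<Rightarrow> real) \<Rightarrow> real" where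
  "diff_cost N p f g u \<equiv> cost N p (\<lambda>i. f u i - g u i)"

lemma pow_sum_nonneg: "0 \<le> pow_sum N p x"
  unfolding pow_sum_def by (rule sum_nonneg) simp

lemma cost_nonneg: "0 \<le> cost N p x"
  unfolding cost_def by (simp add: pow_sum_nonneg)

lemma cost_diff_commute: "cost N p (\<lambda>i. x i - y i) = cost N p (\<lambda>i. y i - x i)"
  unfolding cost_def pow_sum_def L2_set_def by (simp add: power2_commute abs_minus_commute)

lemma expo_ge_1: "p = 0 \<or> 1 \<le> p \<Longrightarrow> 1 \<le> expo p"
  by (auto simp: expo_def)

lemma fun_dist_eq: "fun_dist N p f g = (\<integral>u. diff_cost N p f g u \<partial>cube N) powr (1 / expo p)"
proof (cases "p = 0")
  case True
  have "0 \<le> (\<integral>u. diff_cost N p f g u \<partial>cube N)" by (intro Bochner_Integration.integral_nonneg cost_nonneg)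
  then show ?thesis using True by (simp add: fun_dist_def expo_def cost_def)
qed (simp add: fun_dist_def expo_def cost_def)

lemma fun_dist_nonneg: "0 \<le> fun_dist N p f g"
  unfolding fun_dist_eq by simp

lemma fun_dist_commute: "fun_dist N p f g = fun_dist N p g f"
  unfolding fun_dist_eq by (simp only: cost_diff_commute[of N p "\<lambda>i. f _ i"])

lemma fun_dist_powr:
  assumes "p = 0 \<or> 1 \<le> p"
  shows "fun_dist N p f g powr expo p = (\<integral>u. diff_cost N p f g u \<partial>cube N)"
  using expo_ge_1[OF assms] unfolding fun_dist_eq
  by (simp add: powr_powr Bochner_Integration.integral_nonneg cost_nonneg)

lemma fun_dist_le_iff:
  assumes "p = 0 \<or> 1 \<le> p" "0 \<le> e"
  shows "fun_dist N p f g \<le> e \<longleftrightarrow> (\<integral>u. diff_cost N p f g u \<partial>cube N) \<le> e powr expo p"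
  unfolding fun_dist_powr[OF assms(1), symmetric]
proof
  assume "fun_dist N p f g \<le> e"
  then show "fun_dist N p f g powr expo p \<le> e powr expo p"
    using expo_ge_1[OF assms(1)] by (intro powr_mono2 fun_dist_nonneg) auto
next
  assume le: "fun_dist N p f g powr expo p \<le> e powr expo p"
  show "fun_dist N p f g \<le> e"
  proof (rule ccontr)
    assume "\<not> fun_dist N p f g \<le> e"
    then have "e powr expo p < fun_dist N p f g powr expo p"
      using expo_ge_1[OF assms(1)] assms(2) by (intro powr_less_mono2) auto
    then show False using le by simp
  qed
qed

lemma measurable_RN_component: "f \<in> measurable M (RN N) \<Longrightarrow> i < N \<Longrightarrow> (\<lambda>u. f u i) \<in> borel_measurable M"
  using measurable_compose[OF _ measurable_component_singleton[of i "{0..<N}" "\<lambda>_. borel"], of f M] by simp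

lemma measurable_RN_iff:
  "f \<in> measurable M (RN N) \<longleftrightarrow> (\<forall>i<N. (\<lambda>u. f u i) \<in> borel_measurable M) \<and> f \<in> space M \<rightarrow> extensional {0..<N}"
proof
  assume f: "f \<in> measurable M (RN N)"
  then show "(\<forall>i<N. (\<lambda>u. f u i) \<in> borel_measurable M) \<and> f \<in> space M \<rightarrow> extensional {0..<N}"
    using measurable_RN_component[OF f] measurable_space[OF f] by (auto simp: space_RN)
next
  assume "(\<forall>i<N. (\<lambda>u. f u i) \<in> borel_measurable M) \<and> f \<in> space M \<rightarrow> extensional {0..<N}"
  then show "f \<in> measurable M (RN N)"
    by (intro measurable_PiM_single') (auto simp: PiE_def)
qed

lemma measurable_pow_sum:
  assumes "\<And>i. i < N \<Longrightarrow> (\<lambda>u. x u i) \<in> borel_measurable M"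
  shows "(\<lambda>u. pow_sum N p (x u)) \<in> borel_measurable M"
  unfolding pow_sum_def
proof (rule borel_measurable_sum)
  fix i assume "i \<in> {0..<N}"
  then have "(\<lambda>u. x u i) \<in> borel_measurable M" using assms by simp
  then show "(\<lambda>u. \<bar>x u i\<bar> powr p) \<in> borel_measurable M" by measurable
qed

lemma measurable_cost:
  assumes "\<And>i. i < N \<Longrightarrow> (\<lambda>u. x u i) \<in> borel_measurable M"
  shows "(\<lambda>u. cost N p (x u)) \<in> borel_measurable M"
proof -
  have "(\<lambda>u. L2_set (x u) {0..<N}) \<in> borel_measurable M"
  proof -
    have "(\<lambda>u. \<Sum>i\<in>{0..<N}. (x u i)\<^sup>2) \<in> borel_measurable M"
      by (intro borel_measurable_sum borel_measurable_power assms) simp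
    then show ?thesis unfolding L2_set_def by measurable
  qed
  then show ?thesis
    unfolding cost_def using measurable_pow_sum[OF assms] by (cases "p = 0") auto
qed

lemma measurable_diff_cost:
  "f \<in> measurable M (RN N) \<Longrightarrow> g \<in> measurable M (RN N) \<Longrightarrow> diff_cost N p f g \<in> borel_measurable M"
  by (intro measurable_cost borel_measurable_diff measurable_RN_component)

section \<open>Domination and the triangle inequality\<close>

text \<open>The factor 2 comes from \<open>a + b \<le> 2 * max a b\<close>. The constant is crude,
  but integrability is all that is drawn from it.\<close>

lemma powr_le_of_dominated:
  fixes a b c h p :: real
  assumes "0 < p" "0 \<le> a" "0 \<le> b" "0 \<le> c" "\<bar>h\<bar> \<le> c * (a + b)"
  shows "\<bar>h\<bar> powr p \<le> (2 * c) powr p * (a powr p + b powr p)"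
proof -
  have "c * (a + b) \<le> c * (2 * max a b)" by (rule mult_left_mono) (use assms in auto)
  then have "\<bar>h\<bar> \<le> (2 * c) * max a b" using assms(5) by simp
  then have "\<bar>h\<bar> powr p \<le> ((2 * c) * max a b) powr p" using assms by (intro powr_mono2) auto
  also have "\<dots> = (2 * c) powr p * max a b powr p" using assms by (intro powr_mult)
  also have "max a b powr p \<le> a powr p + b powr p" by (auto simp: max_def)
  finally show ?thesis by (simp add: mult_left_mono)
qed

text \<open>One criterion for sums, differences, multiples and limits: each is bounded
  coordinatewise by a constant times two integrable maps.\<close>

lemma integrable_pow_sum_dominated:
  assumes p: "0 < p" and c: "0 \<le> c" and hm: "\<And>i. i < N \<Longrightarrow> (\<lambda>u. h u i) \<in> borel_measurable M"
    and f: "integrable M (\<lambda>u. pow_sum N p (f u))" and g: "integrable M (\<lambda>u. pow_sum N p (g u))"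
    and le: "AE u in M. \<forall>i<N. \<bar>h u i\<bar> \<le> c * (\<bar>f u i\<bar> + \<bar>g u i\<bar>)"
  shows "integrable M (\<lambda>u. pow_sum N p (h u))"
proof (rule Bochner_Integration.integrable_bound)
  show "integrable M (\<lambda>u. (2 * c) powr p * (pow_sum N p (f u) + pow_sum N p (g u)))"
    using f g by auto
  show "(\<lambda>u. pow_sum N p (h u)) \<in> borel_measurable M" by (rule measurable_pow_sum[OF hm])
  show "AE u in M. norm (pow_sum N p (h u)) \<le> norm ((2 * c) powr p * (pow_sum N p (f u) + pow_sum N p (g u)))"
    using le
  proof eventually_elim
    case (elim u)
    have "pow_sum N p (h u) \<le> (\<Sum>i\<in>{0..<N}. (2 * c) powr p * (\<bar>f u i\<bar> powr p + \<bar>g u i\<bar> powr p))"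
      unfolding pow_sum_def by (intro sum_mono powr_le_of_dominated) (use p c elim in auto)
    also have "\<dots> = (2 * c) powr p * (pow_sum N p (f u) + pow_sum N p (g u))"
      unfolding pow_sum_def sum_distrib_left[symmetric] sum.distrib by (rule refl)
    finally show ?case using pow_sum_nonneg[of N p] by (simp add: abs_mult)
  qed
qed

lemma p_integrable_dominated:
  assumes p: "p = 0 \<or> 1 \<le> p" and h: "h \<in> measurable (cube N) (RN N)"
    and f: "p_integrable N p f" and g: "p_integrable N p g" and c: "0 \<le> c"
    and le: "AE u in cube N. \<forall>i<N. \<bar>h u i\<bar> \<le> c * (\<bar>f u i\<bar> + \<bar>g u i\<bar>)"
  shows "p_integrable N p h"
  unfolding p_integrable_def
proof (intro conjI impI h)
  assume "p \<noteq> 0"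
  then have "0 < p" using p by simp
  then show "integrable (cube N) (\<lambda>u. pow_sum N p (h u))"
    using f g c le \<open>p \<noteq> 0\<close> measurable_RN_component[OF h]
    by (intro integrable_pow_sum_dominated[of p c N h _ f g]) (auto simp: p_integrable_def)
qed

lemma p_integrable_measurable: "p_integrable N p f \<Longrightarrow> f \<in> measurable (cube N) (RN N)"
  by (simp add: p_integrable_def)

lemma integrable_diff_cost:
  assumes p: "p = 0 \<or> 1 \<le> p" and f: "p_integrable N p f" and g: "p_integrable N p g"
  shows "integrable (cube N) (diff_cost N p f g)"
proof (cases "p = 0")
  case True
  show ?thesis
  proof (rule cube.integrable_const_bound[of _ 1])
    show "AE u in cube N. norm (diff_cost N p f g u) \<le> 1"
      using True by (auto simp: cost_def min_def)
  qed (rule measurable_diff_cost[OF p_integrable_measurable[OF f] p_integrable_measurable[OF g]])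
next
  case False
  then have "0 < p" using p by simp
  then have "integrable (cube N) (\<lambda>u. pow_sum N p (\<lambda>i. f u i - g u i))"
  proof (rule integrable_pow_sum_dominated[where c=1 and f=f and g=g])
    show "(\<lambda>u. f u i - g u i) \<in> borel_measurable (cube N)" if "i < N" for i
      by (intro borel_measurable_diff measurable_RN_component[OF _ that] p_integrable_measurable[OF f] p_integrable_measurable[OF g])
    show "integrable (cube N) (\<lambda>u. pow_sum N p (f u))" "integrable (cube N) (\<lambda>u. pow_sum N p (g u))"
      using f g False by (simp_all add: p_integrable_def)
    show "AE u in cube N. \<forall>i<N. \<bar>f u i - g u i\<bar> \<le> 1 * (\<bar>f u i\<bar> + \<bar>g u i\<bar>)"
      using abs_triangle_ineq4 by (intro AE_I2) auto
  qed simp_all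
  then show ?thesis using False by (simp add: cost_def)
qed

text \<open>With \<open>t = B / (A + B)\<close> the argument on the left is the convex combination
  of \<open>a / A\<close> and \<open>b / B\<close> with weights \<open>1 - t\<close> and
  \<open>t\<close>.\<close>

lemma convex_powr_combination:
  fixes a b A B p :: real
  assumes p: "1 \<le> p" and "0 < A" "0 < B" "0 \<le> a" "0 \<le> b"
  shows "((a + b) / (A + B)) powr p \<le> A / (A + B) * (a / A) powr p + B / (A + B) * (b / B) powr p"
proof -
  define t where "t = B / (A + B)"
  have t: "0 < t" "t < 1" using assms by (simp_all add: t_def)
  have t3: "1 - t = A / (A + B)"
    using assms diff_divide_distrib[of "A + B" B "A + B"] by (simp add: t_def)
  have tA: "(1 - t) * (a / A) = a / (A + B)" unfolding t3 using assms by simp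
  have tB: "t * (b / B) = b / (A + B)" unfolding t_def using assms by simp
  have *: "(a + b) / (A + B) = (1 - t) * (a / A) + t * (b / B)" unfolding tA tB by (simp add: add_divide_distrib)
  \<comment> \<open>Settles the boundary, where convexity on the positive half line does not apply:
    if one argument is 0, the bound \<open>s powr p \<le> s\<close> for \<open>s < 1\<close> takes
    over.\<close>
  have small: "(s * x) powr p \<le> s * x powr p" if "0 < s" "s < 1" "0 \<le> x" for s x :: real
  proof -
    have "s powr p \<le> s powr 1" using that p by (intro powr_mono') auto
    then show ?thesis using that by (simp add: powr_mult mult_right_mono)
  qed
  have "((1 - t) * (a / A) + t * (b / B)) powr p \<le> (1 - t) * (a / A) powr p + t * (b / B) powr p"
  proof (cases "a = 0 \<or> b = 0")
    case True
    then show ?thesis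
      using small[of t "b / B"] small[of "1 - t" "a / A"] t assms by auto
  next
    case False
    then show ?thesis
      using convex_onD[OF powr_convex[OF p], of t "a / A" "b / B"] t assms by auto
  qed
  then show ?thesis unfolding * t_def[symmetric] t3[symmetric] .
qed

text \<open>Minkowski by normalisation: \<open>h\<close> divided by \<open>A + B\<close> is
  dominated by a convex combination of \<open>f / A\<close> and \<open>g / B\<close>, whose power
  sums have integral at most 1. \<open>A\<close> and \<open>B\<close> are strictly positive upper
  bounds instead of the norms themselves, so that dividing by them is possible even when a norm
  vanishes.\<close>

lemma pow_sum_minkowski:
  assumes p: "1 \<le> p" and AB: "0 < A" "0 < B"
    and f: "integrable M (\<lambda>u. pow_sum N p (f u))" "(\<integral>u. pow_sum N p (f u) \<partial>M) \<le> A powr p"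
    and g: "integrable M (\<lambda>u. pow_sum N p (g u))" "(\<integral>u. pow_sum N p (g u) \<partial>M) \<le> B powr p"
    and h: "integrable M (\<lambda>u. pow_sum N p (h u))" and le: "\<And>u i. i < N \<Longrightarrow> \<bar>h u i\<bar> \<le> \<bar>f u i\<bar> + \<bar>g u i\<bar>"
  shows "(\<integral>u. pow_sum N p (h u) \<partial>M) \<le> (A + B) powr p"
proof -
  have scale: "(\<Sum>i\<in>{0..<N}. (\<bar>x i\<bar> / C) powr p) = pow_sum N p x / C powr p" if "0 < C" for x C
    using that by (simp add: pow_sum_def powr_divide sum_divide_distrib)
  have "pow_sum N p (h u) / (A + B) powr p \<le>
      A / (A + B) * (pow_sum N p (f u) / A powr p) + B / (A + B) * (pow_sum N p (g u) / B powr p)" for u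
  proof -
    have "pow_sum N p (h u) / (A + B) powr p = (\<Sum>i\<in>{0..<N}. (\<bar>h u i\<bar> / (A + B)) powr p)"
      using scale[of "A + B"] AB by simp
    also have "\<dots> \<le> (\<Sum>i\<in>{0..<N}. A / (A + B) * (\<bar>f u i\<bar> / A) powr p + B / (A + B) * (\<bar>g u i\<bar> / B) powr p)"
    proof (rule sum_mono)
      fix i assume "i \<in> {0..<N}"
      then have "(\<bar>h u i\<bar> / (A + B)) powr p \<le> ((\<bar>f u i\<bar> + \<bar>g u i\<bar>) / (A + B)) powr p"
        using AB p le by (intro powr_mono2 divide_right_mono) auto
      also have "\<dots> \<le> A / (A + B) * (\<bar>f u i\<bar> / A) powr p + B / (A + B) * (\<bar>g u i\<bar> / B) powr p"
        by (rule convex_powr_combination) (use AB p in auto)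
      finally show "(\<bar>h u i\<bar> / (A + B)) powr p \<le> A / (A + B) * (\<bar>f u i\<bar> / A) powr p + B / (A + B) * (\<bar>g u i\<bar> / B) powr p" .
    qed
    also have "\<dots> = A / (A + B) * (pow_sum N p (f u) / A powr p) + B / (A + B) * (pow_sum N p (g u) / B powr p)"
      unfolding sum.distrib sum_distrib_left[symmetric] scale[OF AB(1)] scale[OF AB(2)] ..
    finally show ?thesis .
  qed
  then have "(\<integral>u. pow_sum N p (h u) / (A + B) powr p \<partial>M) \<le>
      (\<integral>u. A / (A + B) * (pow_sum N p (f u) / A powr p) + B / (A + B) * (pow_sum N p (g u) / B powr p) \<partial>M)"
    using f g h by (intro integral_mono) auto
  also have "\<dots> = A / (A + B) * ((\<integral>u. pow_sum N p (f u) \<partial>M) / A powr p) + B / (A + B) * ((\<integral>u. pow_sum N p (g u) \<partial>M) / B powr p)"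
    using f g by simp
  also have "\<dots> \<le> A / (A + B) * 1 + B / (A + B) * 1"
    using f(2) g(2) AB by (intro add_mono mult_left_mono) (auto simp: divide_le_eq_1)
  also have "\<dots> = 1" using AB by (simp add: add_divide_distrib[symmetric])
  finally show ?thesis using h AB by (simp add: divide_le_eq_1)
qed

lemma fun_dist_triangle:
  assumes p: "p = 0 \<or> 1 \<le> p" and f: "p_integrable N p f" and g: "p_integrable N p g" and h: "p_integrable N p h"
  shows "fun_dist N p f h \<le> fun_dist N p f g + fun_dist N p g h"
proof (cases "p = 0")
  case True
  have "cost N p (\<lambda>i. x i - z i) \<le> cost N p (\<lambda>i. x i - y i) + cost N p (\<lambda>i. y i - z i)" for x y z
  proof -
    have "L2_set (\<lambda>i. x i - z i) {0..<N} \<le> L2_set (\<lambda>i. x i - y i) {0..<N} + L2_set (\<lambda>i. y i - z i) {0..<N}"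
      using L2_set_triangle_ineq[of "\<lambda>i. x i - y i" "\<lambda>i. y i - z i" "{0..<N}"] by simp
    moreover have "min c 1 \<le> min a 1 + min b 1" if "c \<le> a + b" "0 \<le> a" "0 \<le> b" for a b c :: real
      using that by (auto simp: min_def)
    ultimately show ?thesis
      using True by (simp add: cost_def)
  qed
  then have "(\<integral>u. diff_cost N p f h u \<partial>cube N) \<le> (\<integral>u. diff_cost N p f g u + diff_cost N p g h u \<partial>cube N)"
    by (intro integral_mono Bochner_Integration.integrable_add integrable_diff_cost p f g h)
  also have "\<dots> = (\<integral>u. diff_cost N p f g u \<partial>cube N) + (\<integral>u. diff_cost N p g h u \<partial>cube N)"
    by (intro Bochner_Integration.integral_add integrable_diff_cost p f g h)
  finally have le: "(\<integral>u. diff_cost N p f h u \<partial>cube N) \<le> (\<integral>u. diff_cost N p f g u \<partial>cube N) + (\<integral>u. diff_cost N p g h u \<partial>cube N)" .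
  have "fun_dist N p f g = (\<integral>u. diff_cost N p f g u \<partial>cube N)" for f g
    using fun_dist_powr[OF p, of N f g] fun_dist_nonneg[of N p f g] True by (simp add: expo_def)
  then show ?thesis using le by simp
next
  case False
  then have p1: "1 \<le> p" and e: "expo p = p" using p by (auto simp: expo_def)
  have c: "cost N p = pow_sum N p" using False by (simp add: cost_def fun_eq_iff)
  note int = integrable_diff_cost[OF p, of N, unfolded c]
  show ?thesis
  proof (rule field_le_epsilon)
    \<comment> \<open>A slack of \<open>e / 2\<close> on each side makes the two bounds strictly
      positive, since a distance may be 0.\<close>
    fix e :: real assume e0: "0 < e"
    have "(\<integral>u. pow_sum N p (\<lambda>i. f u i - h u i) \<partial>cube N) \<le> ((fun_dist N p f g + e / 2) + (fun_dist N p g h + e / 2)) powr p"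
    proof (rule pow_sum_minkowski[OF p1 _ _ int[OF f g] _ int[OF g h] _ int[OF f h]])
      show "0 < fun_dist N p f g + e / 2" "0 < fun_dist N p g h + e / 2"
        using fun_dist_nonneg[of N p f g] fun_dist_nonneg[of N p g h] e0 by linarith+
      show "(\<integral>u. pow_sum N p (\<lambda>i. f u i - g u i) \<partial>cube N) \<le> (fun_dist N p f g + e / 2) powr p"
        using fun_dist_le_iff[OF p, of "fun_dist N p f g + e / 2" N f g] fun_dist_nonneg[of N p f g] e0 by (simp add: c e)
      show "(\<integral>u. pow_sum N p (\<lambda>i. g u i - h u i) \<partial>cube N) \<le> (fun_dist N p g h + e / 2) powr p"
        using fun_dist_le_iff[OF p, of "fun_dist N p g h + e / 2" N g h] fun_dist_nonneg[of N p g h] e0 by (simp add: c e)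
    qed auto
    moreover have "0 \<le> (fun_dist N p f g + e / 2) + (fun_dist N p g h + e / 2)"
      using fun_dist_nonneg[of N p f g] fun_dist_nonneg[of N p g h] e0 by linarith
    ultimately have "fun_dist N p f h \<le> (fun_dist N p f g + e / 2) + (fun_dist N p g h + e / 2)"
      using fun_dist_le_iff[OF p, of "(fun_dist N p f g + e / 2) + (fun_dist N p g h + e / 2)" N f h] by (simp add: c e)
    then show "fun_dist N p f h \<le> fun_dist N p f g + fun_dist N p g h + e" by simp
  qed
qed

text \<open>The condition \<open>d \<le> 1\<close> reflects the truncation at \<open>p = 0\<close>.
  The bound serves both to separate points and to control coordinates in the proof of almost sure
  convergence.\<close>

lemma cost_ge_component:
  assumes p: "p = 0 \<or> 1 \<le> p" and i: "i < N" and d: "0 \<le> d" "d \<le> 1" "d \<le> \<bar>x i\<bar>"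
  shows "d powr expo p \<le> cost N p x"
proof (cases "p = 0")
  case True
  have "\<bar>x i\<bar> \<le> L2_set x {0..<N}"
    using member_le_L2_set[of "{0..<N}" i "\<lambda>i. \<bar>x i\<bar>"] i by (simp add: L2_set_def)
  then show ?thesis using True d by (simp add: cost_def expo_def)
next
  case False
  have "d powr p \<le> \<bar>x i\<bar> powr p" using d p False by (intro powr_mono2) auto
  also have "\<dots> \<le> pow_sum N p x"
    unfolding pow_sum_def using i by (intro member_le_sum) auto
  finally show ?thesis using False by (simp add: cost_def expo_def)
qed

lemma cost_eq_0_iff:
  assumes p: "p = 0 \<or> 1 \<le> p"
  shows "cost N p x = 0 \<longleftrightarrow> (\<forall>i<N. x i = 0)"
proof
  assume c: "cost N p x = 0"
  show "\<forall>i<N. x i = 0"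
  proof (intro allI impI, rule ccontr)
    fix i assume i: "i < N" "x i \<noteq> 0"
    have "min 1 \<bar>x i\<bar> powr expo p \<le> cost N p x"
      by (rule cost_ge_component[OF p i(1)]) auto
    moreover have "0 < min 1 \<bar>x i\<bar> powr expo p" using i by auto
    ultimately show False using c by simp
  qed
next
  assume "\<forall>i<N. x i = 0"
  then show "cost N p x = 0" using p by (auto simp: cost_def pow_sum_def L2_set_def)
qed

lemma fun_dist_eq_0_iff:
  assumes p: "p = 0 \<or> 1 \<le> p" and f: "p_integrable N p f" and g: "p_integrable N p g"
  shows "fun_dist N p f g = 0 \<longleftrightarrow> (AE u in cube N. f u = g u)"
proof -
  have "fun_dist N p f g = 0 \<longleftrightarrow> (\<integral>u. diff_cost N p f g u \<partial>cube N) = 0"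
    unfolding fun_dist_eq by simp
  also have "\<dots> \<longleftrightarrow> (AE u in cube N. diff_cost N p f g u = 0)"
    by (intro integral_nonneg_eq_0_iff_AE integrable_diff_cost p f g) (simp add: cost_nonneg)
  also have "\<dots> \<longleftrightarrow> (AE u in cube N. f u = g u)"
  proof (rule AE_cong)
    fix u assume u: "u \<in> space (cube N)"
    \<comment> \<open>Extensionality turns agreement at the indices below \<open>N\<close> into
      equality of functions.\<close>
    have "f u \<in> extensional {0..<N}" "g u \<in> extensional {0..<N}"
      using measurable_space[OF p_integrable_measurable[OF f] u] measurable_space[OF p_integrable_measurable[OF g] u]
      by (auto simp: space_RN)
    then show "diff_cost N p f g u = 0 \<longleftrightarrow> f u = g u"
      unfolding cost_eq_0_iff[OF p] by (auto intro: extensionalityI)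
  qed
  finally show ?thesis .
qed

lemma fun_dist_cong_AE:
  assumes "f \<in> measurable (cube N) (RN N)" "g \<in> measurable (cube N) (RN N)"
    and "f' \<in> measurable (cube N) (RN N)" "g' \<in> measurable (cube N) (RN N)"
    and "AE u in cube N. f u = f' u" "AE u in cube N. g u = g' u"
  shows "fun_dist N p f g = fun_dist N p f' g'"
proof -
  have "AE u in cube N. diff_cost N p f g u = diff_cost N p f' g' u"
    using assms(5,6) by eventually_elim simp
  then have "(\<integral>u. diff_cost N p f g u \<partial>cube N) = (\<integral>u. diff_cost N p f' g' u \<partial>cube N)"
    by (intro integral_cong_AE measurable_diff_cost assms(1-4))
  then show ?thesis unfolding fun_dist_eq by simp
qed

section \<open>Classes modulo null sets\<close>

lemma ae_class_self: "f \<in> measurable (cube N) (RN N) \<Longrightarrow> f \<in> ae_class N f"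
  by (simp add: ae_class_def)

lemma ae_class_eq_iff:
  assumes f: "f \<in> measurable (cube N) (RN N)"
  shows "ae_class N f = ae_class N g \<longleftrightarrow> (AE u in cube N. f u = g u)"
proof
  assume "ae_class N f = ae_class N g"
  then have "f \<in> ae_class N g" using ae_class_self[OF f] by simp
  then show "AE u in cube N. f u = g u" by (simp add: ae_class_def)
next
  assume eq: "AE u in cube N. f u = g u"
  have "(AE u in cube N. h u = f u) \<longleftrightarrow> (AE u in cube N. h u = g u)" for h
  proof
    assume "AE u in cube N. h u = f u"
    then show "AE u in cube N. h u = g u" using eq by eventually_elim simp
  next
    assume "AE u in cube N. h u = g u"
    then show "AE u in cube N. h u = f u" using eq by eventually_elim simp
  qed
  then show "ae_class N f = ae_class N g" by (simp add: ae_class_def)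
qed

lemma representative_ae_class:
  assumes "f \<in> measurable (cube N) (RN N)"
  shows "representative (ae_class N f) \<in> measurable (cube N) (RN N)"
    and "AE u in cube N. representative (ae_class N f) u = f u"
proof -
  have "representative (ae_class N f) \<in> ae_class N f"
    unfolding representative_def by (rule someI[of "\<lambda>g. g \<in> ae_class N f", OF ae_class_self[OF assms]])
  then show "representative (ae_class N f) \<in> measurable (cube N) (RN N)"
    "AE u in cube N. representative (ae_class N f) u = f u"
    by (simp_all add: ae_class_def)
qed

lemma Lp_dist_ae_class:
  assumes "f \<in> measurable (cube N) (RN N)" "g \<in> measurable (cube N) (RN N)"
  shows "Lp_dist N p (ae_class N f) (ae_class N g) = fun_dist N p f g"
  unfolding Lp_dist_def
  by (intro fun_dist_cong_AE representative_ae_class assms)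

lemma Metric_space_Lp:
  assumes p: "p = 0 \<or> 1 \<le> p"
  shows "Metric_space (Lp N p) (Lp_dist N p)"
proof
  show "0 \<le> Lp_dist N p F G" for F G unfolding Lp_dist_def by (rule fun_dist_nonneg)
  show "Lp_dist N p F G = Lp_dist N p G F" for F G unfolding Lp_dist_def by (rule fun_dist_commute)
  fix F G assume "F \<in> Lp N p" "G \<in> Lp N p"
  then obtain f g where f: "p_integrable N p f" "F = ae_class N f" and g: "p_integrable N p g" "G = ae_class N g"
    by (auto simp: Lp_def)
  note m = p_integrable_measurable[OF f(1)] p_integrable_measurable[OF g(1)]
  show "Lp_dist N p F G = 0 \<longleftrightarrow> F = G"
    unfolding f(2) g(2) Lp_dist_ae_class[OF m] fun_dist_eq_0_iff[OF p f(1) g(1)] ae_class_eq_iff[OF m(1)] ..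
  fix H assume "H \<in> Lp N p"
  then obtain h where h: "p_integrable N p h" "H = ae_class N h" by (auto simp: Lp_def)
  show "Lp_dist N p F H \<le> Lp_dist N p F G + Lp_dist N p G H"
    using fun_dist_triangle[OF p f(1) g(1) h(1)] m p_integrable_measurable[OF h(1)]
    unfolding f(2) g(2) h(2) by (simp add: Lp_dist_ae_class)
qed

subsection \<open>Completeness\<close>

lemma convergent_of_fast_differences:
  fixes a :: "nat \<Rightarrow> real"
  assumes "eventually (\<lambda>j. \<bar>a j - a (Suc j)\<bar> \<le> (1 / 2) ^ j) sequentially"
  shows "convergent a"
proof -
  have "summable (\<lambda>j. a (Suc j) - a j)"
  proof (rule summable_comparison_test_ev)
    show "eventually (\<lambda>j. norm (a (Suc j) - a j) \<le> (1 / 2) ^ j) sequentially"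
      using assms by (simp add: abs_minus_commute)
  qed (simp add: summable_geometric)
  then have "convergent (\<lambda>n. \<Sum>j<n. a (Suc j) - a j)"
    by (simp add: summable_iff_convergent)
  then have "convergent (\<lambda>n. a n - a 0)"
    by (simp only: sum_lessThan_telescope)
  from convergent_add[OF this convergent_const[of "a 0"]] show ?thesis by simp
qed

lemma tendsto_cost:
  assumes p: "p = 0 \<or> 1 \<le> p" and x: "\<And>i. i < N \<Longrightarrow> (\<lambda>j. x j i) \<longlonglongrightarrow> y i"
  shows "(\<lambda>j. cost N p (x j)) \<longlonglongrightarrow> cost N p y"
proof (cases "p = 0")
  case True
  have "(\<lambda>j. L2_set (x j) {0..<N}) \<longlonglongrightarrow> L2_set y {0..<N}"
    unfolding L2_set_def by (intro tendsto_real_sqrt tendsto_sum tendsto_power x) auto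
  then show ?thesis
    using True by (simp add: cost_def tendsto_min)
next
  case False
  then have "0 < p" using p by simp
  then have "(\<lambda>j. pow_sum N p (x j)) \<longlonglongrightarrow> pow_sum N p y"
    unfolding pow_sum_def by (intro tendsto_sum tendsto_powr' tendsto_rabs x tendsto_const) auto
  then show ?thesis using False by (simp add: cost_def)
qed

text \<open>Formulated for maps and not for classes, so that pointwise limits can be taken.\<close>

definition cauchy_in :: "nat \<Rightarrow> real \<Rightarrow> (nat \<Rightarrow> (nat \<Rightarrow> real) \<Rightarrow> nat \<Rightarrow> real) \<Rightarrow> bool" where
  "cauchy_in N p f \<longleftrightarrow> (\<forall>e>0. \<exists>M. \<forall>m\<ge>M. \<forall>n\<ge>M. fun_dist N p (f m) (f n) < e)"

text \<open>Fatou's lemma: the cost of \<open>f n - g\<close> is the limit of the costs of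
  \<open>f n - f (s j)\<close>, so a bound on the latter passes to the former. Pointwise convergence
  holds along a subsequence only, yet the whole sequence converges, because \<open>n\<close> ranges
  over all late indices.\<close>

lemma cauchy_in_limit:
  assumes p: "p = 0 \<or> 1 \<le> p" and f: "\<And>n. p_integrable N p (f n)" and cau: "cauchy_in N p f"
    and s: "strict_mono s" and g: "g \<in> measurable (cube N) (RN N)"
    and lim: "AE u in cube N. \<forall>i<N. (\<lambda>j. f (s j) u i) \<longlonglongrightarrow> g u i"
  shows "p_integrable N p g" and "(\<lambda>n. fun_dist N p (f n) g) \<longlonglongrightarrow> 0"
proof -
  note fm = p_integrable_measurable[OF f]
  have key: "integrable (cube N) (diff_cost N p (f n) g) \<and> fun_dist N p (f n) g \<le> e"
    if e: "0 < e" and n: "\<And>m. m \<ge> n \<Longrightarrow> fun_dist N p (f n) (f m) \<le> e" for n e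
  proof -
    have "AE u in cube N. ennreal (diff_cost N p (f n) g u) = liminf (\<lambda>j. ennreal (diff_cost N p (f n) (f (s j)) u))"
      using lim
    proof eventually_elim
      case (elim u)
      have "(\<lambda>j. diff_cost N p (f n) (f (s j)) u) \<longlonglongrightarrow> diff_cost N p (f n) g u"
        by (intro tendsto_cost[OF p] tendsto_diff tendsto_const) (use elim in auto)
      then have "(\<lambda>j. ennreal (diff_cost N p (f n) (f (s j)) u)) \<longlonglongrightarrow> ennreal (diff_cost N p (f n) g u)"
        by (rule tendsto_ennrealI)
      then show ?case by (rule lim_imp_Liminf[OF sequentially_bot, symmetric])
    qed
    then have "(\<integral>\<^sup>+u. ennreal (diff_cost N p (f n) g u) \<partial>cube N) =
        (\<integral>\<^sup>+u. liminf (\<lambda>j. ennreal (diff_cost N p (f n) (f (s j)) u)) \<partial>cube N)"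
      by (rule nn_integral_cong_AE)
    also have "\<dots> \<le> liminf (\<lambda>j. \<integral>\<^sup>+u. ennreal (diff_cost N p (f n) (f (s j)) u) \<partial>cube N)"
      by (intro nn_integral_liminf measurable_compose[OF measurable_diff_cost[OF fm fm] measurable_ennreal])
    also have "\<dots> \<le> ennreal (e powr expo p)"
    proof (rule Liminf_le)
      have "(\<integral>\<^sup>+u. ennreal (diff_cost N p (f n) (f (s j)) u) \<partial>cube N) \<le> ennreal (e powr expo p)" if "n \<le> j" for j
      proof -
        have "n \<le> s j" using that seq_suble[OF s, of j] by simp
        then have "(\<integral>u. diff_cost N p (f n) (f (s j)) u \<partial>cube N) \<le> e powr expo p"
          using n fun_dist_le_iff[OF p, of e N "f n" "f (s j)"] e by simp
        moreover have "(\<integral>\<^sup>+u. ennreal (diff_cost N p (f n) (f (s j)) u) \<partial>cube N) = ennreal (\<integral>u. diff_cost N p (f n) (f (s j)) u \<partial>cube N)"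
          by (intro nn_integral_eq_integral integrable_diff_cost p f) (simp add: cost_nonneg)
        ultimately show ?thesis by (simp add: ennreal_leI)
      qed
      then show "eventually (\<lambda>j. (\<integral>\<^sup>+u. ennreal (diff_cost N p (f n) (f (s j)) u) \<partial>cube N) \<le> ennreal (e powr expo p)) sequentially"
        unfolding eventually_sequentially by blast
    qed simp
    finally have le: "(\<integral>\<^sup>+u. ennreal (diff_cost N p (f n) g u) \<partial>cube N) \<le> ennreal (e powr expo p)" .
    have int: "integrable (cube N) (diff_cost N p (f n) g)"
    proof (rule integrableI_nonneg)
      show "diff_cost N p (f n) g \<in> borel_measurable (cube N)" by (rule measurable_diff_cost[OF fm g])
      show "(\<integral>\<^sup>+u. ennreal (diff_cost N p (f n) g u) \<partial>cube N) < \<infinity>"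
        using le by (rule le_less_trans) simp
    qed (simp add: cost_nonneg)
    have "ennreal (\<integral>u. diff_cost N p (f n) g u \<partial>cube N) \<le> ennreal (e powr expo p)"
      using le by (subst nn_integral_eq_integral[OF int, symmetric]) (auto simp: cost_nonneg)
    then have "(\<integral>u. diff_cost N p (f n) g u \<partial>cube N) \<le> e powr expo p" by (simp add: ennreal_le_iff)
    then show ?thesis using int fun_dist_le_iff[OF p, of e N "f n" g] e by simp
  qed
  have ev: "\<exists>M. \<forall>n\<ge>M. integrable (cube N) (diff_cost N p (f n) g) \<and> fun_dist N p (f n) g \<le> e" if e: "0 < e" for e
  proof -
    obtain M where M: "\<And>m n. m \<ge> M \<Longrightarrow> n \<ge> M \<Longrightarrow> fun_dist N p (f m) (f n) < e"
      using cau[unfolded cauchy_in_def, rule_format, OF e] by blast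
    have "integrable (cube N) (diff_cost N p (f n) g) \<and> fun_dist N p (f n) g \<le> e" if n: "n \<ge> M" for n
      by (rule key[OF e]) (use M n in \<open>auto intro: less_imp_le\<close>)
    then show ?thesis by blast
  qed
  show "(\<lambda>n. fun_dist N p (f n) g) \<longlonglongrightarrow> 0"
  proof (rule LIMSEQ_I)
    fix e :: real assume "0 < e"
    then obtain M where "\<forall>n\<ge>M. fun_dist N p (f n) g \<le> e / 2" using ev[of "e / 2"] by auto
    then show "\<exists>M. \<forall>n\<ge>M. norm (fun_dist N p (f n) g - 0) < e"
      using \<open>0 < e\<close> fun_dist_nonneg[of N p] by (intro exI[of _ M]) (force simp: abs_of_nonneg)
  qed
  obtain n where int: "integrable (cube N) (diff_cost N p (f n) g)" using ev[of 1] by auto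
  show "p_integrable N p g"
    unfolding p_integrable_def
  proof (intro conjI impI g)
    assume p0: "p \<noteq> 0"
    \<comment> \<open>\<open>g\<close> is dominated coordinatewise by \<open>f n\<close> and
      \<open>f n - g\<close>, both integrable.\<close>
    show "integrable (cube N) (\<lambda>u. pow_sum N p (g u))"
    proof (rule integrable_pow_sum_dominated[where c=1 and f="f n" and g="\<lambda>u i. f n u i - g u i"])
      show "0 < p" using p p0 by simp
      show "integrable (cube N) (\<lambda>u. pow_sum N p (f n u))"
        using f[of n] p0 by (simp add: p_integrable_def)
      show "integrable (cube N) (\<lambda>u. pow_sum N p (\<lambda>i. f n u i - g u i))"
        using int p0 by (simp add: cost_def)
    qed (auto intro: measurable_RN_component[OF g])
  qed
qed

text \<open>Markov's inequality and Borel-Cantelli. With distances below \<open>(1 / 4) ^ j\<close>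
  and threshold \<open>(1 / 2) ^ j\<close>, the exceptional probability is at most
  \<open>((1 / 2) ^ j) powr expo p\<close>, hence at most \<open>(1 / 2) ^ j\<close>. Both this
  bound and the threshold are summable.\<close>

lemma cauchy_in_subsequence_AE:
  assumes p: "p = 0 \<or> 1 \<le> p" and f: "\<And>n. p_integrable N p (f n)" and cau: "cauchy_in N p f"
  obtains s where "strict_mono s" "AE u in cube N. \<forall>i<N. convergent (\<lambda>j. f (s j) u i)"
proof -
  note fm = p_integrable_measurable[OF f]
  let ?r = "expo p"
  have r: "1 \<le> ?r" by (rule expo_ge_1[OF p])
  have "\<forall>j. \<exists>M. \<forall>m\<ge>M. \<forall>n\<ge>M. fun_dist N p (f m) (f n) < (1 / 4) ^ j"
  proof
    fix j :: nat
    have "(0::real) < (1 / 4) ^ j" by simp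
    then show "\<exists>M. \<forall>m\<ge>M. \<forall>n\<ge>M. fun_dist N p (f m) (f n) < (1 / 4) ^ j"
      using cau unfolding cauchy_in_def by blast
  qed
  then obtain M where M: "\<And>j m n. m \<ge> M j \<Longrightarrow> n \<ge> M j \<Longrightarrow> fun_dist N p (f m) (f n) < (1 / 4) ^ j"
    by metis
  \<comment> \<open>Summing \<open>Suc (M i)\<close> makes the indices strictly increasing and at
    least \<open>M j\<close>.\<close>
  define s where "s j = (\<Sum>i\<le>j. Suc (M i))" for j
  have s: "strict_mono s" by (rule strict_monoI_Suc) (simp add: s_def)
  have sM: "M j \<le> s j" for j
    using member_le_sum[of j "{..j}" "\<lambda>i. Suc (M i)"] by (simp add: s_def)
  have sMS: "M j \<le> s (Suc j)" for j using sM[of j] by (simp add: s_def)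
  define C where "C j u = diff_cost N p (f (s j)) (f (s (Suc j))) u" for j u
  have Cint: "integrable (cube N) (C j)" for j
    unfolding C_def by (rule integrable_diff_cost[OF p f f])
  define A where "A j = {u \<in> space (cube N). ((1 / 2) ^ j) powr ?r \<le> C j u}" for j
  have Am: "A j \<in> sets (cube N)" for j
    unfolding A_def by (intro borel_measurable_le borel_measurable_const borel_measurable_integrable Cint)
  have Ale: "measure (cube N) (A j) \<le> (1 / 2) ^ j" for j
  proof -
    have "measure (cube N) (A j) \<le> (\<integral>u. C j u \<partial>cube N) / ((1 / 2) ^ j) powr ?r"
      unfolding A_def
      using integral_Markov_inequality_measure[OF Cint[of j], of "{}" "((1 / 2) ^ j) powr ?r"]
      by (simp add: C_def cost_nonneg)
    also have "(\<integral>u. C j u \<partial>cube N) \<le> ((1 / 4) ^ j) powr ?r"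
      using fun_dist_le_iff[OF p, of "(1 / 4) ^ j" N "f (s j)" "f (s (Suc j))"] M[OF sM sMS, of j]
      by (simp add: C_def less_imp_le)
    then have "(\<integral>u. C j u \<partial>cube N) / ((1 / 2) ^ j) powr ?r \<le> ((1 / 4) ^ j) powr ?r / ((1 / 2) ^ j) powr ?r"
      by (intro divide_right_mono) auto
    also have "\<dots> = ((1 / 4) ^ j / (1 / 2) ^ j) powr ?r" by (rule powr_divide[symmetric])
    also have "(1 / 4 :: real) ^ j / (1 / 2) ^ j = (1 / 2) ^ j" by (simp add: power_divide[symmetric])
    also have "((1 / 2) ^ j) powr ?r \<le> ((1 / 2 :: real) ^ j) powr 1"
      using r by (intro powr_mono') (auto simp: power_le_one)
    finally show ?thesis by simp
  qed
  have "AE u in cube N. eventually (\<lambda>j. u \<in> space (cube N) - A j) sequentially"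
  proof (rule borel_cantelli_AE1[OF Am])
    show "emeasure (cube N) (A j) < \<infinity>" for j by (simp add: less_top[symmetric])
    show "summable (\<lambda>j. measure (cube N) (A j))"
      by (rule summable_comparison_test[of _ "\<lambda>j. (1 / 2 :: real) ^ j"])
         (use Ale in \<open>auto simp: summable_geometric\<close>)
  qed
  then have "AE u in cube N. \<forall>i<N. convergent (\<lambda>j. f (s j) u i)"
  proof eventually_elim
    case (elim u)
    show ?case
    proof (intro allI impI convergent_of_fast_differences)
      fix i assume i: "i < N"
      show "eventually (\<lambda>j. \<bar>f (s j) u i - f (s (Suc j)) u i\<bar> \<le> (1 / 2) ^ j) sequentially"
        using elim
      proof eventually_elim
        case (elim j)
        show ?case
        proof (rule ccontr)
          assume "\<not> \<bar>f (s j) u i - f (s (Suc j)) u i\<bar> \<le> (1 / 2) ^ j"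
          then have "((1 / 2) ^ j) powr ?r \<le> C j u"
            unfolding C_def by (intro cost_ge_component[OF p i]) (auto simp: power_le_one)
          then show False using elim by (simp add: A_def)
        qed
      qed
    qed
  qed
  with s show thesis by (rule that)
qed

text \<open>A nonempty open interval has positive measure and cannot lie in a null set.\<close>

lemma AE_unit_measure_dense:
  assumes P: "AE v in unit_measure. P v" and ab: "0 \<le> a" "a < b" "b \<le> 1"
  shows "\<exists>v. a < v \<and> v < b \<and> P v"
proof (rule ccontr)
  assume no: "\<not> ?thesis"
  obtain Z where Z: "Z \<in> sets unit_measure" "emeasure unit_measure Z = 0" "{v \<in> space unit_measure. \<not> P v} \<subseteq> Z"
    using P by (rule AE_E) auto
  have "{a<..<b} \<subseteq> Z"
  proof
    fix v assume "v \<in> {a<..<b}"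
    then have "v \<in> space unit_measure" "\<not> P v" using no ab by auto
    then show "v \<in> Z" using Z(3) by blast
  qed
  then have "emeasure unit_measure {a<..<b} \<le> 0"
    using emeasure_mono[OF _ Z(1), of "{a<..<b}"] Z(2) by simp
  moreover have "emeasure unit_measure {a<..<b} = ennreal (b - a)"
    using ab by (subst emeasure_restrict_space) auto
  ultimately show False using ab by (simp add: ennreal_eq_0_iff)
qed

text \<open>The pointwise limit superior is increasing and triangular everywhere, but possibly infinite. By
  monotonicity in the last input it is finite on a whole fibre as soon as it is finite at all rational points
  of that fibre; on the remaining null set of fibres the value 0 is used instead.\<close>

lemma increasing_triangular_limit:
  assumes T: "\<And>j. increasing_triangular N (T j)"
    and conv: "AE u in cube N. \<forall>i<N. convergent (\<lambda>j. T j u i)"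
  obtains g where "increasing_triangular N g" "AE u in cube N. \<forall>i<N. (\<lambda>j. T j u i) \<longlonglongrightarrow> g u i"
proof -
  have tri: "triangular N (T j)" and inc: "prop_inc N (T j)" for j
    using T[of j] by (simp_all add: increasing_triangular_def)
  note Tm = triangular_measurable[OF tri]
  define L where "L u k = limsup (\<lambda>j. ereal (T j u k))" for u k
  \<comment> \<open>The entry \<open>u k\<close> is overwritten, so the condition belongs to the
    fibre in direction \<open>k\<close> and not to the point on it. Switching to 0 therefore affects
    whole fibres and cannot destroy monotonicity.\<close>
  define good where "good k u \<longleftrightarrow> (\<forall>q::rat. 0 < q \<longrightarrow> q < 1 \<longrightarrow> \<bar>L (u(k := of_rat q)) k\<bar> \<noteq> \<infinity>)" for k u
  define g where "g u = (\<lambda>k\<in>{0..<N}. if good k u then real_of_ereal (L u k) else 0)" for u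
  have rat01: "of_rat q \<in> {0<..<1::real}" if "0 < q" "q < 1" for q using that by simp
  have Lm: "(\<lambda>u. L u k) \<in> borel_measurable (cube N)" if "k < N" for k
    unfolding L_def
    by (intro borel_measurable_limsup borel_measurable_ereal measurable_RN_component[OF Tm that])
  have goodm: "{u \<in> space (cube N). good k u} \<in> sets (cube N)" if k: "k < N" for k
  proof -
    have "Measurable.pred (cube N) (\<lambda>u. \<bar>L (u(k := of_rat q)) k\<bar> \<noteq> \<infinity>)" if q: "0 < q" "q < 1" for q
    proof -
      have "(\<lambda>u. u(k := of_rat q)) \<in> measurable (cube N) (cube N)"
        by (rule measurable_cube_upd[OF k measurable_ident_sets[OF refl] measurable_const])
           (simp only: space_unit_measure rat01[OF q])
      from measurable_compose[OF this Lm[OF k]]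
      have "(\<lambda>u. L (u(k := of_rat q)) k) \<in> borel_measurable (cube N)" .
      then show ?thesis by measurable
    qed
    then show ?thesis
      unfolding good_def pred_def[symmetric] by (intro pred_intros_countable(1) pred_intros_imp')
  qed
  have gm: "g \<in> measurable (cube N) (RN N)"
    unfolding measurable_RN_iff
  proof (intro conjI allI impI)
    fix k assume k: "k < N"
    have "(\<lambda>u. if good k u then real_of_ereal (L u k) else 0) \<in> borel_measurable (cube N)"
      by (intro measurable_If borel_measurable_real_of_ereal Lm[OF k] goodm[OF k] borel_measurable_const)
    then show "(\<lambda>u. g u k) \<in> borel_measurable (cube N)" using k by (simp add: g_def)
  qed (auto simp: g_def)
  have L_cong: "L u k = L w k" if "k < N" "u \<in> space (cube N)" "w \<in> space (cube N)" "\<And>j. j \<le> k \<Longrightarrow> u j = w j" for u w k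
    unfolding L_def using triangular_cong[OF tri that] by simp
  have L_mono: "L (u(k := v)) k \<le> L (u(k := w)) k"
    if "k < N" "u \<in> space (cube N)" "v \<in> {0<..<1}" "w \<in> {0<..<1}" "v \<le> w" for u k v w
    unfolding L_def using mono_onD[OF prop_inc_mono_on[OF inc that(1,2)]] that(3-5)
    by (intro Limsup_mono always_eventually) auto
  have finite_between: "\<bar>L (u(k := v)) k\<bar> \<noteq> \<infinity>"
    if "k < N" "u \<in> space (cube N)" "0 < a" "a < v" "v < b" "b < 1"
      and "\<bar>L (u(k := a)) k\<bar> \<noteq> \<infinity>" "\<bar>L (u(k := b)) k\<bar> \<noteq> \<infinity>" for u k v a b
  proof -
    have "L (u(k := a)) k \<le> L (u(k := v)) k" "L (u(k := v)) k \<le> L (u(k := b)) k"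
      using that by (auto intro!: L_mono)
    then show ?thesis using that(7,8) by (cases "L (u(k := a)) k"; cases "L (u(k := b)) k"; cases "L (u(k := v)) k") auto
  qed
  have good_finite: "\<bar>L (u(k := v)) k\<bar> \<noteq> \<infinity>" if k: "k < N" and u: "u \<in> space (cube N)" and v: "v \<in> {0<..<1}" and gd: "good k u" for u k v
  proof -
    obtain q :: rat where q: "(0::real) < of_rat q" "of_rat q < v" using of_rat_dense[of 0 v] v by auto
    obtain r :: rat where r: "v < of_rat r" "of_rat r < (1::real)" using of_rat_dense[of v 1] v by auto
    have "(of_rat q :: real) < 1" "0 < (of_rat r::real)" using q r v unfolding greaterThanLessThan_iff by linarith+
    then have qr: "0 < q" "q < 1" "0 < r" "r < 1"
      using q(1) r(2) unfolding zero_less_of_rat_iff of_rat_less_1_iff by simp_all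
    show ?thesis
      by (rule finite_between[OF k u q r gd[unfolded good_def, rule_format, OF qr(1,2)]
            gd[unfolded good_def, rule_format, OF qr(3,4)]])
  qed
  have good_upd: "good k (u(k := v)) = good k u" for k u v
    by (simp add: good_def)
  have "increasing_triangular N g"
    unfolding increasing_triangular_def triangular_def prop_inc_def
  proof (intro conjI allI ballI impI gm)
    fix k u w assume k: "k < N" and u: "u \<in> space (cube N)" and w: "w \<in> space (cube N)" and eq: "\<forall>j\<le>k. u j = w j"
    have "L (u(k := of_rat q)) k = L (w(k := of_rat q)) k" if "0 < q" "q < 1" for q
      by (rule L_cong[OF k]) (use cube_upd_in u w k rat01[OF that] eq in auto)
    then have "good k u = good k w" unfolding good_def by metis
    moreover have "L u k = L w k" using L_cong[OF k u w] eq by blast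
    ultimately show "g u k = g w k" using k by (simp add: g_def)
  next
    fix k u v assume k: "k < N" and u: "u \<in> space (cube N)" and v: "v \<in> {0<..<1}" "u k \<le> v"
    have uk: "u k \<in> {0<..<1}" using u k by (auto simp: space_cube)
    show "g u k \<le> g (u(k := v)) k"
    proof (cases "good k u")
      case True
      have "L u k \<le> L (u(k := v)) k" using L_mono[OF k u uk v] by simp
      moreover have "\<bar>L u k\<bar> \<noteq> \<infinity>" using good_finite[OF k u uk True] by simp
      moreover have "\<bar>L (u(k := v)) k\<bar> \<noteq> \<infinity>" by (rule good_finite[OF k u v(1) True])
      ultimately have "real_of_ereal (L u k) \<le> real_of_ereal (L (u(k := v)) k)"
        by (cases "L u k"; cases "L (u(k := v)) k") auto
      then show ?thesis using k True by (simp add: g_def good_upd)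
    next
      case False
      then show ?thesis using k by (simp add: g_def good_upd)
    qed
  qed
  moreover
  have L_lim: "L u k = ereal (lim (\<lambda>j. T j u k))" if "convergent (\<lambda>j. T j u k)" for u k
  proof -
    have "(\<lambda>j. ereal (T j u k)) \<longlonglongrightarrow> ereal (lim (\<lambda>j. T j u k))"
      using that by (intro tendsto_ereal) (simp add: convergent_LIMSEQ_iff)
    then show ?thesis unfolding L_def by (rule lim_imp_Limsup[OF sequentially_bot])
  qed
  \<comment> \<open>On almost every fibre the value is finite at almost every point, hence somewhere
    on either side of each rational; monotonicity squeezes the value at the rational itself.\<close>
  have "AE u in cube N. good k u" if k: "k < N" for k
    using AE_cube_upd[OF k conv] AE_space
  proof eventually_elim
    case (elim u)
    have fin: "AE v in unit_measure. \<bar>L (u(k := v)) k\<bar> \<noteq> \<infinity>"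
      using elim(1) by eventually_elim (use k L_lim in auto)
    show ?case
      unfolding good_def
    proof (intro allI impI)
      fix q :: rat assume q: "0 < q" "q < 1"
      then have q': "0 < (of_rat q :: real)" "(of_rat q :: real) < 1" by simp_all
      obtain a where a: "0 < a" "a < of_rat q" "\<bar>L (u(k := a)) k\<bar> \<noteq> \<infinity>"
        using AE_unit_measure_dense[OF fin, of 0 "of_rat q"] q' by auto
      obtain b where b: "of_rat q < b" "b < 1" "\<bar>L (u(k := b)) k\<bar> \<noteq> \<infinity>"
        using AE_unit_measure_dense[OF fin, of "of_rat q" 1] q' by auto
      show "\<bar>L (u(k := of_rat q)) k\<bar> \<noteq> \<infinity>"
        by (rule finite_between[OF k elim(2) a(1,2) b(1,2) a(3) b(3)])
    qed
  qed
  then have "AE u in cube N. \<forall>k\<in>{0..<N}. good k u"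
    by (intro AE_finite_allI) auto
  with conv have "AE u in cube N. \<forall>i<N. (\<lambda>j. T j u i) \<longlonglongrightarrow> g u i"
  proof eventually_elim
    case (elim u)
    show ?case
    proof (intro allI impI)
      fix i assume i: "i < N"
      then have "g u i = lim (\<lambda>j. T j u i)" using elim L_lim[of u i] by (simp add: g_def)
      then show "(\<lambda>j. T j u i) \<longlonglongrightarrow> g u i" using elim(1) i by (simp add: convergent_LIMSEQ_iff)
    qed
  qed
  ultimately show thesis by (rule that)
qed

lemma cauchy_in_IT_limit:
  assumes p: "p = 0 \<or> 1 \<le> p" and T: "\<And>n. p_integrable N p (T n)" "\<And>n. increasing_triangular N (T n)"
    and cau: "cauchy_in N p T"
  obtains g where "p_integrable N p g" "increasing_triangular N g" "(\<lambda>n. fun_dist N p (T n) g) \<longlonglongrightarrow> 0"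
proof -
  obtain s where s: "strict_mono s" and conv: "AE u in cube N. \<forall>i<N. convergent (\<lambda>j. T (s j) u i)"
    by (rule cauchy_in_subsequence_AE[OF p T(1) cau])
  obtain g where g: "increasing_triangular N g" "AE u in cube N. \<forall>i<N. (\<lambda>j. T (s j) u i) \<longlonglongrightarrow> g u i"
    by (rule increasing_triangular_limit[OF T(2) conv])
  have gm: "g \<in> measurable (cube N) (RN N)"
    using g(1) triangular_measurable by (simp add: increasing_triangular_def)
  show thesis
    by (rule that[OF cauchy_in_limit(1)[OF p T(1) cau s gm g(2)] g(1) cauchy_in_limit(2)[OF p T(1) cau s gm g(2)]])
qed

subsection \<open>Cones, closures and the metric completion\<close>

text \<open>The operations on classes go through chosen representatives, which need not satisfy
  \<open>P\<close>; the result is identified with the class of the sum or multiple of maps that do.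
  Each cone is thereby reduced to pointwise closure properties.\<close>

lemma Lp_convex_coneI:
  assumes p: "p = 0 \<or> 1 \<le> p" and meas: "\<And>T. P T \<Longrightarrow> T \<in> measurable (cube N) (RN N)"
    and add: "\<And>S T. P S \<Longrightarrow> P T \<Longrightarrow> P (\<lambda>u. \<lambda>i\<in>{0..<N}. S u i + T u i)"
    and scale: "\<And>c T. 0 < c \<Longrightarrow> P T \<Longrightarrow> P (\<lambda>u. \<lambda>i\<in>{0..<N}. c * T u i)"
  shows "Lp_convex_cone N {ae_class N T | T. p_integrable N p T \<and> P T}"
  unfolding Lp_convex_cone_def
proof (intro conjI ballI allI impI)
  fix F G assume "F \<in> {ae_class N T | T. p_integrable N p T \<and> P T}" "G \<in> {ae_class N T | T. p_integrable N p T \<and> P T}"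
  then obtain S T where S: "p_integrable N p S" "P S" "F = ae_class N S" and T: "p_integrable N p T" "P T" "G = ae_class N T"
    by blast
  define R where "R u = (\<lambda>i\<in>{0..<N}. S u i + T u i)" for u
  have PR: "P R" unfolding R_def[abs_def] by (rule add[OF S(2) T(2)])
  have "p_integrable N p R"
    by (rule p_integrable_dominated[OF p meas[OF PR] S(1) T(1), of 1]) (auto simp: R_def abs_triangle_ineq)
  moreover have "Lp_add N F G = ae_class N R"
  proof -
    let ?R = "\<lambda>u. \<lambda>i\<in>{0..<N}. representative F u i + representative G u i"
    have "AE u in cube N. R u = ?R u"
      using representative_ae_class(2)[OF meas[OF S(2)]] representative_ae_class(2)[OF meas[OF T(2)]]
      unfolding S(3)[symmetric] T(3)[symmetric] by eventually_elim (simp add: R_def)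
    then have "ae_class N R = ae_class N ?R" unfolding ae_class_eq_iff[OF meas[OF PR]] .
    then show ?thesis unfolding Lp_add_def by (rule sym)
  qed
  ultimately show "Lp_add N F G \<in> {ae_class N T | T. p_integrable N p T \<and> P T}" using PR by blast
next
  fix c :: real and F assume c: "0 < c" and "F \<in> {ae_class N T | T. p_integrable N p T \<and> P T}"
  then obtain T where T: "p_integrable N p T" "P T" "F = ae_class N T" by blast
  define R where "R u = (\<lambda>i\<in>{0..<N}. c * T u i)" for u
  have PR: "P R" unfolding R_def[abs_def] by (rule scale[OF c T(2)])
  have "p_integrable N p R"
    by (rule p_integrable_dominated[OF p meas[OF PR] T(1) T(1), of c]) (use c in \<open>auto simp: R_def abs_mult\<close>)
  moreover have "Lp_scale N c F = ae_class N R"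
  proof -
    let ?R = "\<lambda>u. \<lambda>i\<in>{0..<N}. c * representative F u i"
    have "AE u in cube N. R u = ?R u"
      using representative_ae_class(2)[OF meas[OF T(2)]]
      unfolding T(3)[symmetric] by eventually_elim (simp add: R_def)
    then have "ae_class N R = ae_class N ?R" unfolding ae_class_eq_iff[OF meas[OF PR]] .
    then show ?thesis unfolding Lp_scale_def by (rule sym)
  qed
  ultimately show "Lp_scale N c F \<in> {ae_class N T | T. p_integrable N p T \<and> P T}" using PR by blast
qed

section \<open>Stability of the pointwise conditions under sums and multiples\<close>

lemma triangular_add:
  assumes "triangular N S" "triangular N T"
  shows "triangular N (\<lambda>u. \<lambda>i\<in>{0..<N}. S u i + T u i)"
  unfolding triangular_def
proof (intro conjI allI ballI impI)
  show "(\<lambda>u. \<lambda>i\<in>{0..<N}. S u i + T u i) \<in> measurable (cube N) (RN N)"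
    unfolding measurable_RN_iff
    using measurable_RN_component[OF triangular_measurable[OF assms(1)]] measurable_RN_component[OF triangular_measurable[OF assms(2)]]
    by auto
  fix k u w assume "k < N" "u \<in> space (cube N)" "w \<in> space (cube N)" "\<forall>j\<le>k. u j = w j"
  then show "(\<lambda>i\<in>{0..<N}. S u i + T u i) k = (\<lambda>i\<in>{0..<N}. S w i + T w i) k"
    using triangular_cong[OF assms(1), of k u w] triangular_cong[OF assms(2), of k u w] by simp
qed

lemma triangular_scale:
  assumes "triangular N T"
  shows "triangular N (\<lambda>u. \<lambda>i\<in>{0..<N}. c * T u i)"
  unfolding triangular_def
proof (intro conjI allI ballI impI)
  show "(\<lambda>u. \<lambda>i\<in>{0..<N}. c * T u i) \<in> measurable (cube N) (RN N)"
    unfolding measurable_RN_iff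
    using measurable_RN_component[OF triangular_measurable[OF assms(1)]]
    by auto
  fix k u w assume "k < N" "u \<in> space (cube N)" "w \<in> space (cube N)" "\<forall>j\<le>k. u j = w j"
  then show "(\<lambda>i\<in>{0..<N}. c * T u i) k = (\<lambda>i\<in>{0..<N}. c * T w i) k"
    using triangular_cong[OF assms(1), of k u w] by simp
qed

lemma prop_incD:
  "prop_inc N T \<Longrightarrow> k < N \<Longrightarrow> u \<in> space (cube N) \<Longrightarrow> v \<in> {0<..<1} \<Longrightarrow> u k \<le> v \<Longrightarrow> T u k \<le> T (u(k := v)) k"
  unfolding prop_inc_def by blast

text \<open>(con) compares values in both directions, so (inc) is also wanted in its downward
  form.\<close>

lemma prop_incD_ge:
  assumes "prop_inc N T" "k < N" "u \<in> space (cube N)" "v \<in> {0<..<1}" "v \<le> u k"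
  shows "T (u(k := v)) k \<le> T u k"
proof -
  have "u k \<in> {0<..<1}" using assms by (auto simp: space_cube)
  then show ?thesis
    using prop_incD[OF assms(1,2) cube_upd_in[OF assms(3,4,2)], of "u k"] assms(5) by simp
qed

lemma prop_sincD:
  "prop_sinc N T \<Longrightarrow> k < N \<Longrightarrow> u \<in> space (cube N) \<Longrightarrow> v \<in> {0<..<1} \<Longrightarrow> u k < v \<Longrightarrow> T u k < T (u(k := v)) k"
  unfolding prop_sinc_def by blast

lemma prop_conD:
  assumes "prop_con N T" "k \<le> m" "m < N" "u \<in> space (cube N)" "v \<in> {0<..<1}" "T u k = T (u(k := v)) k"
  shows "T u m = T (u(k := v)) m"
  using assms(1)[unfolded prop_con_def, rule_format, of k m u v] assms(2-) by linarith

lemma prop_inc_add: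
  "prop_inc N S \<Longrightarrow> prop_inc N T \<Longrightarrow> prop_inc N (\<lambda>u. \<lambda>i\<in>{0..<N}. S u i + T u i)"
  unfolding prop_inc_def by (auto intro!: add_mono)

lemma prop_inc_scale:
  "0 < c \<Longrightarrow> prop_inc N T \<Longrightarrow> prop_inc N (\<lambda>u. \<lambda>i\<in>{0..<N}. c * T u i)"
  unfolding prop_inc_def by (auto intro!: mult_left_mono)

lemma prop_sinc_add:
  "prop_inc N S \<Longrightarrow> prop_sinc N T \<Longrightarrow> prop_sinc N (\<lambda>u. \<lambda>i\<in>{0..<N}. S u i + T u i)"
  unfolding prop_inc_def prop_sinc_def by (auto intro!: add_le_less_mono)

lemma prop_sinc_scale:
  "0 < c \<Longrightarrow> prop_sinc N T \<Longrightarrow> prop_sinc N (\<lambda>u. \<lambda>i\<in>{0..<N}. c * T u i)"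
  unfolding prop_sinc_def by auto

text \<open>By (inc), changing one input moves both summands in the same direction, so the sum can
  stay fixed only if each summand does.\<close>

lemma prop_con_add:
  assumes S: "prop_inc N S" "prop_con N S" and T: "prop_inc N T" "prop_con N T"
  shows "prop_con N (\<lambda>u. \<lambda>i\<in>{0..<N}. S u i + T u i)"
  unfolding prop_con_def
proof (intro allI ballI impI)
  fix k m u v assume k: "k < N" and m: "k \<le> m \<and> m < N" and u: "u \<in> space (cube N)" and v: "v \<in> {0<..<1}"
    and "(\<lambda>i\<in>{0..<N}. S u i + T u i) k = (\<lambda>i\<in>{0..<N}. S (u(k := v)) i + T (u(k := v)) i) k"
  then have eq: "S u k + T u k = S (u(k := v)) k + T (u(k := v)) k" by simp
  have "S u k = S (u(k := v)) k \<and> T u k = T (u(k := v)) k"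
  proof (cases "u k \<le> v")
    case True
    then show ?thesis using prop_incD[OF S(1) k u v] prop_incD[OF T(1) k u v] eq by linarith
  next
    case False
    then show ?thesis using prop_incD_ge[OF S(1) k u v] prop_incD_ge[OF T(1) k u v] eq by linarith
  qed
  then have "S u m = S (u(k := v)) m" "T u m = T (u(k := v)) m"
    using prop_conD[OF S(2) _ _ u v] prop_conD[OF T(2) _ _ u v] m by blast+
  then show "(\<lambda>i\<in>{0..<N}. S u i + T u i) m = (\<lambda>i\<in>{0..<N}. S (u(k := v)) i + T (u(k := v)) i) m"
    using m by simp
qed

lemma prop_con_scale:
  assumes c: "0 < c" and T: "prop_con N T"
  shows "prop_con N (\<lambda>u. \<lambda>i\<in>{0..<N}. c * T u i)"
  unfolding prop_con_def
proof (intro allI ballI impI)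
  fix k m u v assume k: "k < N" and m: "k \<le> m \<and> m < N" and u: "u \<in> space (cube N)" and v: "v \<in> {0<..<1}"
    and "(\<lambda>i\<in>{0..<N}. c * T u i) k = (\<lambda>i\<in>{0..<N}. c * T (u(k := v)) i) k"
  then have "T u k = T (u(k := v)) k" using c by simp
  then have "T u m = T (u(k := v)) m" using prop_conD[OF T _ _ u v] m by blast
  then show "(\<lambda>i\<in>{0..<N}. c * T u i) m = (\<lambda>i\<in>{0..<N}. c * T (u(k := v)) i) m" by simp
qed

lemma prop_sinc_imp_inc:
  assumes "prop_sinc N T"
  shows "prop_inc N T"
  unfolding prop_inc_def
proof (intro allI ballI impI)
  fix k u v assume k: "k < N" and u: "u \<in> space (cube N)" and v: "v \<in> {0<..<1}" "u k \<le> v"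
  show "T u k \<le> T (u(k := v)) k"
  proof (cases "u k = v")
    case True
    then have "u(k := v) = u" by auto
    then show ?thesis by simp
  next
    case False
    then show ?thesis using prop_sincD[OF assms k u v(1)] v(2) by simp
  qed
qed

text \<open>Under (sinc) the premise of (con) forces \<open>u k = v\<close>.\<close>

lemma prop_sinc_imp_con:
  assumes "prop_sinc N T"
  shows "prop_con N T"
  unfolding prop_con_def
proof (intro allI ballI impI)
  fix k m u v assume k: "k < N" and m: "k \<le> m \<and> m < N" and u: "u \<in> space (cube N)" and v: "v \<in> {0<..<1}"
    and eq: "T u k = T (u(k := v)) k"
  have "u k = v"
  proof (rule linorder_cases)
    assume "u k < v"
    then show ?thesis using prop_sincD[OF assms k u v] eq by simp
  next
    assume gt: "v < u k"
    have "u k \<in> {0<..<1}" using u k by (auto simp: space_cube)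
    then show ?thesis using prop_sincD[OF assms k cube_upd_in[OF u v k], of "u k"] gt eq by simp
  qed
  then have "u(k := v) = u" by auto
  then show "T u m = T (u(k := v)) m" by simp
qed

lemma SIT_quantile_process: "strictly_increasing_triangular N T \<Longrightarrow> quantile_process N T"
  by (simp add: strictly_increasing_triangular_def quantile_process_def prop_sinc_imp_inc prop_sinc_imp_con)

lemma quantile_process_IT: "quantile_process N T \<Longrightarrow> increasing_triangular N T"
  by (simp add: quantile_process_def increasing_triangular_def)

lemma IT_measurable: "increasing_triangular N T \<Longrightarrow> T \<in> measurable (cube N) (RN N)"
  by (simp add: increasing_triangular_def triangular_measurable)

lemma convex_cones:
  assumes p: "p = 0 \<or> 1 \<le> p"
  shows "Lp_convex_cone N (Lp_SIT N p)" "Lp_convex_cone N (Lp_quantile N p)" "Lp_convex_cone N (Lp_IT N p)"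
proof -
  show "Lp_convex_cone N (Lp_IT N p)"
    unfolding Lp_IT_def
    by (rule Lp_convex_coneI[OF p IT_measurable])
       (simp_all add: increasing_triangular_def triangular_add triangular_scale prop_inc_add prop_inc_scale)
  show "Lp_convex_cone N (Lp_quantile N p)"
    unfolding Lp_quantile_def
    by (rule Lp_convex_coneI[OF p IT_measurable[OF quantile_process_IT]])
       (simp_all add: quantile_process_def triangular_add triangular_scale prop_inc_add prop_inc_scale prop_con_add prop_con_scale)
  show "Lp_convex_cone N (Lp_SIT N p)"
    unfolding Lp_SIT_def
    by (rule Lp_convex_coneI[OF p IT_measurable[OF quantile_process_IT[OF SIT_quantile_process]]])
       (simp_all add: strictly_increasing_triangular_def triangular_add triangular_scale prop_sinc_add prop_sinc_imp_inc prop_sinc_scale)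
qed

lemma Lp_SIT_subset: "Lp_SIT N p \<subseteq> Lp_quantile N p"
  unfolding Lp_SIT_def Lp_quantile_def using SIT_quantile_process by blast

lemma Lp_quantile_subset: "Lp_quantile N p \<subseteq> Lp_IT N p"
  unfolding Lp_quantile_def Lp_IT_def using quantile_process_IT by blast

lemma Lp_IT_subset: "Lp_IT N p \<subseteq> Lp N p"
  unfolding Lp_IT_def Lp_def by blast

section \<open>Approximation by strictly increasing maps\<close>

lemma triangular_id: "triangular N (\<lambda>u. u)"
proof -
  have "(\<lambda>u. u) \<in> measurable (cube N) (RN N)"
    unfolding measurable_RN_iff using measurable_cube_component_borel by (auto simp: space_cube PiE_iff)
  then show ?thesis unfolding triangular_def by auto
qed

lemma p_integrable_id:
  assumes p: "p = 0 \<or> 1 \<le> p"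
  shows "p_integrable N p (\<lambda>u. u)"
  unfolding p_integrable_def
proof (intro conjI impI)
  show m: "(\<lambda>u. u) \<in> measurable (cube N) (RN N)" by (rule triangular_measurable[OF triangular_id])
  assume "p \<noteq> 0"
  show "integrable (cube N) (pow_sum N p)"
  proof (rule cube.integrable_const_bound[of _ "real N"])
    show "AE u in cube N. norm (pow_sum N p u) \<le> real N"
    proof (rule AE_I2)
      fix u assume u: "u \<in> space (cube N)"
      have "pow_sum N p u \<le> (\<Sum>i\<in>{0..<N}. 1)"
        unfolding pow_sum_def
      proof (rule sum_mono)
        fix i assume "i \<in> {0..<N}"
        then have "u i \<in> {0<..<1}" using u by (auto simp: space_cube)
        then show "\<bar>u i\<bar> powr p \<le> 1" using p \<open>p \<noteq> 0\<close> by (intro powr_le1) auto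
      qed
      then show "norm (pow_sum N p u) \<le> real N" using pow_sum_nonneg[of N p u] by simp
    qed
  qed (rule measurable_pow_sum[OF measurable_RN_component[OF m]])
qed

text \<open>The factor \<open>N\<close> is crude but uniform in \<open>p\<close>: it bounds the
  Euclidean norm by the sum of the coordinates, and for \<open>p \<ge> 1\<close> it rests on
  \<open>N \<le> N powr p\<close>.\<close>

lemma cost_le_of_small:
  assumes p: "p = 0 \<or> 1 \<le> p" and e: "0 \<le> e" and le: "\<And>i. i < N \<Longrightarrow> \<bar>x i\<bar> \<le> e"
  shows "cost N p x \<le> (real N * e) powr expo p"
proof (cases "p = 0")
  case True
  have "L2_set x {0..<N} \<le> (\<Sum>i\<in>{0..<N}. \<bar>x i\<bar>)" by (rule L2_set_le_sum_abs)
  also have "\<dots> \<le> (\<Sum>i\<in>{0..<N}. e)" by (rule sum_mono) (use le in auto)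
  finally show ?thesis using True e by (simp add: cost_def expo_def)
next
  case False
  have "pow_sum N p x \<le> (\<Sum>i\<in>{0..<N}. e powr p)"
    unfolding pow_sum_def by (intro sum_mono powr_mono2) (use le p False in auto)
  also have "\<dots> = real N powr 1 * e powr p" by simp
  also have "\<dots> \<le> real N powr p * e powr p"
  proof (cases "N = 0")
    case False
    then show ?thesis using p \<open>p \<noteq> 0\<close> by (intro mult_right_mono powr_mono) auto
  qed (use False in simp)
  finally show ?thesis using False e by (simp add: cost_def expo_def powr_mult)
qed

lemma SIT_approximation:
  assumes p: "p = 0 \<or> 1 \<le> p" and T: "p_integrable N p T" "increasing_triangular N T" and r: "0 < r"
  obtains S where "p_integrable N p S" "strictly_increasing_triangular N S" "fun_dist N p T S < r"
proof -
  \<comment> \<open>Makes \<open>real N * e\<close>, the bound obtained from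
    \<open>cost_le_of_small\<close>, smaller than \<open>r\<close>; the summand 1 avoids a division
    by zero for \<open>N = 0\<close>.\<close>
  define e where "e = r / (2 * (real N + 1))"
  have e: "0 < e" using r by (simp add: e_def)
  have Ne: "real N * e < r"
  proof -
    have "real N * e \<le> (real N + 1) * e" using e by (intro mult_right_mono) auto
    also have "\<dots> = r / 2" unfolding e_def by (simp add: field_simps)
    finally show ?thesis using r by simp
  qed
  define S where "S u = (\<lambda>i\<in>{0..<N}. T u i + (\<lambda>i\<in>{0..<N}. e * u i) i)" for u
  have S_apply: "S u i = T u i + e * u i" if "i < N" for u i using that by (simp add: S_def)
  have id: "prop_sinc N (\<lambda>u. u)" by (auto simp: prop_sinc_def)
  have SIT: "strictly_increasing_triangular N S"
    using T(2) triangular_add[OF _ triangular_scale[OF triangular_id]] prop_sinc_add[OF _ prop_sinc_scale[OF e id]]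
    unfolding strictly_increasing_triangular_def increasing_triangular_def S_def[abs_def] by blast
  have Sm: "S \<in> measurable (cube N) (RN N)"
    by (rule IT_measurable[OF quantile_process_IT[OF SIT_quantile_process[OF SIT]]])
  have Sint: "p_integrable N p S"
  proof (rule p_integrable_dominated[OF p Sm T(1) p_integrable_id[OF p]])
    show "0 \<le> max 1 e" by simp
    show "AE u in cube N. \<forall>i<N. \<bar>S u i\<bar> \<le> max 1 e * (\<bar>T u i\<bar> + \<bar>u i\<bar>)"
    proof (intro AE_I2 allI impI)
      fix u i assume "i < N"
      have "\<bar>T u i + e * u i\<bar> \<le> \<bar>T u i\<bar> + \<bar>e * u i\<bar>" by (rule abs_triangle_ineq)
      also have "\<dots> = 1 * \<bar>T u i\<bar> + e * \<bar>u i\<bar>" using e by (simp add: abs_mult)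
      also have "\<dots> \<le> max 1 e * \<bar>T u i\<bar> + max 1 e * \<bar>u i\<bar>" by (intro add_mono mult_right_mono) auto
      finally show "\<bar>S u i\<bar> \<le> max 1 e * (\<bar>T u i\<bar> + \<bar>u i\<bar>)"
        using \<open>i < N\<close> by (simp add: S_apply distrib_left)
    qed
  qed
  have "fun_dist N p T S \<le> real N * e"
  proof (subst fun_dist_le_iff[OF p])
    show "0 \<le> real N * e" using e by simp
    have "(\<integral>u. diff_cost N p T S u \<partial>cube N) \<le> (\<integral>u. (real N * e) powr expo p \<partial>cube N)"
    proof (rule integral_mono[OF integrable_diff_cost[OF p T(1) Sint]])
      fix u assume u: "u \<in> space (cube N)"
      show "diff_cost N p T S u \<le> (real N * e) powr expo p"
      proof (rule cost_le_of_small[OF p])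
        fix i assume i: "i < N"
        then have "u i \<in> {0<..<1}" using u by (auto simp: space_cube)
        then show "\<bar>T u i - S u i\<bar> \<le> e"
          using e i mult_left_le[of "u i" e] by (simp add: S_apply abs_mult)
      qed (use e in simp)
    qed simp
    then show "(\<integral>u. diff_cost N p T S u \<partial>cube N) \<le> (real N * e) powr expo p" 
      by (simp add: cube.prob_space)
  qed
  then show thesis by (intro that[OF Sint SIT]) (use Ne in simp)
qed

lemma Lp_dist_p_integrable:
  "p_integrable N p S \<Longrightarrow> p_integrable N p T \<Longrightarrow> Lp_dist N p (ae_class N S) (ae_class N T) = fun_dist N p S T"
  by (intro Lp_dist_ae_class p_integrable_measurable)

lemma mcomplete_IT:
  assumes p: "p = 0 \<or> 1 \<le> p"
  shows "Metric_space.mcomplete (Lp_IT N p) (Lp_dist N p)"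
proof -
  interpret Metric_space "Lp_IT N p" "Lp_dist N p"
    using Metric_space.subspace[OF Metric_space_Lp[OF p] Lp_IT_subset] .
  show ?thesis
    unfolding mcomplete_def
  proof (intro allI impI)
    fix \<sigma> assume \<sigma>: "MCauchy \<sigma>"
    then have mem: "\<sigma> n \<in> Lp_IT N p" for n unfolding MCauchy_def by blast
    then have "\<forall>n. \<exists>T. \<sigma> n = ae_class N T \<and> p_integrable N p T \<and> increasing_triangular N T"
      unfolding Lp_IT_def by blast
    then obtain T where T: "\<And>n. \<sigma> n = ae_class N (T n)" "\<And>n. p_integrable N p (T n)" "\<And>n. increasing_triangular N (T n)"
      by metis
    have d: "Lp_dist N p (\<sigma> m) (\<sigma> n) = fun_dist N p (T m) (T n)" for m n
      unfolding T(1) by (rule Lp_dist_p_integrable[OF T(2) T(2)])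
    have "cauchy_in N p T"
      unfolding cauchy_in_def
    proof (intro allI impI)
      fix e :: real assume "0 < e"
      then obtain M where "\<forall>n n'. M \<le> n \<longrightarrow> M \<le> n' \<longrightarrow> fun_dist N p (T n) (T n') < e"
        using \<sigma> unfolding MCauchy_def d by meson
      then show "\<exists>M. \<forall>m\<ge>M. \<forall>n\<ge>M. fun_dist N p (T m) (T n) < e" by blast
    qed
    then obtain g where g: "p_integrable N p g" "increasing_triangular N g" "(\<lambda>n. fun_dist N p (T n) g) \<longlonglongrightarrow> 0"
      by (rule cauchy_in_IT_limit[OF p T(2,3)])
    have "limitin mtopology \<sigma> (ae_class N g) sequentially"
      unfolding limitin_metric_dist_null
    proof (intro conjI)
      show "ae_class N g \<in> Lp_IT N p" using g by (auto simp: Lp_IT_def)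
      show "\<forall>\<^sub>F n in sequentially. \<sigma> n \<in> Lp_IT N p" using mem by simp
      show "(\<lambda>n. Lp_dist N p (\<sigma> n) (ae_class N g)) \<longlonglongrightarrow> 0"
        using g(3) unfolding T(1) Lp_dist_p_integrable[OF T(2) g(1)] .
    qed
    then show "\<exists>x. limitin mtopology \<sigma> x sequentially" by blast
  qed
qed

text \<open>Since the three sets are nested, density of the smallest and closedness of the largest
  settle both closures at once. Closedness follows from completeness.\<close>

lemma closures:
  assumes p: "p = 0 \<or> 1 \<le> p"
  shows "Lp_topology N p closure_of Lp_SIT N p = Lp_IT N p"
    and "Lp_topology N p closure_of Lp_quantile N p = Lp_IT N p"
proof -
  interpret Metric_space "Lp N p" "Lp_dist N p" by (rule Metric_space_Lp[OF p])
  interpret Submetric "Lp N p" "Lp_dist N p" "Lp_IT N p"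
    by unfold_locales (rule Lp_IT_subset)
  have closed: "closedin mtopology (Lp_IT N p)"
    by (rule mcomplete_imp_closedin[OF mcomplete_IT[OF p]])
  have dense: "Lp_IT N p \<subseteq> mtopology closure_of Lp_SIT N p"
  proof
    fix F assume F: "F \<in> Lp_IT N p"
    then obtain T where T: "F = ae_class N T" "p_integrable N p T" "increasing_triangular N T"
      by (auto simp: Lp_IT_def)
    have "\<exists>G\<in>Lp_SIT N p. G \<in> mball F r" if r: "0 < r" for r
    proof -
      obtain S where S: "p_integrable N p S" "strictly_increasing_triangular N S" "fun_dist N p T S < r"
        by (rule SIT_approximation[OF p T(2,3) r])
      have "ae_class N S \<in> Lp_SIT N p" using S by (auto simp: Lp_SIT_def)
      moreover from this have "ae_class N S \<in> mball F r"
        unfolding in_mball T(1) Lp_dist_p_integrable[OF T(2) S(1)]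
        using S(3) F T(1) Lp_IT_subset[of N p] Lp_quantile_subset[of N p] Lp_SIT_subset[of N p] by blast
      ultimately show ?thesis by blast
    qed
    then show "F \<in> mtopology closure_of Lp_SIT N p"
      using F Lp_IT_subset[of N p] unfolding metric_closure_of by blast
  qed
  have mono: "mtopology closure_of Lp_SIT N p \<subseteq> mtopology closure_of Lp_quantile N p"
    by (rule closure_of_mono[OF Lp_SIT_subset])
  have upper: "mtopology closure_of Lp_quantile N p \<subseteq> Lp_IT N p"
    by (rule closure_of_minimal[OF Lp_quantile_subset closed])
  show "mtopology closure_of Lp_SIT N p = Lp_IT N p" "mtopology closure_of Lp_quantile N p = Lp_IT N p"
    using dense mono upper by blast+
qed

section \<open>Measures and classes of quantile processes\<close>

lemma p_integrable_iff_law: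
  assumes "T \<in> measurable (cube N) (RN N)"
  shows "p_integrable N p T \<longleftrightarrow> law N T \<in> Pp N p"
proof -
  have "pow_sum N p \<in> borel_measurable (RN N)"
    by (rule measurable_pow_sum) (rule measurable_component_singleton, simp)
  then have "integrable (law N T) (pow_sum N p) \<longleftrightarrow> integrable (cube N) (\<lambda>u. pow_sum N p (T u))"
    by (rule integrable_distr_eq[OF assms])
  then show ?thesis
    using assms prob_space_law[OF assms] by (auto simp: p_integrable_def Pp_def space_prob_algebra)
qed

text \<open>Uniqueness of the quantile process with a given law is what gives the definite
  description in \<open>Q\<close> its value.\<close>

lemma Q_law:
  assumes T: "quantile_process N T"
  shows "Q N (law N T) = ae_class N T"
  unfolding Q_def
proof (rule the_equality)
  show "\<exists>S. quantile_process N S \<and> law N S = law N T \<and> ae_class N T = ae_class N S" using T by blast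
  fix F assume "\<exists>S. quantile_process N S \<and> law N S = law N T \<and> F = ae_class N S"
  then obtain S where S: "quantile_process N S" "law N S = law N T" "F = ae_class N S" by blast
  show "F = ae_class N T"
    unfolding S(3) using ae_class_eq_iff[OF IT_measurable[OF quantile_process_IT[OF S(1)]]] quantile_law_unique[OF S(1) T S(2)] by blast
qed

lemma quantile_process_exists:
  assumes "\<mu> \<in> Pp N p"
  obtains T where "quantile_process N T" "law N T = \<mu>" "p_integrable N p T" "Q N \<mu> = ae_class N T"
proof -
  have "prob_space \<mu>" "sets \<mu> = sets (RN N)" using assms by (auto simp: Pp_def space_prob_algebra)
  then obtain G where G: "\<forall>k. step (RN k) (G k)" "law N (build G N) = \<mu>" using build_exists by blast
  have T: "quantile_process N (build G N)" by (rule quantile_process_build) (use G in blast)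
  then show thesis
    using that[OF T G(2)] p_integrable_iff_law[OF IT_measurable[OF quantile_process_IT[OF T]], of p] Q_law[OF T] assms G(2) by simp
qed

lemma law_cong_AE:
  assumes "S \<in> measurable (cube N) (RN N)" "T \<in> measurable (cube N) (RN N)" "AE u in cube N. S u = T u"
  shows "law N S = law N T"
  using assms by (intro distr_cong_AE) auto

lemma Q_inj:
  assumes "\<mu> \<in> Pp N p" "\<nu> \<in> Pp N p" "Q N \<mu> = Q N \<nu>"
  shows "\<mu> = \<nu>"
proof -
  obtain S where S: "law N S = \<mu>" "p_integrable N p S" "Q N \<mu> = ae_class N S"
    using quantile_process_exists[OF assms(1)] by metis
  obtain T where T: "law N T = \<nu>" "p_integrable N p T" "Q N \<nu> = ae_class N T"
    using quantile_process_exists[OF assms(2)] by metis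
  note m = p_integrable_measurable[OF S(2)] p_integrable_measurable[OF T(2)]
  have "ae_class N S = ae_class N T" using assms(3) S(3) T(3) by simp
  then have "AE u in cube N. S u = T u" using ae_class_eq_iff[OF m(1)] by blast
  then show ?thesis using law_cong_AE[OF m] S(1) T(1) by simp
qed

text \<open>As \<open>KR\<close> is the distance of classes pulled back along \<open>Q\<close>, this
  and \<open>Q_inj\<close> identify the measures isometrically with the classes of quantile
  processes.\<close>

lemma Q_image: "Q N ` Pp N p = Lp_quantile N p"
proof (intro equalityI subsetI)
  fix F assume "F \<in> Q N ` Pp N p"
  then obtain \<mu> where \<mu>: "\<mu> \<in> Pp N p" "F = Q N \<mu>" by blast
  obtain T where "quantile_process N T" "p_integrable N p T" "Q N \<mu> = ae_class N T"
    using quantile_process_exists[OF \<mu>(1)] by metis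
  then show "F \<in> Lp_quantile N p" using \<mu>(2) by (auto simp: Lp_quantile_def)
next
  fix F assume "F \<in> Lp_quantile N p"
  then obtain T where T: "F = ae_class N T" "p_integrable N p T" "quantile_process N T" by (auto simp: Lp_quantile_def)
  have "law N T \<in> Pp N p" using p_integrable_iff_law[OF p_integrable_measurable[OF T(2)]] T(2) by blast
  then show "F \<in> Q N ` Pp N p" unfolding T(1) Q_law[OF T(3), symmetric] by (rule imageI)
qed

lemma metric_completion_IT:
  assumes p: "p = 0 \<or> 1 \<le> p"
  shows "metric_completion_of (Pp N p) (KR N p) (Lp_IT N p) (Lp_dist N p)"
proof -
  interpret L: Metric_space "Lp N p" "Lp_dist N p" by (rule Metric_space_Lp[OF p])
  interpret Submetric "Lp N p" "Lp_dist N p" "Lp_IT N p"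
    by unfold_locales (rule Lp_IT_subset)
  have QL: "Q N \<mu> \<in> Lp N p" if "\<mu> \<in> Pp N p" for \<mu>
    using Q_image[of N p] Lp_quantile_subset[of N p] Lp_IT_subset[of N p] that by blast
  have "Metric_space (Pp N p) (KR N p)"
  proof
    fix \<mu> \<nu> :: "(nat \<Rightarrow> real) measure"
    show "0 \<le> KR N p \<mu> \<nu>" "KR N p \<mu> \<nu> = KR N p \<nu> \<mu>"
      unfolding KR_def by (simp, rule L.commute)
    assume \<mu>: "\<mu> \<in> Pp N p" and \<nu>: "\<nu> \<in> Pp N p"
    show "KR N p \<mu> \<nu> = 0 \<longleftrightarrow> \<mu> = \<nu>"
      unfolding KR_def L.zero[OF QL[OF \<mu>] QL[OF \<nu>]] using Q_inj[OF \<mu> \<nu>] by blast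
    fix \<kappa> assume \<kappa>: "\<kappa> \<in> Pp N p"
    show "KR N p \<mu> \<kappa> \<le> KR N p \<mu> \<nu> + KR N p \<nu> \<kappa>"
      unfolding KR_def by (intro L.triangle QL \<mu> \<nu> \<kappa>)
  qed
  moreover have "Q N \<in> Pp N p \<rightarrow> Lp_IT N p"
    using Q_image[of N p] Lp_quantile_subset[of N p] by blast
  \<comment> \<open>The closure is taken in the subspace \<open>Lp_IT N p\<close>, where it is the
    ambient closure cut down to that subspace.\<close>
  moreover have "sub.mtopology closure_of (Q N ` Pp N p) = Lp_IT N p"
    unfolding Q_image mtopology_submetric closure_of_subtopology
    using closures(2)[OF p, of N] Lp_quantile_subset[of N p] by (simp add: Int_absorb1)
  ultimately show ?thesis
    unfolding metric_completion_of_def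
    using mcomplete_IT[OF p] sub.Metric_space_axioms by (auto simp: KR_def intro!: exI[of _ "Q N"])
qed

lemma triangular_regular_iff:
  assumes \<mu>: "\<mu> \<in> Pp N p"
  shows "triangular_regular N \<mu> \<longleftrightarrow> Q N \<mu> \<in> Lp_SIT N p"
proof
  assume "triangular_regular N \<mu>"
  then obtain T where T: "quantile_process N T" "prop_sinc N T" "law N T = \<mu>"
    by (rule triangular_regular_imp_SIT)
  have "p_integrable N p T"
    using p_integrable_iff_law[OF IT_measurable[OF quantile_process_IT[OF T(1)]], of p] T(3) \<mu> by simp
  moreover have "strictly_increasing_triangular N T"
    using T(1,2) by (simp add: quantile_process_def strictly_increasing_triangular_def)
  ultimately show "Q N \<mu> \<in> Lp_SIT N p"
    using Q_law[OF T(1)] T(3) by (auto simp: Lp_SIT_def)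
next
  assume "Q N \<mu> \<in> Lp_SIT N p"
  then obtain T where T: "Q N \<mu> = ae_class N T" "p_integrable N p T" "strictly_increasing_triangular N T"
    by (auto simp: Lp_SIT_def)
  obtain S where S: "law N S = \<mu>" "p_integrable N p S" "Q N \<mu> = ae_class N S"
    using quantile_process_exists[OF \<mu>] by metis
  note m = p_integrable_measurable[OF S(2)] p_integrable_measurable[OF T(2)]
  \<comment> \<open>The strictly increasing map in the class need not be the one that produced
    \<open>Q N \<mu>\<close>; being almost everywhere equal to it, it has the same law.\<close>
  have "AE u in cube N. S u = T u" using ae_class_eq_iff[OF m(1), of T] S(3) T(1) by simp
  then have "law N T = \<mu>" using law_cong_AE[OF m] S(1) by simp
  moreover have "triangular_regular N (law N T)"
    using T(3) by (intro SIT_imp_triangular_regular SIT_quantile_process) (simp_all add: strictly_increasing_triangular_def)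
  ultimately show "triangular_regular N \<mu>" by simp
qed

theorem theorem1p7:
  fixes N :: nat and p :: real
  assumes "p = 0 \<or> 1 \<le> p"
  shows
    "(Lp_convex_cone N (Lp_SIT N p) \<and>
      Lp_convex_cone N (Lp_quantile N p) \<and>
      Lp_convex_cone N (Lp_IT N p)) \<and>
     (Lp_topology N p closure_of Lp_quantile N p = Lp_IT N p \<and>
      metric_completion_of (Pp N p) (KR N p) (Lp_IT N p) (Lp_dist N p)) \<and>
     (\<forall>\<mu>\<in>Pp N p. triangular_regular N \<mu> \<longleftrightarrow> Q N \<mu> \<in> Lp_SIT N p) \<and>
     (Lp_SIT N p \<subseteq> Lp_quantile N p \<and>
      subtopology (Lp_topology N p) (Lp_quantile N p) closure_of Lp_SIT N p = Lp_quantile N p)"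
proof (intro conjI ballI)
  \<comment> \<open>The ambient closure of \<open>Lp_SIT N p\<close> is all of
    \<open>Lp_IT N p\<close>, so intersecting it with \<open>Lp_quantile N p\<close> leaves the
    latter.\<close>
  show "subtopology (Lp_topology N p) (Lp_quantile N p) closure_of Lp_SIT N p = Lp_quantile N p"
    unfolding closure_of_subtopology
    using closures(1)[OF assms, of N] Lp_SIT_subset[of N p] Lp_quantile_subset[of N p]
    by (simp add: Int_absorb1 Int_absorb2)
qed (simp_all add: convex_cones[OF assms] closures[OF assms] metric_completion_IT[OF assms] triangular_regular_iff Lp_SIT_subset)

end
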